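(* Let $U:\mathbb{R}^d\to\mathbb{R}$ satisfy (A1), (A2), (A3) of the context, with constants $L,M,N,K,\mathcal{R}$. Fix $T,R_2,h_1\in(0,\infty)$ such that $$L(T+h_1)^2\le\min\left(\frac KL,\frac14,\frac1{256\,L\mathcal{R}^2}\right).$$ Put $\gamma=\min(T^{-1},\mathcal{R}^{-1}/4)$, $a=T^{-1}$, $R_1=\frac52(\mathcal{R}+T)$, $f(r)=\int_0^r\exp(-a\min(s,R_1))\,ds$. Consider (adjusted or unadjusted) numerical HMC with step size $h$ and the coupling $(X'(x,y),Y'(x,y))$ of two of its transition steps described in the context (with this $\gamma$); let $r(x,y)=|x-y|$ and $R'(x,y)=|X'(x,y)-Y'(x,y)|$. Then there exists $h_\star>0$ depending only on $K,L,M,N,\mathcal{R},T,R_2$ and $d$ such that for any $h\in(0,\min(h_\star,h_1)]$ with $T/h\in\mathbb{Z}$ and any $x,y\in\mathbb{R}^d$ with $\max(|x|,|y|)\le R_2$, $$E[f(R'(x,y))]\le(1-c)\,f(r(x,y)),$$ where $$c=\frac1{10}\min\left(1,\ \frac12KT^2\Big(1+\frac{\mathcal{R}}{T}\Big)e^{-\mathcal{R}/(2T)}\right)e^{-2\mathcal{R}/T}.$$ Moreover, for fixed $K,L,M$ and $N$, $h_\star$ can be chosen such that $h_\star^{-1}$ is of order $O(R_2)$ for unadjusted numerical HMC, and of order $O\big((1+T^{-1/2}+\mathcal{R}^{1/2})(R_2^2+d)\big)$ for adjusted numerical HMC.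
   Context: Assumptions on $U$: $U\in C^4(\mathbb{R}^d)$ with $\int_{\mathbb{R}^d}e^{-U(x)}dx<\infty$, and (A1) $U$ has a local minimum at $0$ and $U(0)=0$; (A2) $U$ has bounded second, third and fourth derivatives; $L=\sup\|\nabla^2U\|$, $M=\sup\|\nabla^3U\|$, $N=\sup\|\nabla^4U\|$; (A3) there are constants $\mathcal{R}\in[0,\infty)$, $K\in(0,\infty)$ such that $(x-y)\cdot(\nabla U(x)-\nabla U(y))\ge K|x-y|^2$ for all $x,y\in\mathbb{R}^d$ with $|x-y|\ge\mathcal{R}$. $|\cdot|$ is the Euclidean norm. If $\mathcal{R}=0$, then $1/\mathcal{R}$ and $1/\mathcal{R}^2$ are read as $+\infty$. Hamiltonian: $H(x,v)=U(x)+\frac12|v|^2$. Velocity Verlet flow with step size $h>0$: with $\lfloor t\rfloor_h=\max\{s\in h\mathbb{Z}:s\le t\}$ and $\lceil t\rceil_h=\min\{s\in h\mathbb{Z}:s\ge t\}$, $(q_t(x,v),p_t(x,v))$ is the solution of $$\tfrac{d}{dt}q_t=p_{\lfloor t\rfloor_h}-\tfrac h2\nabla U(q_{\lfloor t\rfloor_h}),\qquad \tfrac d{dt}p_t=-\tfrac12\big(\nabla U(q_{\lfloor t\rfloor_h})+\nabla U(q_{\lceil t\rceil_h})\big),\qquad (q_0,p_0)=(x,v).$$ Numerical HMC transition step: $X'(x)=q_T(x,\xi)I_{A(x)}+xI_{A(x)^C}$, where $\xi\sim N(0,I_d)$ and $\mathcal{U}\sim\mathrm{Unif}(0,1)$ are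 independent and $A(x)=\{\mathcal{U}\le\exp(H(x,\xi)-H(q_T(x,\xi),p_T(x,\xi)))\}$ for adjusted HMC, $A(x)=\Omega$ (the whole probability space) for unadjusted HMC. Coupling: let $\xi\sim N(0,I_d)$, $\mathcal{U},\tilde{\mathcal{U}}\sim\mathrm{Unif}(0,1)$ be independent. Put $X'(x,y)=q_T(x,\xi)I_{A(x)}+xI_{A(x)^C}$ and $Y'(x,y)=q_T(y,\eta)I_{\hat A(y)}+yI_{\hat A(y)^C}$, where $A(x)=\{\mathcal{U}\le\exp(H(x,\xi)-H(q_T(x,\xi),p_T(x,\xi)))\}$ (adjusted) or $A(x)=\Omega$ (unadjusted) and, with the same $\mathcal{U}$, $\hat A(y)=\{\mathcal{U}\le\exp(H(y,\eta)-H(q_T(y,\eta),p_T(y,\eta)))\}$ (adjusted) or $\hat A(y)=\Omega$ (unadjusted), and - if $|x-y|\ge2\mathcal{R}$, $\eta=\xi$ (synchronous coupling); - if $|x-y|<2\mathcal{R}$, with $z=x-y$, $e=z/|z|$ and $\varphi_{0,1}$ the standard normal density on $\mathbb{R}$, $\eta=\xi+\gamma z$ if $\tilde{\mathcal{U}}\le\varphi_{0,1}(e\cdot\xi+\gamma|z|)/\varphi_{0,1}(e\cdot\xi)$, and $\eta=\xi-2(e\cdot\xi)e$ otherwise (for $z=0$ this gives $\eta=\xi$). *)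

theory Defs
  imports "HOL-Probability.Probability"
begin

(* The constants in the order statements for the step size bound must not depend on the
   dimension d, so d has to be quantified inside a formula. Vectors of R^d are therefore
   functions on {..<d}, extended by undefined, i.e. the points of the d-fold product of
   lborel. The topology used on them is the product topology. *)

definition Rd :: "nat \<Rightarrow> (nat \<Rightarrow> real) set" where
  "Rd d = PiE {..<d} (\<lambda>_. UNIV)"

abbreviation vnorm :: "nat \<Rightarrow> (nat \<Rightarrow> real) \<Rightarrow> real" where
  "vnorm d x \<equiv> L2_set x {..<d}"

abbreviation vdist :: "nat \<Rightarrow> (nat \<Rightarrow> real) \<Rightarrow> (nat \<Rightarrow> real) \<Rightarrow> real" where
  "vdist d x y \<equiv> L2_set (\<lambda>i. x i - y i) {..<d}"

definition vinner :: "nat \<Rightarrow> (nat \<Rightarrow> real) \<Rightarrow> (nat \<Rightarrow> real) \<Rightarrow> real" where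
  "vinner d x y = (\<Sum>i<d. x i * y i)"


definition partial :: "nat \<Rightarrow> ((nat \<Rightarrow> real) \<Rightarrow> real) \<Rightarrow> (nat \<Rightarrow> real) \<Rightarrow> real" where
  "partial i F x = deriv (\<lambda>t. F (x(i := t))) (x i)"

fun partials :: "nat list \<Rightarrow> ((nat \<Rightarrow> real) \<Rightarrow> real) \<Rightarrow> (nat \<Rightarrow> real) \<Rightarrow> real" where
  "partials [] F = F"
| "partials (i # is) F = partial i (partials is F)"

(* deriv is total, so the existence of each partial derivative is required separately. *)
definition C_k :: "nat \<Rightarrow> nat \<Rightarrow> ((nat \<Rightarrow> real) \<Rightarrow> real) \<Rightarrow> bool" where
  "C_k d k F \<longleftrightarrow>
     (\<forall>is. set is \<subseteq> {..<d} \<and> length is \<le> k \<longrightarrow> continuous_on (Rd d) (partials is F)) \<and>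
     (\<forall>is. set is \<subseteq> {..<d} \<and> length is < k \<longrightarrow>
        (\<forall>i<d. \<forall>x\<in>Rd d. (\<lambda>t. partials is F (x(i := t))) differentiable (at (x i))))"

definition grad :: "nat \<Rightarrow> ((nat \<Rightarrow> real) \<Rightarrow> real) \<Rightarrow> (nat \<Rightarrow> real) \<Rightarrow> nat \<Rightarrow> real" where
  "grad d F x = (\<lambda>i\<in>{..<d}. partial i F x)"

(* The multilinear form given by the derivative of order k = length vs, applied to the
   vectors in vs: the sum over i_1, ..., i_k of the mixed partials times
   v_1(i_1) * ... * v_k(i_k). *)
definition deriv_form ::
  "nat \<Rightarrow> ((nat \<Rightarrow> real) \<Rightarrow> real) \<Rightarrow> (nat \<Rightarrow> real) \<Rightarrow> (nat \<Rightarrow> real) list \<Rightarrow> real" where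
  "deriv_form d F x vs =
     (\<Sum>is | set is \<subseteq> {..<d} \<and> length is = length vs.
        partials is F x * (\<Prod>j<length vs. (vs ! j) (is ! j)))"

definition deriv_norm :: "nat \<Rightarrow> nat \<Rightarrow> ((nat \<Rightarrow> real) \<Rightarrow> real) \<Rightarrow> (nat \<Rightarrow> real) \<Rightarrow> real" where
  "deriv_norm d k F x =
     Sup {\<bar>deriv_form d F x vs\<bar> | vs. length vs = k \<and> (\<forall>v\<in>set vs. v \<in> Rd d \<and> vnorm d v \<le> 1)}"

definition potential ::
  "nat \<Rightarrow> ((nat \<Rightarrow> real) \<Rightarrow> real) \<Rightarrow> real \<Rightarrow> real \<Rightarrow> real \<Rightarrow> real \<Rightarrow> real \<Rightarrow> bool" where
  "potential d U L M N K R \<longleftrightarrow>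
     C_k d 4 U \<and>
     integrable (\<Pi>\<^sub>M i\<in>{..<d}. lborel) (\<lambda>x. exp (- U x)) \<and>
     (\<exists>\<epsilon>>0. \<forall>x\<in>Rd d. vnorm d x < \<epsilon> \<longrightarrow> U (\<lambda>i\<in>{..<d}. 0) \<le> U x) \<and>
     U (\<lambda>i\<in>{..<d}. 0) = 0 \<and>
     (\<forall>k\<in>{2, 3, 4}. bdd_above (deriv_norm d k U ` Rd d)) \<and>
     L = (SUP x\<in>Rd d. deriv_norm d 2 U x) \<and>
     M = (SUP x\<in>Rd d. deriv_norm d 3 U x) \<and>
     N = (SUP x\<in>Rd d. deriv_norm d 4 U x) \<and>
     0 \<le> R \<and> 0 < K \<and>
     (\<forall>x\<in>Rd d. \<forall>y\<in>Rd d. R \<le> vdist d x y \<longrightarrow>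
        vinner d (\<lambda>i. x i - y i) (\<lambda>i. grad d U x i - grad d U y i) \<ge> K * (vdist d x y)\<^sup>2)"


definition grid_floor :: "real \<Rightarrow> real \<Rightarrow> real" where
  "grid_floor h t = h * of_int \<lfloor>t / h\<rfloor>"

definition grid_ceiling :: "real \<Rightarrow> real \<Rightarrow> real" where
  "grid_ceiling h t = h * of_int \<lceil>t / h\<rceil>"

(* The right-hand sides jump at the grid points, so the differential equations are imposed
   off the grid and the trajectories are required to be continuous. *)
definition verlet_solution ::
  "nat \<Rightarrow> ((nat \<Rightarrow> real) \<Rightarrow> real) \<Rightarrow> real \<Rightarrow> (nat \<Rightarrow> real) \<Rightarrow> (nat \<Rightarrow> real) \<Rightarrow>
   (real \<Rightarrow> nat \<Rightarrow> real) \<Rightarrow> (real \<Rightarrow> nat \<Rightarrow> real) \<Rightarrow> bool" where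
  "verlet_solution d U h x v q p \<longleftrightarrow>
     q 0 = x \<and> p 0 = v \<and>
     (\<forall>t\<ge>0. q t \<in> Rd d \<and> p t \<in> Rd d) \<and>
     (\<forall>i<d. continuous_on {0..} (\<lambda>t. q t i) \<and> continuous_on {0..} (\<lambda>t. p t i)) \<and>
     (\<forall>t>0. t / h \<notin> \<int> \<longrightarrow> (\<forall>i<d.
        ((\<lambda>s. q s i) has_real_derivative
           p (grid_floor h t) i - h / 2 * grad d U (q (grid_floor h t)) i) (at t) \<and>
        ((\<lambda>s. p s i) has_real_derivative
           - (1 / 2) * (grad d U (q (grid_floor h t)) i + grad d U (q (grid_ceiling h t)) i)) (at t)))"

(* Well-defined for h > 0 and t >= 0 by verlet_solution_exists and verlet_solution_unique. *)
definition verlet_flow ::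
  "nat \<Rightarrow> ((nat \<Rightarrow> real) \<Rightarrow> real) \<Rightarrow> real \<Rightarrow> real \<Rightarrow> (nat \<Rightarrow> real) \<Rightarrow> (nat \<Rightarrow> real) \<Rightarrow>
   (nat \<Rightarrow> real) \<times> (nat \<Rightarrow> real)" where
  "verlet_flow d U h t x v =
     (THE z. \<exists>q p. verlet_solution d U h x v q p \<and> z = (q t, p t))"

definition hamiltonian ::
  "nat \<Rightarrow> ((nat \<Rightarrow> real) \<Rightarrow> real) \<Rightarrow> (nat \<Rightarrow> real) \<times> (nat \<Rightarrow> real) \<Rightarrow> real" where
  "hamiltonian d U z = U (fst z) + 1 / 2 * (vnorm d (snd z))\<^sup>2"

(* Adjusted HMC if adj holds, unadjusted HMC otherwise; v is the initial velocity and u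
   the uniform variable of the accept-reject step. *)
definition hmc_accept ::
  "bool \<Rightarrow> nat \<Rightarrow> ((nat \<Rightarrow> real) \<Rightarrow> real) \<Rightarrow> real \<Rightarrow> real \<Rightarrow> real \<Rightarrow>
   (nat \<Rightarrow> real) \<Rightarrow> (nat \<Rightarrow> real) \<Rightarrow> bool" where
  "hmc_accept adj d U h T u x v \<longleftrightarrow>
     (adj \<longrightarrow> u \<le> exp (hamiltonian d U (x, v) - hamiltonian d U (verlet_flow d U h T x v)))"

definition hmc_step ::
  "bool \<Rightarrow> nat \<Rightarrow> ((nat \<Rightarrow> real) \<Rightarrow> real) \<Rightarrow> real \<Rightarrow> real \<Rightarrow> real \<Rightarrow>
   (nat \<Rightarrow> real) \<Rightarrow> (nat \<Rightarrow> real) \<Rightarrow> nat \<Rightarrow> real" where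
  "hmc_step adj d U h T u x v =
     (if hmc_accept adj d U h T u x v then fst (verlet_flow d U h T x v) else x)"

(* For x = y division by zero gives e = 0 and hence the value v in both branches. *)
definition coupled_velocity ::
  "nat \<Rightarrow> real \<Rightarrow> real \<Rightarrow> (nat \<Rightarrow> real) \<Rightarrow> (nat \<Rightarrow> real) \<Rightarrow> (nat \<Rightarrow> real) \<Rightarrow> real \<Rightarrow> nat \<Rightarrow> real" where
  "coupled_velocity d R \<gamma> x y v u =
     (let r = vdist d x y;
          e = (\<lambda>i. (x i - y i) / r);
          s = vinner d e v
      in if r \<ge> 2 * R then v
         else if u \<le> std_normal_density (s + \<gamma> * r) / std_normal_density s
              then (\<lambda>i\<in>{..<d}. v i + \<gamma> * (x i - y i))
              else (\<lambda>i\<in>{..<d}. v i - 2 * s * e i))"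

(* The joint law of a standard normal vector of R^d and two uniform variables on (0,1),
   all independent. *)
definition coupling_measure :: "nat \<Rightarrow> ((nat \<Rightarrow> real) \<times> real \<times> real) measure" where
  "coupling_measure d =
     (\<Pi>\<^sub>M i\<in>{..<d}. density lborel std_normal_density) \<Otimes>\<^sub>M
       (uniform_measure lborel {0<..<1} \<Otimes>\<^sub>M uniform_measure lborel {0<..<1})"

(* R' as a function of the realisation (\<xi>, u, u') *)
definition coupled_distance ::
  "bool \<Rightarrow> nat \<Rightarrow> ((nat \<Rightarrow> real) \<Rightarrow> real) \<Rightarrow> real \<Rightarrow> real \<Rightarrow> real \<Rightarrow> real \<Rightarrow>
   (nat \<Rightarrow> real) \<Rightarrow> (nat \<Rightarrow> real) \<Rightarrow> (nat \<Rightarrow> real) \<times> real \<times> real \<Rightarrow> real" where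
  "coupled_distance adj d U h T R \<gamma> x y = (\<lambda>(\<xi>, u, u').
     vdist d (hmc_step adj d U h T u x \<xi>)
             (hmc_step adj d U h T u y (coupled_velocity d R \<gamma> x y \<xi> u')))"

definition concave_metric :: "real \<Rightarrow> real \<Rightarrow> real \<Rightarrow> real" where
  "concave_metric a R\<^sub>1 r = integral {0..r} (\<lambda>s. exp (- (a * min s R\<^sub>1)))"


lemma off_grid:
  fixes h t :: real
  assumes h: "h > 0" and t: "real k * h < t" "t < real (Suc k) * h"
  shows "t / h \<notin> \<int>" "grid_floor h t = real k * h" "grid_ceiling h t = real (Suc k) * h"
proof -
  have a: "real k < t / h" "t / h < real k + 1"
    using h t by (auto simp: field_simps)
  have f: "\<lfloor>t / h\<rfloor> = int k" using a by linarith
  have c: "\<lceil>t / h\<rceil> = int k + 1" using a by linarith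
  show "t / h \<notin> \<int>"
  proof
    assume "t / h \<in> \<int>"
    then obtain n where n: "t / h = of_int n" by (auto simp: Ints_def)
    with f have "n = int k" by simp
    with n a show False by simp
  qed
  show "grid_floor h t = real k * h" by (simp add: grid_floor_def f)
  show "grid_ceiling h t = real (Suc k) * h" by (simp add: grid_ceiling_def c algebra_simps)
qed

lemma off_gridE:
  fixes h t :: real
  assumes h: "h > 0" and t: "t > 0" "t / h \<notin> \<int>"
  obtains k where "real k * h < t" "t < real (Suc k) * h"
proof -
  define k where "k = nat \<lfloor>t / h\<rfloor>"
  have "t / h > 0" using h t by simp
  then have k: "real k = of_int \<lfloor>t / h\<rfloor>" unfolding k_def by simp
  have "real k \<noteq> t / h" using t(2) k by (metis Ints_of_int)
  then have "real k < t / h" "t / h < real k + 1" unfolding k by linarith+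
  then show thesis using h by (intro that[of k]) (auto simp: field_simps)
qed

lemma interpolation_exists:
  fixes a :: "nat \<Rightarrow> real"
  assumes h: "h > 0"
  shows "\<exists>g. continuous_on {0..} g \<and> (\<forall>k. g (real k * h) = a k) \<and>
     (\<forall>k t. real k * h < t \<longrightarrow> t < real (Suc k) * h \<longrightarrow>
        (g has_real_derivative (a (Suc k) - a k) / h) (at t))"
proof -
  define c where "c k t = max 0 (min 1 (t / h - real k))" for k t
  define G where "G n t = a 0 + (\<Sum>k<n. (a (Suc k) - a k) * c k t)" for n t
  define g where "g t = G (Suc (nat \<lfloor>t / h\<rfloor>)) t" for t
  have cont: "continuous_on UNIV (G n)" for n
    unfolding G_def c_def by (intro continuous_intros) (use h in auto)
  have c0: "c k t = 0" if "t \<le> real k * h" for k t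
    using that h by (auto simp: c_def field_simps)
  have c1: "c k t = 1" if "real (Suc k) * h \<le> t" for k t
  proof -
    have "1 \<le> t / h - real k" using that h by (simp add: field_simps)
    then show ?thesis by (simp add: c_def)
  qed
  have ext: "G n t = G m t" if "t \<le> real m * h" "m \<le> n" for n m t
  proof -
    have z: "c k t = 0" if "m \<le> k" for k
    proof (rule c0)
      have "real m * h \<le> real k * h" using that h by simp
      then show "t \<le> real k * h" using \<open>t \<le> real m * h\<close> by simp
    qed
    have "(\<Sum>k<n. (a (Suc k) - a k) * c k t) = (\<Sum>k<m. (a (Suc k) - a k) * c k t)"
      by (rule sum.mono_neutral_right) (use that z in auto)
    then show ?thesis by (simp add: G_def)
  qed
  have gG: "g t = G n t" if "0 \<le> t" "t \<le> real n * h" for n t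
  proof -
    define m where "m = Suc (nat \<lfloor>t / h\<rfloor>)"
    have "t / h \<le> real m" using that h unfolding m_def by (simp add: of_nat_nat) linarith
    then have m: "t \<le> real m * h" using h by (simp add: field_simps)
    show ?thesis unfolding g_def m_def[symmetric]
      using ext[OF m, of n] ext[OF that(2), of m] by (cases "m \<le> n") auto
  qed
  have gk: "g (real k * h) = a k" for k
  proof -
    have one: "c j (real k * h) = 1" if "j < k" for j
      by (rule c1, rule mult_right_mono) (use that h in simp_all)
    have "g (real k * h) = G k (real k * h)" using gG[of "real k * h" k] h by simp
    also have "\<dots> = a 0 + (\<Sum>j<k. a (Suc j) - a j)"
      unfolding G_def using one by simp
    finally show ?thesis by (simp add: sum_lessThan_telescope)
  qed
  have cg: "continuous_on {0..} g"
  proof (rule continuous_on_eq_continuous_within[THEN iffD2], rule ballI)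
    fix t :: real assume "t \<in> {0..}"
    obtain n where "(t + 1) / h \<le> real n" using real_arch_simple by blast
    then have n: "t + 1 \<le> real n * h" using h by (simp add: field_simps)
    have "continuous (at t within {0..}) (G n)"
      using continuous_on_subset[OF cont[of n], of "{0..}"] \<open>t \<in> {0..}\<close>
      unfolding continuous_on_eq_continuous_within by blast
    then show "continuous (at t within {0..}) g"
    proof (rule continuous_transform_within[where \<delta>=1])
      fix s assume "s \<in> {0..}" "dist s t < 1"
      then show "G n s = g s" using n gG[of s n] by (auto simp: dist_real_def)
    qed (use \<open>t \<in> {0..}\<close> in auto)
  qed
  have dg: "(g has_real_derivative (a (Suc k) - a k) / h) (at t)"
    if t: "real k * h < t" "t < real (Suc k) * h" for k t
  proof -
    have d: "((\<lambda>s. a k + (a (Suc k) - a k) * (s / h - real k)) has_real_derivative (a (Suc k) - a k) / h) (at t)"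
      by (rule derivative_eq_intros refl | use h in simp)+
    have e: "a k + (a (Suc k) - a k) * (s / h - real k) = g s"
      if s: "s \<in> {real k * h<..<real (Suc k) * h}" for s
    proof -
      have s': "real k * h < s" "s < real (Suc k) * h" using s by auto
      have "0 \<le> real k * h" using h by simp
      then have s0: "0 \<le> s" using s' by simp
      have one: "c j s = 1" if "j < k" for j
      proof (rule c1)
        have "real (Suc j) * h \<le> real k * h" using that h by (intro mult_right_mono) auto
        then show "real (Suc j) * h \<le> s" using s' by simp
      qed
      have ck: "c k s = s / h - real k" using s' h by (auto simp: c_def field_simps)
      have "g s = G (Suc k) s" using gG[OF s0, of "Suc k"] s' by simp
      also have "\<dots> = a 0 + (\<Sum>j<k. a (Suc j) - a j) + (a (Suc k) - a k) * c k s"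
        unfolding G_def using one by simp
      finally show ?thesis by (simp add: sum_lessThan_telescope ck)
    qed
    show ?thesis
      by (rule has_field_derivative_transform_within_open[OF d open_greaterThanLessThan _ e])
        (use t in \<open>simp_all del: of_nat_Suc\<close>)
  qed
  show ?thesis
    by (rule exI[of _ g]) (simp add: cg gk dg del: of_nat_Suc)
qed

lemma verlet_solution_exists:
  assumes h: "h > 0" and x: "x \<in> Rd d" and v: "v \<in> Rd d"
  shows "\<exists>q p. verlet_solution d U h x v q p"
proof -
  define Q where "Q z = (\<lambda>i\<in>{..<d}. fst z i + h * (snd z i - h / 2 * grad d U (fst z) i))" for z
  define P where "P z = (\<lambda>i\<in>{..<d}. snd z i - h / 2 * (grad d U (fst z) i + grad d U (Q z) i))" for z
  define Z where "Z n = ((\<lambda>z. (Q z, P z)) ^^ n) (x, v)" for n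
  have Z0: "Z 0 = (x, v)" and ZS: "Z (Suc n) = (Q (Z n), P (Z n))" for n
    by (simp_all add: Z_def)
  have ZR: "fst (Z n) \<in> Rd d" "snd (Z n) \<in> Rd d" for n
    by (cases n; simp add: Z0 ZS x v; simp add: Rd_def Q_def P_def)+
  define gq where "gq i = (SOME g. continuous_on {0..} g \<and> (\<forall>k. g (real k * h) = fst (Z k) i) \<and>
     (\<forall>k t. real k * h < t \<longrightarrow> t < real (Suc k) * h \<longrightarrow>
        (g has_real_derivative (fst (Z (Suc k)) i - fst (Z k) i) / h) (at t)))" for i
  have Gq: "continuous_on {0..} (gq i) \<and> (\<forall>k. gq i (real k * h) = fst (Z k) i) \<and>
     (\<forall>k t. real k * h < t \<longrightarrow> t < real (Suc k) * h \<longrightarrow>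
        (gq i has_real_derivative (fst (Z (Suc k)) i - fst (Z k) i) / h) (at t))" for i
    unfolding gq_def by (rule someI_ex[OF interpolation_exists[OF h]])
  note gq = Gq[THEN conjunct1] Gq[THEN conjunct2, THEN conjunct1, rule_format]
    Gq[THEN conjunct2, THEN conjunct2, rule_format]
  define gp where "gp i = (SOME g. continuous_on {0..} g \<and> (\<forall>k. g (real k * h) = snd (Z k) i) \<and>
     (\<forall>k t. real k * h < t \<longrightarrow> t < real (Suc k) * h \<longrightarrow>
        (g has_real_derivative (snd (Z (Suc k)) i - snd (Z k) i) / h) (at t)))" for i
  have Gp: "continuous_on {0..} (gp i) \<and> (\<forall>k. gp i (real k * h) = snd (Z k) i) \<and>
     (\<forall>k t. real k * h < t \<longrightarrow> t < real (Suc k) * h \<longrightarrow>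
        (gp i has_real_derivative (snd (Z (Suc k)) i - snd (Z k) i) / h) (at t))" for i
    unfolding gp_def by (rule someI_ex[OF interpolation_exists[OF h]])
  note gp = Gp[THEN conjunct1] Gp[THEN conjunct2, THEN conjunct1, rule_format]
    Gp[THEN conjunct2, THEN conjunct2, rule_format]
  define q where "q t = (\<lambda>i\<in>{..<d}. gq i t)" for t
  define p where "p t = (\<lambda>i\<in>{..<d}. gp i t)" for t
  have qk: "q (real k * h) = fst (Z k)" and pk: "p (real k * h) = snd (Z k)" for k
    using ZR[of k] unfolding q_def p_def gq(2) gp(2) Rd_def by (auto simp: PiE_def extensional_restrict)
  have "verlet_solution d U h x v q p"
    unfolding verlet_solution_def
  proof (intro conjI allI impI)
    show "q 0 = x" "p 0 = v" using qk[of 0] pk[of 0] by (simp_all add: Z0)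
    show "q t \<in> Rd d" "p t \<in> Rd d" for t by (simp_all add: q_def p_def Rd_def)
    show "continuous_on {0..} (\<lambda>t. q t i)" "continuous_on {0..} (\<lambda>t. p t i)" if "i < d" for i
      using that gq(1)[of i] gp(1)[of i] by (simp_all add: q_def p_def)
    fix t i assume t: "0 < t" "t / h \<notin> \<int>" and i: "i < d"
    obtain k where k: "real k * h < t" "t < real (Suc k) * h" using off_gridE[OF h t] by blast
    note og = off_grid[OF h k]
    show "((\<lambda>s. q s i) has_real_derivative
           p (grid_floor h t) i - h / 2 * grad d U (q (grid_floor h t)) i) (at t)"
      using gq(3)[OF k, of i] i h unfolding og qk pk by (simp add: q_def ZS Q_def)
    show "((\<lambda>s. p s i) has_real_derivative
           - (1 / 2) * (grad d U (q (grid_floor h t)) i + grad d U (q (grid_ceiling h t)) i)) (at t)"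
      using gp(3)[OF k, of i] i h unfolding og qk pk by (simp add: p_def ZS P_def)
  qed
  then show ?thesis by blast
qed

lemma affine_on_cell:
  fixes g :: "real \<Rightarrow> real"
  assumes "continuous_on {a..b} g" "\<And>t. a < t \<Longrightarrow> t < b \<Longrightarrow> (g has_real_derivative c) (at t)"
    and s: "a \<le> s" "s \<le> b"
  shows "g s = g a + c * (s - a)"
proof (cases "a = s")
  case False
  define f where "f t = g t - c * t" for t
  have "f s = f a"
  proof (rule DERIV_isconst2[of a b])
    show "a < b" "a \<le> s" "s \<le> b" using s False by auto
    show "continuous_on {a..b} f" unfolding f_def by (intro continuous_intros assms)
    show "(f has_real_derivative 0) (at t)" if "a < t" "t < b" for t
      unfolding f_def by (rule derivative_eq_intros assms that refl | simp)+
  qed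
  then show ?thesis by (simp add: f_def algebra_simps)
qed simp

lemma verlet_solution_cell:
  assumes h: "h > 0" and sol: "verlet_solution d U h x v q p" and i: "i < d"
    and s: "real k * h \<le> s" "s \<le> real (Suc k) * h"
  shows "q s i = q (real k * h) i +
           (p (real k * h) i - h / 2 * grad d U (q (real k * h)) i) * (s - real k * h)"
    and "p s i = p (real k * h) i +
           - (1 / 2) * (grad d U (q (real k * h)) i + grad d U (q (real (Suc k) * h)) i) * (s - real k * h)"
proof -
  note S = sol[unfolded verlet_solution_def]
  note sol_cont = S[THEN conjunct2, THEN conjunct2, THEN conjunct2, THEN conjunct1, rule_format]
  note sol_deriv = S[THEN conjunct2, THEN conjunct2, THEN conjunct2, THEN conjunct2, rule_format]
  have k0: "0 \<le> real k * h" using h by simp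
  have c: "continuous_on {real k * h..real (Suc k) * h} (\<lambda>t. q t i)"
          "continuous_on {real k * h..real (Suc k) * h} (\<lambda>t. p t i)"
    by (rule continuous_on_subset[OF conjunct1[OF sol_cont[OF i]]], use k0 in force)
      (rule continuous_on_subset[OF conjunct2[OF sol_cont[OF i]]], use k0 in force)
  have D: "((\<lambda>s. q s i) has_real_derivative
           p (real k * h) i - h / 2 * grad d U (q (real k * h)) i) (at t)"
          "((\<lambda>s. p s i) has_real_derivative
           - (1 / 2) * (grad d U (q (real k * h)) i + grad d U (q (real (Suc k) * h)) i)) (at t)"
    if "real k * h < t" "t < real (Suc k) * h" for t
  proof -
    note og = off_grid[OF h that]
    have "0 < t" using k0 that by simp
    note D' = sol_deriv[OF this og(1) i, unfolded og]
    show "((\<lambda>s. q s i) has_real_derivative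
           p (real k * h) i - h / 2 * grad d U (q (real k * h)) i) (at t)"
          "((\<lambda>s. p s i) has_real_derivative
           - (1 / 2) * (grad d U (q (real k * h)) i + grad d U (q (real (Suc k) * h)) i)) (at t)"
      by (rule D'[THEN conjunct1], rule D'[THEN conjunct2])
  qed
  show "q s i = q (real k * h) i +
           (p (real k * h) i - h / 2 * grad d U (q (real k * h)) i) * (s - real k * h)"
    by (rule affine_on_cell[OF c(1) D(1) s])
  show "p s i = p (real k * h) i +
           - (1 / 2) * (grad d U (q (real k * h)) i + grad d U (q (real (Suc k) * h)) i) * (s - real k * h)"
    by (rule affine_on_cell[OF c(2) D(2) s])
qed

lemma verlet_solution_unique:
  assumes h: "h > 0" and A: "verlet_solution d U h x v q p" and B: "verlet_solution d U h x v q' p'"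
    and t: "t \<ge> 0"
  shows "q t = q' t \<and> p t = p' t"
proof -
  have ext: "f = g" if "f \<in> Rd d" "g \<in> Rd d" "\<And>i. i < d \<Longrightarrow> f i = g i" for f g
    using that unfolding Rd_def by (intro PiE_ext[of f "{..<d}" "\<lambda>_. UNIV" g]) auto
  have inR: "q s \<in> Rd d" "p s \<in> Rd d" "q' s \<in> Rd d" "p' s \<in> Rd d" if "s \<ge> 0" for s
    using A[unfolded verlet_solution_def, THEN conjunct2, THEN conjunct2, THEN conjunct1, rule_format, OF that]
      B[unfolded verlet_solution_def, THEN conjunct2, THEN conjunct2, THEN conjunct1, rule_format, OF that]
    by simp_all
  have cell: "q s = q' s \<and> p s = p' s"
    if start: "q (real k * h) = q' (real k * h)" "p (real k * h) = p' (real k * h)"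
      and s: "real k * h \<le> s" "s \<le> real (Suc k) * h" for k s
  proof -
    have k0: "0 \<le> real k * h" using h by simp
    have qq: "q r = q' r" if r: "real k * h \<le> r" "r \<le> real (Suc k) * h" for r
    proof (rule ext)
      have "0 \<le> r" using k0 r by linarith
      then show "q r \<in> Rd d" "q' r \<in> Rd d" by (rule inR)+
      show "q r i = q' r i" if i: "i < d" for i
        by (rule trans[OF verlet_solution_cell(1)[OF h A i r]],
            rule trans[OF _ verlet_solution_cell(1)[OF h B i r, symmetric]]) (simp only: start)
    qed
    have e: "q (real (Suc k) * h) = q' (real (Suc k) * h)"
      by (rule qq) (use h in auto)
    have "p s = p' s"
    proof (rule ext)
      have "0 \<le> s" using k0 s by linarith
      then show "p s \<in> Rd d" "p' s \<in> Rd d" by (rule inR)+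
      show "p s i = p' s i" if i: "i < d" for i
        by (rule trans[OF verlet_solution_cell(2)[OF h A i s]],
            rule trans[OF _ verlet_solution_cell(2)[OF h B i s, symmetric]]) (simp only: start e)
    qed
    with qq[OF s] show ?thesis by simp
  qed
  have grid: "q (real k * h) = q' (real k * h) \<and> p (real k * h) = p' (real k * h)" for k
  proof (induction k)
    case 0
    then show ?case using A B by (simp add: verlet_solution_def)
  next
    case (Suc k)
    have "real k * h \<le> real (Suc k) * h" using h by simp
    then show ?case by (rule cell[OF Suc[THEN conjunct1] Suc[THEN conjunct2] _ order_refl])
  qed
  define k where "k = nat \<lfloor>t / h\<rfloor>"
  have "real k \<le> t / h" "t / h \<le> real k + 1" using h t unfolding k_def by simp_all
  then have "real k * h \<le> t" "t \<le> real (Suc k) * h" using h by (auto simp: field_simps)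
  then show ?thesis by (rule cell[OF grid[THEN conjunct1] grid[THEN conjunct2]])
qed

lemma verlet_flow_eq:
  assumes "h > 0" "t \<ge> 0" "verlet_solution d U h x v q p"
  shows "verlet_flow d U h t x v = (q t, p t)"
  unfolding verlet_flow_def
proof (rule the_equality)
  show "\<exists>q' p'. verlet_solution d U h x v q' p' \<and> (q t, p t) = (q' t, p' t)"
    by (intro exI conjI) (rule assms(3), rule refl)
  fix z assume "\<exists>q' p'. verlet_solution d U h x v q' p' \<and> z = (q' t, p' t)"
  then obtain q' p' where z: "verlet_solution d U h x v q' p'" "z = (q' t, p' t)" by (elim exE conjE)
  show "z = (q t, p t)"
    using verlet_solution_unique[OF assms(1) z(1) assms(3) assms(2)] by (simp only: z(2))
qed

end

theory Submission
  imports Defs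
begin

text \<open>
  Write \<open>z = x - y\<close>, \<open>r = \<bar>z\<bar>\<close>, and let \<open>f'(r) = exp (- min r R\<^sub>1 / T)\<close> denote the slope of the concave
  distance function. Since \<open>f\<close> is concave, a change of the distance from \<open>r\<close> to \<open>s\<close> changes \<open>f\<close> by at
  most \<open>f'(r) (s - r)\<close>, so gains and losses can be compared after division by \<open>f'(r)\<close>.

  \<^bold>\<open>Trajectories.\<close> On the grid the integrator is the recursion \<open>leapfrog\<close>, and the positions satisfy the
  trapezoidal version of \<open>q\<^sub>t = x + t v - \<integral> (t - s) \<nabla>U(q\<^sub>s) ds\<close> exactly (\<open>pos_eq\<close>). As \<open>L T\<^sup>2 \<le> 1/4\<close>, the
  difference of two trajectories differs from the free motion by a small fraction of itself
  (\<open>linear_growth\<close>). Two trajectories with the same velocity that start at distance \<open>r \<ge> 2 R\<close> stay at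
  a distance of at least \<open>R\<close>, where the force is strongly monotone; this yields the factor
  \<open>1 - 51/200 K T\<^sup>2\<close> for their distance (\<open>end_dist_contraction\<close>), uniformly in the step size.

  \<^bold>\<open>Far points.\<close> The gain \<open>K T\<^sup>2 r f'(r) / 4\<close> is compared with \<open>c f(r)\<close>. The ratio \<open>r f'(r) / f(r)\<close> is
  smallest at \<open>R\<^sub>1\<close> (\<open>f_le_slope\<close>), and its value there is the origin of the second term in \<open>c\<close>.

  \<^bold>\<open>Near points.\<close> For \<open>r < 2 R\<close> the velocity \<open>\<eta> = \<xi> + \<gamma> z\<close> shrinks the distance to about \<open>(1 - \<gamma> T) r\<close>. The
  reflected velocity, used with probability at most \<open>2/5 \<gamma> r\<close>, changes the distance by about \<open>2 T s\<close>,
  where \<open>s\<close> is the standard normal component of \<open>\<xi>\<close> along \<open>z\<close>. The law of the distance has mean about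
  \<open>r\<close>, but \<open>f\<close> saturates on the scale \<open>T\<close>, so that a large increase costs less than it would under a
  linear function (\<open>f_far\<close>). The net gain is a fixed fraction of \<open>\<gamma> T r f'(r)\<close>, which exceeds \<open>c f(r)\<close>
  because \<open>r < 2 R\<close> bounds \<open>f'(r)\<close> from below by \<open>exp (- 2 R / T)\<close>.

  \<^bold>\<open>Rejections.\<close> The energy error of a trajectory is a sum of trapezoidal errors for the work of the
  force plus a telescoping term (\<open>energy_change\<close>), hence of order \<open>h\<^sup>2\<close>, with a constant cubic in the
  size of position and velocity. Rejecting both proposals only forfeits a gain. Accepting exactly one of
  them can separate the points by a distance of order \<open>T\<close>, however small \<open>r\<close> is; but this has a probability of
  at most the difference of the two energy errors, which by the bounds on the third and fourth
  derivatives of \<open>U\<close> is of order \<open>h\<^sup>2 r\<close> (\<open>energy_error_diff_order\<close>). After reflection that difference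
  is not of order \<open>r\<close>, but reflection itself has a probability of order \<open>\<gamma> r\<close>.

  \<^bold>\<open>Step size.\<close> Every loss by rejection is thus of the form \<open>h\<^sup>2\<close> times a mean of the fourth power of
  \<open>1 + R\<^sub>2 + \<bar>\<xi>\<bar>\<close>, which is of order \<open>(R\<^sub>2\<^sup>2 + d)\<^sup>2\<close> (\<open>gaussian_moment\<close>). Relative to the gains \<open>K T\<^sup>2 r\<close>
  and \<open>\<gamma> T r\<close> it carries an additional factor of order \<open>1 / T\<close> or \<open>1 / \<gamma>\<close>, hence at most of order
  \<open>1 + 1 / T + R\<close>; taking roots gives the order of the step size bound in the adjusted case.
\<close>

section \<open>Vectors with finitely many coordinates\<close>

lemma vnorm_add_le: "vnorm d (\<lambda>i. x i + y i) \<le> vnorm d x + vnorm d y"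
  by (rule L2_set_triangle_ineq)

lemma vnorm_scale: "vnorm d (\<lambda>i. c * x i) = \<bar>c\<bar> * vnorm d x"
  by (simp add: L2_set_def power_mult_distrib real_sqrt_mult flip: sum_distrib_left)

lemma vnorm_minus: "vnorm d (\<lambda>i. - x i) = vnorm d x"
  by (simp add: L2_set_def)

lemma vnorm_diff_le: "vnorm d (\<lambda>i. x i - y i) \<le> vnorm d x + vnorm d y"
  using vnorm_add_le[of x "\<lambda>i. - y i" d] by (simp add: vnorm_minus)

lemma vnorm_le_diff_add: "vnorm d x \<le> vnorm d (\<lambda>i. x i - y i) + vnorm d y"
  using vnorm_add_le[of "\<lambda>i. x i - y i" y d] by simp

lemma vdist_triangle: "vdist d x z \<le> vdist d x y + vdist d y z"
  using vnorm_add_le[of "\<lambda>i. x i - y i" "\<lambda>i. y i - z i" d] by simp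

lemma vdist_commute: "vdist d x y = vdist d y x"
  by (simp add: L2_set_def power2_commute)

lemma vnorm_sum_le:
  assumes "finite A"
  shows "vnorm d (\<lambda>i. \<Sum>k\<in>A. c k * v k i) \<le> (\<Sum>k\<in>A. \<bar>c k\<bar> * vnorm d (v k))"
  using assms
proof (induction rule: finite_induct)
  case empty
  then show ?case by (simp add: L2_set_def)
next
  case (insert k A)
  have "vnorm d (\<lambda>i. \<Sum>k\<in>insert k A. c k * v k i)
      \<le> vnorm d (\<lambda>i. c k * v k i) + vnorm d (\<lambda>i. \<Sum>k\<in>A. c k * v k i)"
    using insert vnorm_add_le by simp
  with insert show ?case by (simp add: vnorm_scale)
qed

lemma vnorm_convex_le:
  assumes "0 \<le> t" "t \<le> 1"
  shows "vnorm d (\<lambda>i. (1 - t) * x i + t * y i) \<le> max (vnorm d x) (vnorm d y)"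
proof -
  have "vnorm d (\<lambda>i. (1 - t) * x i + t * y i) \<le> (1 - t) * vnorm d x + t * vnorm d y"
    using vnorm_add_le[of "\<lambda>i. (1 - t) * x i" "\<lambda>i. t * y i" d] assms by (simp add: vnorm_scale)
  also have "\<dots> \<le> (1 - t) * max (vnorm d x) (vnorm d y) + t * max (vnorm d x) (vnorm d y)"
    using assms by (intro add_mono mult_left_mono) auto
  finally show ?thesis by (simp add: algebra_simps)
qed

lemma vnorm_sq: "(vnorm d x)\<^sup>2 = vinner d x x"
  by (simp add: L2_set_def vinner_def sum_nonneg power2_eq_square)

lemma vinner_le: "\<bar>vinner d x y\<bar> \<le> vnorm d x * vnorm d y"
proof -
  have "\<bar>vinner d x y\<bar> \<le> (\<Sum>i<d. \<bar>x i\<bar> * \<bar>y i\<bar>)"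
    unfolding vinner_def by (rule order_trans[OF sum_abs]) (simp add: abs_mult)
  also have "\<dots> \<le> vnorm d x * vnorm d y" by (rule L2_set_mult_ineq)
  finally show ?thesis .
qed

lemma vinner_commute: "vinner d x y = vinner d y x"
  by (simp add: vinner_def mult.commute)

lemma vinner_diff_left: "vinner d (\<lambda>i. x i - y i) z = vinner d x z - vinner d y z"
  by (simp add: vinner_def sum_subtractf algebra_simps)

lemma vinner_scale_left: "vinner d (\<lambda>i. c * x i) z = c * vinner d x z"
  by (simp add: vinner_def sum_distrib_left algebra_simps)

lemma vinner_sum_right: "vinner d x (\<lambda>i. \<Sum>k\<in>A. c k * v k i) = (\<Sum>k\<in>A. c k * vinner d x (v k))"
  unfolding vinner_def
  by (simp add: sum_distrib_left sum.swap[of _ "{..<d}"] algebra_simps)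

lemma vnorm_diff_sq:
  "(vnorm d (\<lambda>i. x i - y i))\<^sup>2 = (vnorm d x)\<^sup>2 - 2 * vinner d x y + (vnorm d y)\<^sup>2"
  unfolding vnorm_sq
  by (simp add: vinner_def algebra_simps sum.distrib sum_subtractf sum_distrib_left)

lemma vnorm_sq_diff_le:
  "\<bar>(vnorm d x)\<^sup>2 - (vnorm d y)\<^sup>2\<bar> \<le> vdist d x y * (vnorm d x + vnorm d y)"
proof -
  have "(vnorm d x)\<^sup>2 - (vnorm d y)\<^sup>2 = vinner d (\<lambda>i. x i - y i) (\<lambda>i. x i + y i)"
    unfolding vnorm_sq by (simp add: vinner_def algebra_simps sum.distrib sum_subtractf)
  then have "\<bar>(vnorm d x)\<^sup>2 - (vnorm d y)\<^sup>2\<bar> \<le> vdist d x y * vnorm d (\<lambda>i. x i + y i)"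
    using vinner_le by metis
  also have "\<dots> \<le> vdist d x y * (vnorm d x + vnorm d y)"
    by (intro mult_left_mono vnorm_add_le) simp
  finally show ?thesis .
qed

lemma abs_le_vnorm: "i < d \<Longrightarrow> \<bar>x i\<bar> \<le> vnorm d x"
  using member_le_L2_set[of "{..<d}" i "\<lambda>i. \<bar>x i\<bar>"] by (simp add: L2_set_def)

lemma Rd_eqI: "x \<in> Rd d \<Longrightarrow> y \<in> Rd d \<Longrightarrow> (\<And>i. i < d \<Longrightarrow> x i = y i) \<Longrightarrow> x = y"
  unfolding Rd_def by (rule PiE_ext[of x "{..<d}" "\<lambda>_. UNIV" y]) auto

lemma restrict_in_Rd [simp]: "restrict x {..<d} \<in> Rd d"
  by (simp add: Rd_def)

lemma vnorm_restrict [simp]: "vnorm d (restrict x {..<d}) = vnorm d x"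
  by (rule L2_set_cong) auto

lemma upd_in_Rd: "x \<in> Rd d \<Longrightarrow> i < d \<Longrightarrow> x(i := t) \<in> Rd d"
  by (auto simp: Rd_def PiE_def extensional_def)

definition line :: "nat \<Rightarrow> (nat \<Rightarrow> real) \<Rightarrow> (nat \<Rightarrow> real) \<Rightarrow> real \<Rightarrow> nat \<Rightarrow> real" where
  "line d x v t = (\<lambda>i\<in>{..<d}. x i + t * v i)"

lemma line_in_Rd [simp]: "line d x v t \<in> Rd d"
  by (simp add: line_def)

lemma line_0: "x \<in> Rd d \<Longrightarrow> line d x v 0 = x"
  by (rule Rd_eqI) (auto simp: line_def)

lemma line_1: "y \<in> Rd d \<Longrightarrow> line d x (\<lambda>i. y i - x i) 1 = y"
  by (rule Rd_eqI) (auto simp: line_def)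


section \<open>Differentiation along lines\<close>

lemma tendsto_pointwise:
  fixes f :: "'a \<Rightarrow> 'b \<Rightarrow> 'c::topological_space"
  assumes "\<And>i. ((\<lambda>s. f s i) \<longlongrightarrow> l i) F"
  shows "(f \<longlongrightarrow> l) F"
proof (rule topological_tendstoI)
  fix S assume "open S" "l \<in> S"
  then obtain X where X: "l \<in> Pi\<^sub>E UNIV X" "\<And>i. open (X i)" "finite {i. X i \<noteq> UNIV}" "Pi\<^sub>E UNIV X \<subseteq> S"
    using product_topology_open_contains_basis[of "\<lambda>_. euclidean" UNIV S l]
    by (auto simp: open_fun_def topspace_euclidean)
  have "\<forall>\<^sub>F s in F. \<forall>i\<in>{i. X i \<noteq> UNIV}. f s i \<in> X i"
    using X by (intro eventually_ball_finite ballI topological_tendstoD[OF assms]) (auto simp: PiE_def)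
  then show "\<forall>\<^sub>F s in F. f s \<in> S"
  proof eventually_elim
    case (elim s)
    have "f s i \<in> X i" for i
      using elim by (cases "X i = UNIV") auto
    then have "f s \<in> Pi\<^sub>E UNIV X" by auto
    with X(4) show ?case by auto
  qed
qed

text \<open>Moving the coordinates one after the other writes an increment of \<open>F\<close> as a sum of
  increments in single coordinates. The mean value theorem turns each of these into a partial
  derivative at an intermediate point, and the intermediate points converge to the base point.\<close>

lemma has_real_derivative_along_line:
  assumes cont: "\<And>i. i < d \<Longrightarrow> continuous_on (Rd d) (partial i F)"
    and diff: "\<And>i x. i < d \<Longrightarrow> x \<in> Rd d \<Longrightarrow> (\<lambda>t. F (x(i := t))) differentiable (at (x i))"
  shows "((\<lambda>t. F (line d x v t)) has_real_derivative (\<Sum>i<d. v i * partial i F (line d x v t))) (at t)"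
proof -
  define w where "w j s = (\<lambda>i\<in>{..<d}. if i < j then x i + (t + s) * v i else x i + t * v i)" for j s
  have wR: "w j s \<in> Rd d" for j s by (simp add: w_def)
  have w0: "w 0 s = line d x v t" for s by (rule Rd_eqI[OF wR line_in_Rd]) (simp add: w_def line_def)
  have wd: "w d s = line d x v (t + s)" for s
    by (rule Rd_eqI[OF wR line_in_Rd]) (simp add: w_def line_def)
  have deriv: "((\<lambda>t. F (y(i := t))) has_real_derivative partial i F (y(i := a))) (at a)"
    if "i < d" "y \<in> Rd d" for y i a
    using diff[OF that(1) upd_in_Rd[OF that(2) that(1)], of a]
    by (simp add: partial_def DERIV_deriv_iff_real_differentiable)
  have mvt: "\<exists>\<theta>. 0 \<le> \<theta> \<and> \<theta> \<le> 1 \<and> F (w (Suc j) s) - F (w j s)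
      = s * v j * partial j F ((w j s)(j := x j + t * v j + \<theta> * (s * v j)))" if j: "j < d" for j s
  proof -
    define \<psi> where "\<psi> \<theta> = F ((w j s)(j := x j + t * v j + \<theta> * (s * v j)))" for \<theta>
    define \<psi>' where "\<psi>' \<theta> = s * v j * partial j F ((w j s)(j := x j + t * v j + \<theta> * (s * v j)))" for \<theta>
    have D: "(\<psi> has_real_derivative \<psi>' \<theta>) (at \<theta>)" for \<theta>
    proof -
      have "((\<lambda>\<theta>. x j + t * v j + \<theta> * (s * v j)) has_real_derivative s * v j) (at \<theta>)"
        by (auto intro!: derivative_eq_intros)
      from DERIV_chain2[OF deriv[OF j wR[of j s]] this] show ?thesis
        by (simp add: \<psi>_def[abs_def] \<psi>'_def mult.commute)
    qed
    obtain z where z: "0 < z" "z < 1" "\<psi> 1 - \<psi> 0 = (1 - 0) * \<psi>' z"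
      using MVT2[of 0 1 \<psi> \<psi>'] D by auto
    have "(w j s)(j := x j + t * v j + 1 * (s * v j)) = w (Suc j) s"
      by (rule Rd_eqI[OF upd_in_Rd[OF wR j] wR]) (auto simp: w_def less_Suc_eq algebra_simps)
    moreover have "(w j s)(j := x j + t * v j + 0 * (s * v j)) = w j s"
      by (rule Rd_eqI[OF upd_in_Rd[OF wR j] wR]) (auto simp: w_def)
    ultimately have "F (w (Suc j) s) - F (w j s) = \<psi>' z"
      using z(3) unfolding \<psi>_def by simp
    then show ?thesis using z unfolding \<psi>'_def by (intro exI[of _ z]) auto
  qed
  then obtain \<theta> where \<theta>: "\<And>j s. j < d \<Longrightarrow> 0 \<le> \<theta> j s \<and> \<theta> j s \<le> 1 \<and> F (w (Suc j) s) - F (w j s)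
      = s * v j * partial j F ((w j s)(j := x j + t * v j + \<theta> j s * (s * v j)))"
    by metis
  define \<zeta> where "\<zeta> j s = (w j s)(j := x j + t * v j + \<theta> j s * (s * v j))" for j s
  have \<zeta>R: "\<zeta> j s \<in> Rd d" if "j < d" for j s
    unfolding \<zeta>_def by (rule upd_in_Rd[OF wR that])
  have lim: "(\<zeta> j \<longlongrightarrow> line d x v t) (at 0)" if j: "j < d" for j
  proof (rule tendsto_pointwise)
    fix i
    have "\<bar>\<zeta> j s i - line d x v t i\<bar> \<le> \<bar>s\<bar> * \<bar>v i\<bar>" for s
    proof -
      have "\<theta> j s * \<bar>s * v j\<bar> \<le> 1 * \<bar>s * v j\<bar>" using \<theta>[OF j, of s] by (intro mult_right_mono) auto
      then show ?thesis
        using \<theta>[OF j, of s] j by (auto simp: \<zeta>_def w_def line_def abs_mult algebra_simps)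
    qed
    then have bound: "\<forall>\<^sub>F s in at 0. norm (\<zeta> j s i - line d x v t i) \<le> \<bar>s\<bar> * \<bar>v i\<bar>"
      by (simp add: always_eventually)
    have "((\<lambda>s. \<bar>s\<bar> * \<bar>v i\<bar>) \<longlongrightarrow> 0) (at (0::real))"
      by (intro tendsto_mult_left_zero tendsto_rabs_zero tendsto_ident_at)
    with bound have "((\<lambda>s. \<zeta> j s i - line d x v t i) \<longlongrightarrow> 0) (at 0)"
      by (rule Lim_null_comparison)
    then show "((\<lambda>s. \<zeta> j s i) \<longlongrightarrow> line d x v t i) (at 0)" by (simp add: LIM_zero_iff)
  qed
  have quot: "(F (line d x v (t + s)) - F (line d x v t)) / s = (\<Sum>j<d. v j * partial j F (\<zeta> j s))"
    if "s \<noteq> 0" for s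
  proof -
    have "F (line d x v (t + s)) - F (line d x v t) = (\<Sum>j<d. F (w (Suc j) s) - F (w j s))"
      unfolding sum_lessThan_telescope[of "\<lambda>j. F (w j s)" d] by (simp add: wd w0)
    also have "\<dots> = (\<Sum>j<d. s * (v j * partial j F (\<zeta> j s)))"
      using \<theta> by (intro sum.cong refl) (auto simp: \<zeta>_def)
    finally show ?thesis using that by (simp add: sum_distrib_left[symmetric])
  qed
  have "((\<lambda>s. \<Sum>j<d. v j * partial j F (\<zeta> j s)) \<longlongrightarrow> (\<Sum>j<d. v j * partial j F (line d x v t))) (at 0)"
    by (intro tendsto_sum tendsto_mult tendsto_const continuous_on_tendsto_compose[OF cont lim])
      (auto simp: \<zeta>R)
  then show ?thesis
    unfolding DERIV_def
    by (rule Lim_transform_eventually) (auto simp: eventually_at quot intro!: exI[of _ 1])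
qed

lemma sum_multi_indices_Suc:
  "(\<Sum>is | set is \<subseteq> {..<d} \<and> length is = Suc k. f is)
     = (\<Sum>i<d. \<Sum>is | set is \<subseteq> {..<d::nat} \<and> length is = k. f (i # is))"
proof -
  have "{is. set is \<subseteq> {..<d} \<and> length is = Suc k}
      = (\<lambda>(i, is). i # is) ` ({..<d} \<times> {is. set is \<subseteq> {..<d} \<and> length is = k})"
    by (auto simp: length_Suc_conv image_iff)
  then show ?thesis
    by (simp add: sum.reindex inj_on_def sum.cartesian_product case_prod_unfold)
qed

lemma sum_multi_indices_0: "(\<Sum>is | set is \<subseteq> {..<d::nat} \<and> length is = 0. f is) = f []"
proof -
  have "{is. set is \<subseteq> {..<d::nat} \<and> length is = 0} = {[]}" by auto
  then show ?thesis by simp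
qed

lemma deriv_form_Nil: "deriv_form d F x [] = F x"
  unfolding deriv_form_def by (simp only: list.size sum_multi_indices_0) simp

lemma deriv_form_Cons:
  "deriv_form d F x (v # vs) = (\<Sum>i<d. v i * (\<Sum>is | set is \<subseteq> {..<d} \<and> length is = length vs.
      partial i (partials is F) x * (\<Prod>j<length vs. (vs ! j) (is ! j))))"
  unfolding deriv_form_def
  by (simp add: sum_multi_indices_Suc prod.lessThan_Suc_shift sum_distrib_left algebra_simps
      del: prod.lessThan_Suc)

lemma deriv_form_1: "deriv_form d F x [w] = (\<Sum>i<d. w i * partial i F x)"
  unfolding deriv_form_Cons by (simp only: list.size sum_multi_indices_0) simp

lemma deriv_form_cong:
  assumes "length ws = length vs" "\<And>j i. j < length vs \<Longrightarrow> i < d \<Longrightarrow> (vs ! j) i = (ws ! j) i"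
  shows "deriv_form d F x vs = deriv_form d F x ws"
  unfolding deriv_form_def assms(1)
proof (intro sum.cong refl arg_cong2[where f="(*)"] prod.cong)
  fix "is" j assume "is \<in> {is. set is \<subseteq> {..<d} \<and> length is = length vs}" "j \<in> {..<length vs}"
  then have "j < length vs" "j < length is" "set is \<subseteq> {..<d}" by auto
  then have "j < length vs" "is ! j < d" using nth_mem by blast+
  then show "(vs ! j) (is ! j) = (ws ! j) (is ! j)" by (rule assms(2))
qed

lemma prod_list_eq_prod_nth: "prod_list xs = (\<Prod>j<length xs. xs ! j)"
  by (induction xs) (simp_all add: prod.lessThan_Suc_shift del: prod.lessThan_Suc)

lemma deriv_form_scale:
  "deriv_form d F x (map2 (\<lambda>c v i. c * v i) cs vs) = prod_list cs * deriv_form d F x vs"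
  if "length cs = length vs" for vs :: "(nat \<Rightarrow> real) list"
proof -
  have "(\<Prod>j<length vs. (map2 (\<lambda>c v i. c * v i) cs vs ! j) (is ! j))
      = prod_list cs * (\<Prod>j<length vs. (vs ! j) (is ! j))" for "is" :: "nat list"
    using that by (simp add: prod.distrib prod_list_eq_prod_nth)
  then show ?thesis
    using that unfolding deriv_form_def by (simp add: sum_distrib_left algebra_simps)
qed

lemma deriv_form_3:
  "deriv_form d F x [a, b, c]
     = (\<Sum>i<d. \<Sum>j<d. \<Sum>k<d. partials [i, j, k] F x * (a i * b j * c k))"
proof -
  have len: "length [a, b, c] = Suc (Suc (Suc 0))" by simp
  show ?thesis
    unfolding deriv_form_def len sum_multi_indices_Suc sum_multi_indices_0
    by (simp add: mult_ac)
qed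


text \<open>The telescoping of a trilinear form over its three arguments, in which the order of the
  arguments is kept.\<close>

lemma deriv_form_3_diff:
  "deriv_form d F x [a, a, a] - deriv_form d F x [b, b, b]
     = deriv_form d F x [\<lambda>i. a i - b i, a, a] + deriv_form d F x [b, \<lambda>i. a i - b i, a]
       + deriv_form d F x [b, b, \<lambda>i. a i - b i]"
  unfolding deriv_form_3 sum.distrib[symmetric] sum_subtractf[symmetric]
  by (intro sum.cong refl) (simp add: algebra_simps)

text \<open>The supremum in \<open>deriv_norm\<close> is over a bounded set because the coordinates of vectors in
  the unit ball are bounded by 1.\<close>

lemma deriv_form_le_deriv_norm:
  assumes "\<And>v. v \<in> set vs \<Longrightarrow> vnorm d v \<le> 1"
  shows "\<bar>deriv_form d F x vs\<bar> \<le> deriv_norm d (length vs) F x"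
proof -
  let ?A = "{\<bar>deriv_form d F x ws\<bar> | ws. length ws = length vs \<and> (\<forall>v\<in>set ws. v \<in> Rd d \<and> vnorm d v \<le> 1)}"
  have "deriv_form d F x vs = deriv_form d F x (map (\<lambda>v. restrict v {..<d}) vs)"
    by (rule deriv_form_cong) auto
  then have "\<bar>deriv_form d F x vs\<bar> \<in> ?A"
    using assms by (auto intro!: exI[of _ "map (\<lambda>v. restrict v {..<d}) vs"])
  moreover have "bdd_above ?A"
  proof (rule bdd_aboveI)
    fix y assume "y \<in> ?A"
    then obtain ws where ws: "y = \<bar>deriv_form d F x ws\<bar>" "length ws = length vs"
      "\<And>v. v \<in> set ws \<Longrightarrow> vnorm d v \<le> 1" by auto
    have "y \<le> (\<Sum>is | set is \<subseteq> {..<d} \<and> length is = length vs.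
        \<bar>partials is F x * (\<Prod>j<length ws. (ws ! j) (is ! j))\<bar>)"
      unfolding ws deriv_form_def ws(2) by (rule sum_abs)
    also have "\<dots> \<le> (\<Sum>is | set is \<subseteq> {..<d} \<and> length is = length vs. \<bar>partials is F x\<bar>)"
    proof (rule sum_mono)
      fix "is" assume "is \<in> {is. set is \<subseteq> {..<d} \<and> length is = length vs}"
      then have "(\<Prod>j<length ws. \<bar>(ws ! j) (is ! j)\<bar>) \<le> 1"
        using ws(2,3) nth_mem[of _ "is"]
        by (intro prod_le_1) (auto intro!: order_trans[OF abs_le_vnorm[of _ d]] simp: subset_iff)
      then show "\<bar>partials is F x * (\<Prod>j<length ws. (ws ! j) (is ! j))\<bar> \<le> \<bar>partials is F x\<bar>"
        by (simp add: abs_mult abs_prod mult_left_le)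
    qed
    finally show "y \<le> (\<Sum>is | set is \<subseteq> {..<d} \<and> length is = length vs. \<bar>partials is F x\<bar>)" .
  qed
  ultimately show ?thesis unfolding deriv_norm_def by (rule cSup_upper)
qed

text \<open>Homogeneity in each argument reduces the estimate to unit vectors.\<close>

lemma deriv_form_le:
  "\<bar>deriv_form d F x vs\<bar> \<le> deriv_norm d (length vs) F x * prod_list (map (vnorm d) vs)"
proof (cases "0 \<in> set (map (vnorm d) vs)")
  case True
  then obtain j where j: "j < length vs" "vnorm d (vs ! j) = 0"
    by (auto simp: in_set_conv_nth)
  have "deriv_form d F x vs = 0"
    unfolding deriv_form_def
  proof (intro sum.neutral ballI)
    fix "is" assume "is \<in> {is. set is \<subseteq> {..<d} \<and> length is = length vs}"
    then have "j < length is" "set is \<subseteq> {..<d}" using j by auto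
    then have "is ! j < d" using nth_mem by blast
    then have "(vs ! j) (is ! j) = 0" using j by (auto simp: L2_set_eq_0_iff)
    then show "partials is F x * (\<Prod>j<length vs. (vs ! j) (is ! j)) = 0"
      using j by (auto intro!: prod_zero)
  qed
  moreover have "prod_list (map (vnorm d) vs) = 0" using True by (simp add: prod_list_zero_iff)
  ultimately show ?thesis by simp
next
  case False
  define ws where "ws = map (\<lambda>v i. v i / vnorm d v) vs"
  have ws1: "vnorm d v \<le> 1" if v: "v \<in> set ws" for v
  proof -
    obtain u where u: "u \<in> set vs" "v = (\<lambda>i. inverse (vnorm d u) * u i)"
      using v by (auto simp: ws_def divide_inverse mult.commute)
    have "vnorm d u \<noteq> 0" using u False by force
    then show ?thesis unfolding u vnorm_scale by simp
  qed
  have "map2 (\<lambda>c v i. c * v i) (map (vnorm d) vs) ws = vs"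
  proof (rule nth_equalityI)
    fix j assume "j < length (map2 (\<lambda>c v i. c * v i) (map (vnorm d) vs) ws)"
    then have j: "j < length vs" by (simp add: ws_def)
    then have "vnorm d (vs ! j) \<noteq> 0" using False nth_mem[OF j] by (force simp: image_iff)
    with j show "map2 (\<lambda>c v i. c * v i) (map (vnorm d) vs) ws ! j = vs ! j"
      by (simp add: ws_def)
  qed (simp add: ws_def)
  then have eq: "deriv_form d F x vs = prod_list (map (vnorm d) vs) * deriv_form d F x ws"
    using deriv_form_scale[of "map (vnorm d) vs" ws d F x] by (simp add: ws_def)
  have pos: "0 \<le> prod_list (map (vnorm d) vs)" by (rule prod_list_nonneg) auto
  have "\<bar>deriv_form d F x ws\<bar> \<le> deriv_norm d (length vs) F x"
    using deriv_form_le_deriv_norm[OF ws1, of ws F x] by (simp add: ws_def)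
  then show ?thesis
    unfolding eq abs_mult using pos by (simp add: mult.commute mult_right_mono)
qed

lemma deriv_form_along_line:
  assumes "C_k d k F" "length vs < k"
  shows "((\<lambda>t. deriv_form d F (line d x v t) vs) has_real_derivative
           deriv_form d F (line d x v t) (v # vs)) (at t)"
proof -
  have D: "((\<lambda>t. partials is F (line d x v t)) has_real_derivative
        (\<Sum>i<d. v i * partial i (partials is F) (line d x v t))) (at t)"
    if ms: "set is \<subseteq> {..<d}" "length is = length vs" for "is"
  proof (rule has_real_derivative_along_line)
    show "continuous_on (Rd d) (partial i (partials is F))" if "i < d" for i
      using assms ms that unfolding C_k_def
      by (auto dest!: spec[of _ "i # is"])
    show "(\<lambda>t. partials is F (x(i := t))) differentiable at (x i)" if "i < d" "x \<in> Rd d" for i x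
      using assms ms that unfolding C_k_def by auto
  qed
  have "((\<lambda>t. deriv_form d F (line d x v t) vs) has_real_derivative
      (\<Sum>is | set is \<subseteq> {..<d} \<and> length is = length vs.
        (\<Sum>i<d. v i * partial i (partials is F) (line d x v t)) * (\<Prod>j<length vs. (vs ! j) (is ! j)))) (at t)"
    unfolding deriv_form_def by (intro DERIV_sum DERIV_cmult_right D) auto
  also have "(\<Sum>is | set is \<subseteq> {..<d} \<and> length is = length vs.
        (\<Sum>i<d. v i * partial i (partials is F) (line d x v t)) * (\<Prod>j<length vs. (vs ! j) (is ! j)))
      = deriv_form d F (line d x v t) (v # vs)"
    unfolding deriv_form_Cons sum_distrib_left sum_distrib_right
    by (subst sum.swap) (simp only: mult_ac)
  finally show ?thesis .
qed

text \<open>The mean value theorem, with the increment measured by the next derivative.\<close>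

lemma deriv_form_increment_le:
  assumes F: "C_k d k F" "length vs < k"
    and B: "\<And>z. z \<in> Rd d \<Longrightarrow> deriv_norm d (Suc (length vs)) F z \<le> B"
    and xy: "x \<in> Rd d" "y \<in> Rd d"
  shows "\<bar>deriv_form d F x vs - deriv_form d F y vs\<bar> \<le> B * vdist d x y * prod_list (map (vnorm d) vs)"
proof -
  let ?v = "\<lambda>i. x i - y i"
  obtain t where "deriv_form d F (line d y ?v 1) vs - deriv_form d F (line d y ?v 0) vs
      = (1 - 0) * deriv_form d F (line d y ?v t) (?v # vs)"
    using MVT2[of 0 1 "\<lambda>t. deriv_form d F (line d y ?v t) vs"
        "\<lambda>t. deriv_form d F (line d y ?v t) (?v # vs)"] deriv_form_along_line[OF F] by auto
  then have "\<bar>deriv_form d F x vs - deriv_form d F y vs\<bar> = \<bar>deriv_form d F (line d y ?v t) (?v # vs)\<bar>"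
    using xy by (simp add: line_0 line_1)
  also have "\<dots> \<le> deriv_norm d (Suc (length vs)) F (line d y ?v t) * prod_list (map (vnorm d) (?v # vs))"
    using deriv_form_le[of d F "line d y ?v t" "?v # vs"] by simp
  also have "\<dots> \<le> B * prod_list (map (vnorm d) (?v # vs))"
    by (intro mult_right_mono B prod_list_nonneg) auto
  finally show ?thesis by (simp add: algebra_simps)
qed

section \<open>The potential\<close>

text \<open>The error of the trapezoidal rule for a primitive \<open>\<Phi>\<close> of \<open>\<Phi>1\<close> is controlled by the
  third derivative of \<open>\<Phi>\<close>. It is used for the potential along one step of the integrator, and
  for the difference of the potential along two such steps.\<close>

lemma trapezoid_error_le:
  fixes \<Phi> :: "real \<Rightarrow> real"
  assumes D: "\<And>t. (\<Phi> has_real_derivative \<Phi>1 t) (at t)"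
    "\<And>t. (\<Phi>1 has_real_derivative \<Phi>2 t) (at t)"
    "\<And>t. (\<Phi>2 has_real_derivative \<Phi>3 t) (at t)"
    and B: "\<And>t. 0 \<le> t \<Longrightarrow> t \<le> 1 \<Longrightarrow> \<bar>\<Phi>3 t\<bar> \<le> B"
  shows "\<bar>\<Phi> 1 - \<Phi> 0 - (\<Phi>1 0 + \<Phi>1 1) / 2\<bar> \<le> B / 2"
proof -
  define \<Psi> where "\<Psi> t = \<Phi> t - \<Phi> 0 - t / 2 * (\<Phi>1 0 + \<Phi>1 t)" for t
  have "(\<Psi> has_real_derivative (\<Phi>1 t - \<Phi>1 0) / 2 - t / 2 * \<Phi>2 t) (at t)" for t
    unfolding \<Psi>_def by (auto intro!: derivative_eq_intros D simp: field_simps)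
  then obtain c where c: "0 < c" "c < 1" "\<Psi> 1 - \<Psi> 0 = (1 - 0) * ((\<Phi>1 c - \<Phi>1 0) / 2 - c / 2 * \<Phi>2 c)"
    using MVT2[of 0 1 \<Psi> "\<lambda>t. (\<Phi>1 t - \<Phi>1 0) / 2 - t / 2 * \<Phi>2 t"] by auto
  obtain e where e: "0 < e" "e < c" "\<Phi>1 c - \<Phi>1 0 = (c - 0) * \<Phi>2 e"
    using MVT2[of 0 c \<Phi>1 \<Phi>2] D c by auto
  obtain f where f: "e < f" "f < c" "\<Phi>2 c - \<Phi>2 e = (c - e) * \<Phi>3 f"
    using MVT2[of e c \<Phi>2 \<Phi>3] D e by auto
  have "\<Psi> 1 = - (c / 2) * ((c - e) * \<Phi>3 f)"
    using c(3) unfolding e(3) f(3)[symmetric] by (simp add: \<Psi>_def field_simps)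
  then have "\<bar>\<Psi> 1\<bar> = c / 2 * ((c - e) * \<bar>\<Phi>3 f\<bar>)"
    using c e by (simp add: abs_mult)
  also have "\<dots> \<le> 1 / 2 * (1 * B)"
    using c e f B[of f] by (intro mult_mono) auto
  finally show ?thesis by (simp add: \<Psi>_def)
qed

lemma vnorm_single: "i < d \<Longrightarrow> vnorm d (\<lambda>j. if j = i then t else 0) = \<bar>t\<bar>"
proof -
  assume "i < d"
  then have "(\<Sum>j<d. (if j = i then t else 0)\<^sup>2) = (\<Sum>j<d. if j = i then t\<^sup>2 else 0)"
    by (intro sum.cong) auto
  also have "\<dots> = t\<^sup>2" using \<open>i < d\<close> by simp
  finally show ?thesis by (simp add: L2_set_def)
qed

locale smooth_potential =
  fixes d :: nat and U :: "(nat \<Rightarrow> real) \<Rightarrow> real" and L M N K R :: real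
  assumes pot: "potential d U L M N K R" and d_pos: "d \<ge> 1"
begin

abbreviation g :: "(nat \<Rightarrow> real) \<Rightarrow> nat \<Rightarrow> real" where
  "g \<equiv> grad d U"

lemma C4: "C_k d 4 U"
  using pot by (simp add: potential_def)

lemma R_nonneg: "0 \<le> R" and K_pos: "0 < K"
  using pot by (simp_all add: potential_def)

lemma deriv_norm_le:
  assumes "z \<in> Rd d"
  shows "deriv_norm d 2 U z \<le> L" "deriv_norm d 3 U z \<le> M" "deriv_norm d 4 U z \<le> N"
  using pot assms unfolding potential_def by (auto intro!: cSUP_upper)

lemma deriv_norm_nonneg: "0 \<le> deriv_norm d k U z"
proof -
  have "\<bar>deriv_form d U z (replicate k (\<lambda>_. 0))\<bar> \<le> deriv_norm d (length (replicate k (\<lambda>_::nat. 0::real))) U z"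
    by (rule deriv_form_le_deriv_norm) (auto simp: L2_set_def)
  then show ?thesis by simp
qed

lemma bounds_nonneg: "0 \<le> L" "0 \<le> M" "0 \<le> N"
  using deriv_norm_le[of "restrict (\<lambda>_. 0) {..<d}"] deriv_norm_nonneg order_trans
  by (meson restrict_in_Rd)+

lemma g_in_Rd [simp]: "g x \<in> Rd d"
  by (simp add: grad_def)

lemma deriv_form_grad: "deriv_form d U x [w] = vinner d w (g x)"
  unfolding deriv_form_1 vinner_def by (intro sum.cong) (auto simp: grad_def)

text \<open>The increment of the gradient is tested against its own direction, so that the mean value
  theorem applies to a scalar function.\<close>

lemma grad_lipschitz:
  assumes "x \<in> Rd d" "y \<in> Rd d"
  shows "vdist d (g x) (g y) \<le> L * vdist d x y"
proof -
  let ?w = "\<lambda>i. g x i - g y i"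
  have "(vnorm d ?w)\<^sup>2 = vinner d ?w (g x) - vinner d ?w (g y)"
    unfolding vnorm_sq by (simp add: vinner_def right_diff_distrib sum_subtractf)
  also have "\<dots> = deriv_form d U x [?w] - deriv_form d U y [?w]"
    by (simp add: deriv_form_grad)
  also have "\<dots> \<le> \<bar>deriv_form d U x [?w] - deriv_form d U y [?w]\<bar>" by simp
  also have "\<dots> \<le> L * vdist d x y * vnorm d ?w"
    using deriv_form_increment_le[OF C4, of "[?w]" L x y] assms deriv_norm_le(1)
    by (simp add: numeral_2_eq_2)
  finally have "vnorm d ?w * vnorm d ?w \<le> (L * vdist d x y) * vnorm d ?w"
    by (simp add: power2_eq_square)
  then show ?thesis
    using bounds_nonneg by (cases "vnorm d ?w = 0") (auto simp: mult_le_cancel_right less_le)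
qed

lemma grad_origin: "i < d \<Longrightarrow> g (\<lambda>i\<in>{..<d}. 0) i = 0"
proof -
  let ?o = "\<lambda>i\<in>{..<d}. 0 :: real"
  assume i: "i < d"
  obtain \<epsilon> where \<epsilon>: "\<epsilon> > 0" "\<And>x. x \<in> Rd d \<Longrightarrow> vnorm d x < \<epsilon> \<Longrightarrow> U ?o \<le> U x"
    using pot unfolding potential_def by blast
  have "(\<lambda>t. partials [] U (?o(i := t))) differentiable (at (?o i))"
    using C4 i restrict_in_Rd[of "\<lambda>_. 0" d] unfolding C_k_def
    by (metis empty_set empty_subsetI list.size(3) zero_less_numeral)
  then have D: "((\<lambda>t. U (?o(i := t))) has_real_derivative g ?o i) (at 0)"
    using i by (simp add: grad_def partial_def DERIV_deriv_iff_real_differentiable)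
  show ?thesis
  proof (rule DERIV_local_min[OF D \<epsilon>(1)], intro allI impI)
    fix t :: real assume t: "\<bar>0 - t\<bar> < \<epsilon>"
    have "vnorm d (?o(i := t)) = vnorm d (\<lambda>j. if j = i then t else 0)"
      by (rule L2_set_cong) auto
    also have "\<dots> = \<bar>t\<bar>" using i by (rule vnorm_single)
    finally have "vnorm d (?o(i := t)) < \<epsilon>" using t by simp
    moreover have "?o(i := t) \<in> Rd d" by (rule upd_in_Rd[OF restrict_in_Rd i])
    ultimately have "U ?o \<le> U (?o(i := t))" by (intro \<epsilon>(2))
    moreover have "?o(i := 0) = ?o" using i by auto
    ultimately show "U (?o(i := 0)) \<le> U (?o(i := t))" by simp
  qed
qed

lemma grad_le: "x \<in> Rd d \<Longrightarrow> vnorm d (g x) \<le> L * vnorm d x"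
proof -
  assume x: "x \<in> Rd d"
  have "vnorm d (g x) = vdist d (g x) (g (\<lambda>i\<in>{..<d}. 0))"
    by (rule L2_set_cong) (auto simp: grad_origin)
  also have "\<dots> \<le> L * vdist d x (\<lambda>i\<in>{..<d}. 0)"
    by (rule grad_lipschitz[OF x restrict_in_Rd])
  also have "vdist d x (\<lambda>i\<in>{..<d}. 0) = vnorm d x" by (rule L2_set_cong) auto
  finally show ?thesis .
qed

lemma strongly_convex_at_distance:
  "x \<in> Rd d \<Longrightarrow> y \<in> Rd d \<Longrightarrow> R \<le> vdist d x y \<Longrightarrow>
     K * (vdist d x y)\<^sup>2 \<le> vinner d (\<lambda>i. x i - y i) (\<lambda>i. g x i - g y i)"
  using pot unfolding potential_def by blast

text \<open>On a coordinate axis, at a distance beyond \<open>R\<close>, the monotonicity constant cannot exceed the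
  Lipschitz constant of the force.\<close>

lemma K_le_L: "K \<le> L"
proof -
  define t where "t = max R 1"
  have t: "t \<ge> 1" "t \<ge> R" by (simp_all add: t_def)
  let ?x = "\<lambda>i\<in>{..<d}. if i = 0 then t else 0" and ?y = "\<lambda>i\<in>{..<d}. 0 :: real"
  have "vdist d ?x ?y = vnorm d (\<lambda>i. if i = 0 then t else 0)"
    by (rule L2_set_cong) auto
  also have "\<dots> = t" using t d_pos vnorm_single[of 0 d t] by simp
  finally have dist: "vdist d ?x ?y = t" .
  have "K * t\<^sup>2 \<le> vinner d (\<lambda>i. ?x i - ?y i) (\<lambda>i. g ?x i - g ?y i)"
    using strongly_convex_at_distance[of ?x ?y] t unfolding dist by simp
  also have "\<dots> \<le> vdist d ?x ?y * vdist d (g ?x) (g ?y)"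
    using vinner_le abs_le_D1 by blast
  also have "\<dots> \<le> t * (L * t)"
    using grad_lipschitz[of ?x ?y] t unfolding dist by (intro mult_left_mono) auto
  finally show ?thesis using t by (simp add: power2_eq_square)
qed

lemma L_pos: "0 < L"
  using K_le_L K_pos by simp

text \<open>The energy changes in one step of the integrator by the error of the trapezoidal rule
  for the work of the force along the displacement.\<close>

definition work_error :: "(nat \<Rightarrow> real) \<Rightarrow> (nat \<Rightarrow> real) \<Rightarrow> real" where
  "work_error x \<delta> = U (line d x \<delta> 1) - U x - (vinner d \<delta> (g x) + vinner d \<delta> (g (line d x \<delta> 1))) / 2"

lemma potential_derivatives:
  "((\<lambda>t. U (line d x \<delta> t)) has_real_derivative deriv_form d U (line d x \<delta> t) [\<delta>]) (at t)"
  "((\<lambda>t. deriv_form d U (line d x \<delta> t) [\<delta>]) has_real_derivative deriv_form d U (line d x \<delta> t) [\<delta>, \<delta>]) (at t)"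
  "((\<lambda>t. deriv_form d U (line d x \<delta> t) [\<delta>, \<delta>]) has_real_derivative deriv_form d U (line d x \<delta> t) [\<delta>, \<delta>, \<delta>]) (at t)"
  using deriv_form_along_line[OF C4, of "[]"] deriv_form_along_line[OF C4, of "[\<delta>]"]
    deriv_form_along_line[OF C4, of "[\<delta>, \<delta>]"] by (simp_all add: deriv_form_Nil)

lemma third_derivative_le:
  "x \<in> Rd d \<Longrightarrow> \<bar>deriv_form d U x [a, b, c]\<bar> \<le> M * (vnorm d a * vnorm d b * vnorm d c)"
proof -
  assume x: "x \<in> Rd d"
  have "\<bar>deriv_form d U x [a, b, c]\<bar> \<le> deriv_norm d 3 U x * (vnorm d a * vnorm d b * vnorm d c)"
    using deriv_form_le[of d U x "[a, b, c]"] by (simp add: numeral_3_eq_3 mult_ac)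
  also have "\<dots> \<le> M * (vnorm d a * vnorm d b * vnorm d c)"
    using x by (intro mult_right_mono deriv_norm_le) auto
  finally show ?thesis .
qed

lemma work_error_le:
  assumes x: "x \<in> Rd d" and D: "vnorm d \<delta> \<le> D"
  shows "\<bar>work_error x \<delta>\<bar> \<le> M * D ^ 3 / 2"
proof -
  have D0: "0 \<le> D" using order_trans[OF L2_set_nonneg D] .
  have B: "\<bar>deriv_form d U (line d x \<delta> t) [\<delta>, \<delta>, \<delta>]\<bar> \<le> M * D ^ 3" for t
  proof -
    have "vnorm d \<delta> * vnorm d \<delta> * vnorm d \<delta> \<le> D * D * D"
      by (intro mult_mono mult_nonneg_nonneg D D0 L2_set_nonneg)
    from order_trans[OF third_derivative_le[OF line_in_Rd] mult_left_mono[OF this bounds_nonneg(2)]]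
    show ?thesis by (simp add: power3_eq_cube)
  qed
  have "\<bar>U (line d x \<delta> 1) - U (line d x \<delta> 0)
      - (deriv_form d U (line d x \<delta> 0) [\<delta>] + deriv_form d U (line d x \<delta> 1) [\<delta>]) / 2\<bar> \<le> M * D ^ 3 / 2"
    by (rule trapezoid_error_le[OF potential_derivatives B])
  then show ?thesis
    by (simp add: work_error_def deriv_form_grad line_0[OF x])
qed

text \<open>The third derivatives along the two displacements differ because the base points differ, which
  costs \<open>N\<close>, and because the directions differ, which costs \<open>M\<close>.\<close>

lemma work_error_diff_le:
  assumes xy: "x \<in> Rd d" "y \<in> Rd d" "vdist d x y \<le> Z" "vdist d (line d x \<delta> 1) (line d y \<epsilon> 1) \<le> Z"
    and D: "vnorm d \<delta> \<le> D" "vnorm d \<epsilon> \<le> D" and W: "vdist d \<delta> \<epsilon> \<le> W"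
  shows "\<bar>work_error x \<delta> - work_error y \<epsilon>\<bar> \<le> (N * Z * D ^ 3 + 3 * M * W * D\<^sup>2) / 2"
proof -
  let ?x = "line d x \<delta>" and ?y = "line d y \<epsilon>"
  have D0: "0 \<le> D" using order_trans[OF L2_set_nonneg D(1)] .
  have W0: "0 \<le> W" using order_trans[OF L2_set_nonneg W] .
  have Z0: "0 \<le> Z" using order_trans[OF L2_set_nonneg xy(3)] .
  have B: "\<bar>deriv_form d U (?x t) [\<delta>, \<delta>, \<delta>] - deriv_form d U (?y t) [\<epsilon>, \<epsilon>, \<epsilon>]\<bar>
      \<le> N * Z * D ^ 3 + 3 * M * W * D\<^sup>2" if t: "0 \<le> t" "t \<le> 1" for t
  proof -
    have "vdist d (?x t) (?y t)
        = vnorm d (\<lambda>i. (1 - t) * (x i - y i) + t * (?x 1 i - ?y 1 i))"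
      by (rule L2_set_cong) (auto simp: line_def algebra_simps)
    also have "\<dots> \<le> Z" using vnorm_convex_le[OF t] xy(3,4) by (meson max.boundedI order_trans)
    finally have z: "vdist d (?x t) (?y t) \<le> Z" .
    have "\<bar>deriv_form d U (?x t) [\<delta>, \<delta>, \<delta>] - deriv_form d U (?y t) [\<delta>, \<delta>, \<delta>]\<bar>
        \<le> N * vdist d (?x t) (?y t) * (vnorm d \<delta> * vnorm d \<delta> * vnorm d \<delta>)"
      using deriv_form_increment_le[OF C4, of "[\<delta>, \<delta>, \<delta>]" N "?x t" "?y t"] deriv_norm_le(3)
      by (simp add: mult_ac eval_nat_numeral)
    also have "\<dots> \<le> N * Z * (D * D * D)"
      by (intro mult_mono mult_nonneg_nonneg z D D0 Z0 bounds_nonneg L2_set_nonneg order_refl)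
    finally have 1: "\<bar>deriv_form d U (?x t) [\<delta>, \<delta>, \<delta>] - deriv_form d U (?y t) [\<delta>, \<delta>, \<delta>]\<bar>
        \<le> N * Z * D ^ 3" by (simp add: power3_eq_cube)
    have t3: "\<bar>deriv_form d U (?y t) [a, b, c]\<bar> \<le> M * W * D\<^sup>2"
      if "vnorm d a * vnorm d b * vnorm d c \<le> W * D * D" for a b c
      using order_trans[OF third_derivative_le[of "?y t" a b c] mult_left_mono[OF that bounds_nonneg(2)]]
      by (simp add: power2_eq_square mult.assoc)
    have "\<bar>deriv_form d U (?y t) [\<lambda>i. \<delta> i - \<epsilon> i, \<delta>, \<delta>]\<bar> \<le> M * W * D\<^sup>2"
      by (intro t3 mult_mono mult_nonneg_nonneg D D0 W W0 L2_set_nonneg)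
    moreover have "\<bar>deriv_form d U (?y t) [\<epsilon>, \<lambda>i. \<delta> i - \<epsilon> i, \<delta>]\<bar> \<le> M * W * D\<^sup>2"
      by (rule t3, subst mult.commute[of "vnorm d \<epsilon>"])
        (intro mult_mono mult_nonneg_nonneg D D0 W W0 L2_set_nonneg)
    moreover have "\<bar>deriv_form d U (?y t) [\<epsilon>, \<epsilon>, \<lambda>i. \<delta> i - \<epsilon> i]\<bar> \<le> M * W * D\<^sup>2"
      by (rule t3, subst mult.commute, subst mult.assoc[symmetric])
        (intro mult_mono mult_nonneg_nonneg D D0 W W0 L2_set_nonneg)
    ultimately have "\<bar>deriv_form d U (?y t) [\<delta>, \<delta>, \<delta>] - deriv_form d U (?y t) [\<epsilon>, \<epsilon>, \<epsilon>]\<bar>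
        \<le> 3 * (M * W * D\<^sup>2)"
      unfolding deriv_form_3_diff by linarith
    with 1 show ?thesis by linarith
  qed
  have "\<bar>(U (?x 1) - U (?y 1)) - (U (?x 0) - U (?y 0))
      - ((deriv_form d U (?x 0) [\<delta>] - deriv_form d U (?y 0) [\<epsilon>])
        + (deriv_form d U (?x 1) [\<delta>] - deriv_form d U (?y 1) [\<epsilon>])) / 2\<bar>
      \<le> (N * Z * D ^ 3 + 3 * M * W * D\<^sup>2) / 2"
    by (rule trapezoid_error_le[of "\<lambda>t. U (?x t) - U (?y t)"
          "\<lambda>t. deriv_form d U (?x t) [\<delta>] - deriv_form d U (?y t) [\<epsilon>]"
          "\<lambda>t. deriv_form d U (?x t) [\<delta>, \<delta>] - deriv_form d U (?y t) [\<epsilon>, \<epsilon>]"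
          "\<lambda>t. deriv_form d U (?x t) [\<delta>, \<delta>, \<delta>] - deriv_form d U (?y t) [\<epsilon>, \<epsilon>, \<epsilon>]"])
      (intro DERIV_diff potential_derivatives B; assumption)+
  then show ?thesis
    using xy(1,2) by (simp add: work_error_def deriv_form_grad line_0 field_simps)
qed

end

section \<open>Growth of Verlet trajectories\<close>

text \<open>The position after \<open>k\<close> steps is the trapezoidal approximation of
  \<open>x + t v - \<integral>\<^sub>0\<^sup>t (t - s) \<nabla>U(q\<^sub>s) ds\<close>; the initial time carries half the weight of the other grid
  times.\<close>

definition trapezoid_weight :: "nat \<Rightarrow> real" where
  "trapezoid_weight j = (if j = 0 then 1 / 2 else 1)"

lemma trapezoid_weight_nonneg: "0 \<le> trapezoid_weight j"
  by (simp add: trapezoid_weight_def)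

lemma sum_trapezoid_weight: "(\<Sum>j\<le>k. trapezoid_weight j) = real k + 1 / 2"
  by (induction k) (simp_all add: trapezoid_weight_def)

lemma sum_trapezoid_weight_linear:
  "(\<Sum>j<k. (real k - real j) * trapezoid_weight j) = (real k)\<^sup>2 / 2"
proof (induction k)
  case (Suc k)
  have "(\<Sum>j<Suc k. (real (Suc k) - real j) * trapezoid_weight j)
      = (\<Sum>j<Suc k. (real k - real j) * trapezoid_weight j) + (\<Sum>j<Suc k. trapezoid_weight j)"
    by (simp only: sum.distrib[symmetric]) (simp add: algebra_simps)
  also have "(\<Sum>j<Suc k. trapezoid_weight j) = real k + 1 / 2"
    using sum_trapezoid_weight[of k] by (simp only: lessThan_Suc_atMost)
  finally show ?case using Suc by (simp add: power2_eq_square field_simps)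
qed simp

lemma sum_trapezoid_weight_cubic:
  "(\<Sum>j<k. (real k - real j) * trapezoid_weight j * (real j)\<^sup>2) = (real k)\<^sup>2 * ((real k)\<^sup>2 - 1) / 12"
proof (induction k)
  case (Suc k)
  have s2: "(\<Sum>j<Suc k. trapezoid_weight j * (real j)\<^sup>2) = real k * (real k + 1) * (2 * real k + 1) / 6"
    by (induction k) (simp_all add: trapezoid_weight_def power2_eq_square field_simps)
  have "(\<Sum>j<Suc k. (real (Suc k) - real j) * trapezoid_weight j * (real j)\<^sup>2)
      = (\<Sum>j<Suc k. (real k - real j) * trapezoid_weight j * (real j)\<^sup>2)
        + (\<Sum>j<Suc k. trapezoid_weight j * (real j)\<^sup>2)"
    by (simp only: sum.distrib[symmetric]) (simp add: algebra_simps)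
  then show ?case unfolding s2 using Suc
    by (simp add: power2_eq_square power4_eq_xxxx field_simps)
qed simp

text \<open>The recursion obeyed by the positions of a single trajectory and by the difference of two of
  them; in both cases the force is at most \<open>L\<close> times the displacement. The bound \<open>A\<close> holds at both ends of
  the free motion, hence along all of it.\<close>

locale linear_growth =
  fixes d n :: nat and h L A :: real and z G :: "nat \<Rightarrow> nat \<Rightarrow> real" and z0 w :: "nat \<Rightarrow> real"
  assumes h_pos: "0 < h" and L_nonneg: "0 \<le> L" and short: "L * (real n * h)\<^sup>2 \<le> 1 / 4"
    and z_eq: "\<And>k i. k \<le> n \<Longrightarrow> i < d \<Longrightarrow> z k i = z0 i + real k * h * w i
        - h\<^sup>2 * (\<Sum>j<k. (real k - real j) * trapezoid_weight j * G j i)"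
    and G_le: "\<And>j. j \<le> n \<Longrightarrow> vnorm d (G j) \<le> L * vnorm d (z j)"
    and A_ge: "vnorm d z0 \<le> A" "vnorm d (\<lambda>i. z0 i + real n * h * w i) \<le> A"
begin

lemma A_nonneg: "0 \<le> A"
  using order_trans[OF L2_set_nonneg A_ge(1)] .

lemma free_le: "k \<le> n \<Longrightarrow> vnorm d (\<lambda>i. z0 i + real k * h * w i) \<le> A"
proof (cases "n = 0")
  case False
  assume k: "k \<le> n"
  define t where "t = real k / real n"
  have t: "0 \<le> t" "t \<le> 1" "real k = t * real n" using k False by (auto simp: t_def)
  have "vnorm d (\<lambda>i. z0 i + real k * h * w i)
      = vnorm d (\<lambda>i. (1 - t) * z0 i + t * (z0 i + real n * h * w i))"
    unfolding t(3) by (rule L2_set_cong) (auto simp: algebra_simps)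
  also have "\<dots> \<le> A" using vnorm_convex_le[OF t(1,2)] A_ge by (meson max.boundedI order_trans)
  finally show ?thesis .
qed (use A_ge in simp)

lemma short_le: "k \<le> n \<Longrightarrow> L * (real k * h)\<^sup>2 \<le> 1 / 4"
  using short h_pos L_nonneg
  by (meson mult_left_mono mult_right_mono of_nat_0_le_iff of_nat_mono order_trans power_mono
      mult_nonneg_nonneg less_imp_le)

text \<open>A bound \<open>8 A / 7\<close> reproduces itself: the force moves the trajectory away from the free motion by at
  most \<open>L T\<^sup>2 / 2 \<le> 1 / 8\<close> of the bound, that is, by \<open>A / 7\<close>.\<close>

lemma displacement_le_if:
  assumes k: "k \<le> n" and IH: "\<And>j. j < k \<Longrightarrow> vnorm d (z j) \<le> 8 / 7 * A"
  shows "vnorm d (\<lambda>i. z k i - (z0 i + real k * h * w i)) \<le> 4 / 7 * L * (real k * h)\<^sup>2 * A"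
proof -
  let ?c = "\<lambda>j. - h\<^sup>2 * ((real k - real j) * trapezoid_weight j)"
  have "vnorm d (\<lambda>i. z k i - (z0 i + real k * h * w i)) = vnorm d (\<lambda>i. \<Sum>j<k. ?c j * G j i)"
    by (rule L2_set_cong) (auto simp: z_eq[OF k] sum_distrib_left sum_negf mult.assoc)
  also have "\<dots> \<le> (\<Sum>j<k. \<bar>?c j\<bar> * vnorm d (G j))" by (rule vnorm_sum_le) simp
  also have "\<dots> \<le> (\<Sum>j<k. (h\<^sup>2 * (8 / 7 * L * A)) * ((real k - real j) * trapezoid_weight j))"
  proof (rule sum_mono)
    fix j assume "j \<in> {..<k}"
    then have j: "j < k" by simp
    have c: "\<bar>?c j\<bar> = h\<^sup>2 * ((real k - real j) * trapezoid_weight j)"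
      using j trapezoid_weight_nonneg[of j] by (simp add: abs_mult)
    have "vnorm d (G j) \<le> L * (8 / 7 * A)"
      using j k by (intro order_trans[OF G_le mult_left_mono[OF IH L_nonneg]]) auto
    then have "\<bar>?c j\<bar> * vnorm d (G j) \<le> \<bar>?c j\<bar> * (L * (8 / 7 * A))" by (rule mult_left_mono) simp
    then show "\<bar>?c j\<bar> * vnorm d (G j) \<le> (h\<^sup>2 * (8 / 7 * L * A)) * ((real k - real j) * trapezoid_weight j)"
      unfolding c by (simp add: algebra_simps)
  qed
  also have "\<dots> = 4 / 7 * L * (real k * h)\<^sup>2 * A"
    unfolding sum_distrib_left[symmetric] sum_trapezoid_weight_linear by (simp add: power_mult_distrib)
  finally show ?thesis .
qed

lemma growth_le: "k \<le> n \<Longrightarrow> vnorm d (z k) \<le> 8 / 7 * A"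
proof (induction k rule: less_induct)
  case (less k)
  have "vnorm d (\<lambda>i. z k i - (z0 i + real k * h * w i)) \<le> 4 / 7 * L * (real k * h)\<^sup>2 * A"
    using less by (intro displacement_le_if) auto
  also have "\<dots> \<le> 4 / 7 * (1 / 4) * A"
    using mult_right_mono[OF short_le[OF less.prems] A_nonneg] by (simp add: mult_ac)
  finally show ?case
    using vnorm_le_diff_add[where x="z k" and y="\<lambda>i. z0 i + real k * h * w i" and d=d] free_le[OF less.prems] by simp
qed

lemma displacement_le:
  "k \<le> n \<Longrightarrow> vnorm d (\<lambda>i. z k i - (z0 i + real k * h * w i)) \<le> 4 / 7 * L * (real k * h)\<^sup>2 * A"
  by (intro displacement_le_if growth_le) auto

lemma velocity_le:
  assumes k: "k < n"
  shows "vnorm d (\<lambda>i. w i - h * (\<Sum>j\<le>k. trapezoid_weight j * G j i))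
    \<le> vnorm d w + 8 / 7 * L * (real n * h) * A"
proof -
  have "vnorm d (\<lambda>i. h * (\<Sum>j\<le>k. trapezoid_weight j * G j i))
      = h * vnorm d (\<lambda>i. \<Sum>j\<le>k. trapezoid_weight j * G j i)"
    using h_pos by (subst vnorm_scale) simp
  also have "\<dots> \<le> h * (\<Sum>j\<le>k. \<bar>trapezoid_weight j\<bar> * vnorm d (G j))"
    using h_pos by (intro mult_left_mono vnorm_sum_le) auto
  also have "\<dots> \<le> h * (\<Sum>j\<le>k. trapezoid_weight j * (8 / 7 * L * A))"
  proof (intro mult_left_mono sum_mono)
    fix j assume "j \<in> {..k}"
    then have j: "j \<le> n" using k by simp
    have "vnorm d (G j) \<le> L * (8 / 7 * A)"
      by (intro order_trans[OF G_le mult_left_mono[OF growth_le L_nonneg]] j)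
    then show "\<bar>trapezoid_weight j\<bar> * vnorm d (G j) \<le> trapezoid_weight j * (8 / 7 * L * A)"
      using mult_left_mono[of _ _ "trapezoid_weight j"] trapezoid_weight_nonneg[of j]
      by (simp add: mult.assoc mult.left_commute[of L])
  qed (use h_pos in simp)
  also have "\<dots> = (real k + 1 / 2) * (8 / 7 * L * h * A)"
    by (simp only: sum_distrib_right[symmetric] sum_trapezoid_weight) (simp add: algebra_simps)
  also have "\<dots> \<le> real n * (8 / 7 * L * h * A)"
    using k h_pos L_nonneg A_nonneg by (intro mult_right_mono mult_nonneg_nonneg) auto
  finally show ?thesis
    using vnorm_diff_le[where d=d and x=w and y="\<lambda>i. h * (\<Sum>j\<le>k. trapezoid_weight j * G j i)"]
    by (simp add: algebra_simps)
qed

end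

text \<open>Contraction of the difference of two trajectories with the same initial velocity. The
  strong monotonicity of the force is available at each grid time because the distance stays
  above \<open>6 / 7\<close> of its initial value; the terms of order \<open>L\<^sup>2 T\<^sup>4\<close> that come from the motion and from the square of
  the total impulse are dominated by \<open>K T\<^sup>2\<close> because \<open>L\<^sup>2 T\<^sup>2 \<le> K\<close>.\<close>

lemma (in linear_growth) contraction:
  assumes w: "w = (\<lambda>_. 0)" and A: "vnorm d z0 = A"
    and K: "0 < K" "K \<le> L" "L * (real n * h)\<^sup>2 \<le> K / L"
    and mono: "\<And>j. j < n \<Longrightarrow> 6 / 7 * A \<le> vnorm d (z j) \<Longrightarrow> K * (vnorm d (z j))\<^sup>2 \<le> vinner d (z j) (G j)"
  shows "vnorm d (z n) \<le> (1 - 51 / 200 * K * (real n * h)\<^sup>2) * A"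
proof -
  define T where "T = real n * h"
  have T0: "0 \<le> T" using h_pos by (simp add: T_def)
  have LT: "L * T\<^sup>2 \<le> 1 / 4" "L * T\<^sup>2 \<le> K / L" using short K by (simp_all add: T_def)
  have LLT: "L\<^sup>2 * T\<^sup>2 \<le> K" using LT(2) K by (simp add: field_simps power2_eq_square)
  have KT: "K * T\<^sup>2 \<le> 1 / 4" using LT(1) mult_right_mono[OF K(2), of "T\<^sup>2"] by simp
  have time: "(real j * h)\<^sup>2 \<le> T\<^sup>2" if "j \<le> n" for j
    unfolding T_def using that h_pos by (intro power_mono mult_right_mono) auto
  define I where "I i = h\<^sup>2 * (\<Sum>j<n. (real n - real j) * trapezoid_weight j * G j i)" for i
  have zn: "vnorm d (z n) = vnorm d (\<lambda>i. z0 i - I i)"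
    by (rule L2_set_cong) (auto simp: z_eq I_def w)
  have lower: "K * A\<^sup>2 - (8 / 7 * K * L + 32 / 49 * L\<^sup>2) * A\<^sup>2 * (real j * h)\<^sup>2 \<le> vinner d z0 (G j)"
    if j: "j < n" for j
  proof -
    let ?s = "(real j * h)\<^sup>2"
    have dj: "vnorm d (\<lambda>i. z0 i - z j i) \<le> 4 / 7 * L * ?s * A"
      using displacement_le[of j] j vdist_commute[where x=z0 and y="z j" and d=d] by (simp add: w)
    have Ls: "L * ?s \<le> 1 / 4" using short_le[of j] j by simp
    have "4 / 7 * L * ?s * A \<le> 1 / 7 * A" using mult_right_mono[OF Ls A_nonneg] by (simp add: mult_ac)
    then have zj: "A - 4 / 7 * L * ?s * A \<le> vnorm d (z j)" "6 / 7 * A \<le> vnorm d (z j)"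
      using vnorm_le_diff_add[where x=z0 and y="z j" and d=d] dj A
        \<open>4 / 7 * L * ?s * A \<le> 1 / 7 * A\<close> by linarith+
    have "2 * A * (4 / 7 * L * ?s * A) = 8 / 7 * L * ?s * A\<^sup>2"
      by (simp add: power2_eq_square[of A])
    then have "A\<^sup>2 - 8 / 7 * L * ?s * A\<^sup>2 \<le> (A - 4 / 7 * L * ?s * A)\<^sup>2"
      using zero_le_power2[of "4 / 7 * L * ?s * A"] unfolding power2_diff by linarith
    also have "\<dots> \<le> (vnorm d (z j))\<^sup>2"
      by (rule power_mono[OF zj(1)]) (use \<open>4 / 7 * L * ?s * A \<le> 1 / 7 * A\<close> A_nonneg in linarith)
    finally have "K * (A\<^sup>2 - 8 / 7 * L * ?s * A\<^sup>2) \<le> K * (vnorm d (z j))\<^sup>2"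
      using K by simp
    also have "\<dots> \<le> vinner d (z j) (G j)" by (rule mono[OF j zj(2)])
    finally have a: "K * (A\<^sup>2 - 8 / 7 * L * ?s * A\<^sup>2) \<le> vinner d (z j) (G j)" .
    have "\<bar>vinner d (\<lambda>i. z0 i - z j i) (G j)\<bar> \<le> vnorm d (\<lambda>i. z0 i - z j i) * vnorm d (G j)"
      by (rule vinner_le)
    also have "\<dots> \<le> (4 / 7 * L * ?s * A) * (L * (8 / 7 * A))"
      using j by (intro mult_mono dj order_trans[OF G_le mult_left_mono[OF growth_le L_nonneg]])
        (auto intro!: mult_nonneg_nonneg L_nonneg A_nonneg)
    finally have b: "\<bar>vinner d (\<lambda>i. z0 i - z j i) (G j)\<bar> \<le> 32 / 49 * L\<^sup>2 * A\<^sup>2 * ?s"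
      by (simp add: power2_eq_square algebra_simps)
    have "vinner d z0 (G j) = vinner d (z j) (G j) + vinner d (\<lambda>i. z0 i - z j i) (G j)"
      by (simp add: vinner_diff_left)
    with a b show ?thesis by (simp add: algebra_simps)
  qed
  let ?c = "\<lambda>j. h\<^sup>2 * ((real n - real j) * trapezoid_weight j)"
  let ?B = "(8 / 7 * K * L + 32 / 49 * L\<^sup>2) * A\<^sup>2"
  have c0: "0 \<le> ?c j" if "j < n" for j using that trapezoid_weight_nonneg[of j] by simp
  have c1: "(\<Sum>j<n. ?c j) = T\<^sup>2 / 2"
    by (simp only: sum_distrib_left[symmetric] sum_trapezoid_weight_linear)
      (simp add: T_def power_mult_distrib)
  have c2: "(\<Sum>j<n. ?c j * (real j * h)\<^sup>2) \<le> T ^ 4 / 12"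
  proof -
    have "(\<Sum>j<n. ?c j * (real j * h)\<^sup>2)
        = h ^ 4 * (\<Sum>j<n. (real n - real j) * trapezoid_weight j * (real j)\<^sup>2)"
      unfolding sum_distrib_left by (intro sum.cong) (auto simp: power_mult_distrib power2_eq_square power4_eq_xxxx)
    also have "\<dots> \<le> h ^ 4 * ((real n)\<^sup>2 * (real n)\<^sup>2 / 12)"
      unfolding sum_trapezoid_weight_cubic by (intro mult_left_mono divide_right_mono) auto
    finally show ?thesis by (simp add: T_def power_mult_distrib mult.commute)
  qed
  have I_eq: "I = (\<lambda>i. \<Sum>j<n. ?c j * G j i)"
    by (auto simp: I_def sum_distrib_left mult.assoc)
  have weighted: "\<alpha> * (\<Sum>j<n. c j) - \<beta> * (\<Sum>j<n. c j * s j) = (\<Sum>j<n. c j * (\<alpha> - \<beta> * s j))"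
    for \<alpha> \<beta> :: real and c s :: "nat \<Rightarrow> real"
    by (simp add: sum_distrib_left sum_subtractf[symmetric] right_diff_distrib mult_ac)
  have "K * A\<^sup>2 * (T\<^sup>2 / 2) - ?B * (T ^ 4 / 12) \<le> K * A\<^sup>2 * (\<Sum>j<n. ?c j) - ?B * (\<Sum>j<n. ?c j * (real j * h)\<^sup>2)"
    unfolding c1 using mult_left_mono[OF c2, of ?B] K L_nonneg by simp
  also have "\<dots> = (\<Sum>j<n. ?c j * (K * A\<^sup>2 - ?B * (real j * h)\<^sup>2))"
    by (rule weighted)
  also have "\<dots> \<le> (\<Sum>j<n. ?c j * vinner d z0 (G j))"
    using lower c0 by (intro sum_mono mult_left_mono) auto
  also have "\<dots> = vinner d z0 I"
    unfolding I_eq vinner_sum_right ..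
  finally have inner: "K * A\<^sup>2 * (T\<^sup>2 / 2) - ?B * (T ^ 4 / 12) \<le> vinner d z0 I" .
  have "vnorm d I = vnorm d (\<lambda>i. z n i - (z0 i + real n * h * w i))"
  proof -
    have "vnorm d (\<lambda>i. z n i - (z0 i + real n * h * w i)) = vnorm d (\<lambda>i. - I i)"
      by (rule L2_set_cong) (auto simp: z_eq I_def)
    then show ?thesis by (simp add: vnorm_minus)
  qed
  then have "vnorm d I \<le> 4 / 7 * L * T\<^sup>2 * A"
    using displacement_le[of n] by (simp add: T_def)
  then have I2: "(vnorm d I)\<^sup>2 \<le> (4 / 7 * L * T\<^sup>2 * A)\<^sup>2" by (intro power_mono) auto
  have T4: "L\<^sup>2 * T ^ 4 \<le> K * T\<^sup>2" "K * L * T ^ 4 \<le> K * T\<^sup>2 * (1 / 4)"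
    using mult_right_mono[OF LLT, of "T\<^sup>2"] mult_left_mono[OF LT(1), of "K * T\<^sup>2"] K
    by (simp_all add: power2_eq_square power4_eq_xxxx algebra_simps)
  have "(vnorm d (z n))\<^sup>2 = A\<^sup>2 - 2 * vinner d z0 I + (vnorm d I)\<^sup>2"
    unfolding zn vnorm_diff_sq A ..
  also have "\<dots> \<le> A\<^sup>2 - 2 * (K * A\<^sup>2 * (T\<^sup>2 / 2) - ?B * (T ^ 4 / 12)) + (4 / 7 * L * T\<^sup>2 * A)\<^sup>2"
    by (intro add_mono diff_left_mono mult_left_mono inner I2) auto
  also have "\<dots> = A\<^sup>2 * (1 - K * T\<^sup>2 + 4 / 21 * (K * L * T ^ 4) + 64 / 147 * (L\<^sup>2 * T ^ 4))"
    by (simp add: power2_eq_square power4_eq_xxxx field_simps)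
  also have "\<dots> \<le> A\<^sup>2 * (1 - 51 / 100 * (K * T\<^sup>2))"
  proof (rule mult_left_mono)
    have aux: "1 - k + 4 / 21 * a + 64 / 147 * b \<le> 1 - 51 / 100 * k"
      if "b \<le> k" "a \<le> k * (1 / 4)" "0 \<le> k" for a b k :: real
      using that by linarith
    show "1 - K * T\<^sup>2 + 4 / 21 * (K * L * T ^ 4) + 64 / 147 * (L\<^sup>2 * T ^ 4)
        \<le> 1 - 51 / 100 * (K * T\<^sup>2)" by (rule aux[OF T4]) (use K in simp)
  qed simp
  also have "\<dots> \<le> A\<^sup>2 * (1 - 51 / 200 * (K * T\<^sup>2))\<^sup>2"
    by (intro mult_left_mono) (simp_all add: power2_diff)
  also have "\<dots> = ((1 - 51 / 200 * K * T\<^sup>2) * A)\<^sup>2" by (simp add: power_mult_distrib mult.assoc)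
  finally show ?thesis
    unfolding T_def[symmetric] by (rule power2_le_imp_le) (use KT A_nonneg in simp)
qed

section \<open>The integrator on the grid\<close>

context smooth_potential
begin

text \<open>The positions at the grid times together with the velocities half a step later, for which
  the integrator takes its simplest form.\<close>

primrec leapfrog :: "real \<Rightarrow> (nat \<Rightarrow> real) \<Rightarrow> (nat \<Rightarrow> real) \<Rightarrow> nat \<Rightarrow> (nat \<Rightarrow> real) \<times> (nat \<Rightarrow> real)" where
  "leapfrog h x v 0 = (x, \<lambda>i. v i - h / 2 * g x i)"
| "leapfrog h x v (Suc k) = (let q = line d (fst (leapfrog h x v k)) (snd (leapfrog h x v k)) h
     in (q, \<lambda>i. snd (leapfrog h x v k) i - h * g q i))"

abbreviation pos :: "real \<Rightarrow> (nat \<Rightarrow> real) \<Rightarrow> (nat \<Rightarrow> real) \<Rightarrow> nat \<Rightarrow> nat \<Rightarrow> real" where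
  "pos h x v k \<equiv> fst (leapfrog h x v k)"

abbreviation half_vel :: "real \<Rightarrow> (nat \<Rightarrow> real) \<Rightarrow> (nat \<Rightarrow> real) \<Rightarrow> nat \<Rightarrow> nat \<Rightarrow> real" where
  "half_vel h x v k \<equiv> snd (leapfrog h x v k)"

definition vel :: "real \<Rightarrow> (nat \<Rightarrow> real) \<Rightarrow> (nat \<Rightarrow> real) \<Rightarrow> nat \<Rightarrow> nat \<Rightarrow> real" where
  "vel h x v k = (\<lambda>i\<in>{..<d}. half_vel h x v k i + h / 2 * g (pos h x v k) i)"

lemma pos_Suc: "pos h x v (Suc k) = line d (pos h x v k) (half_vel h x v k) h"
  and half_vel_Suc: "half_vel h x v (Suc k) = (\<lambda>i. half_vel h x v k i - h * g (pos h x v (Suc k)) i)"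
  by (simp_all add: Let_def)

lemma pos_in_Rd: "x \<in> Rd d \<Longrightarrow> pos h x v k \<in> Rd d"
  by (cases k) (simp_all add: Let_def)

lemma half_vel_eq:
  "half_vel h x v k i = v i - h * (\<Sum>j\<le>k. trapezoid_weight j * g (pos h x v j) i)"
proof (induction k)
  case 0
  then show ?case by (simp add: trapezoid_weight_def)
next
  case (Suc k)
  have "half_vel h x v (Suc k) i = half_vel h x v k i - h * g (pos h x v (Suc k)) i"
    by (simp only: half_vel_Suc)
  then show ?case
    unfolding Suc by (simp add: trapezoid_weight_def algebra_simps del: leapfrog.simps)
qed

lemma pos_eq:
  assumes i: "i < d"
  shows "pos h x v k i = x i + real k * h * v i
    - h\<^sup>2 * (\<Sum>j<k. (real k - real j) * trapezoid_weight j * g (pos h x v j) i)"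
proof (induction k)
  case (Suc k)
  let ?t = "\<lambda>j. trapezoid_weight j * g (pos h x v j) i"
  have "(\<Sum>j<Suc k. (real (Suc k) - real j) * ?t j) = (\<Sum>j<Suc k. (real k - real j) * ?t j) + (\<Sum>j<Suc k. ?t j)"
    by (simp only: sum.distrib[symmetric]) (simp add: algebra_simps del: leapfrog.simps)
  then have "(\<Sum>j<Suc k. (real (Suc k) - real j) * ?t j) = (\<Sum>j<k. (real k - real j) * ?t j) + (\<Sum>j\<le>k. ?t j)"
    by (simp add: lessThan_Suc_atMost[symmetric] del: leapfrog.simps)
  moreover have "pos h x v (Suc k) i = pos h x v k i + h * half_vel h x v k i"
    unfolding pos_Suc using i by (simp add: line_def)
  ultimately show ?case
    unfolding half_vel_eq using Suc
    by (simp add: algebra_simps power2_eq_square del: leapfrog.simps)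
qed simp

lemma verlet_flow_eq_leapfrog:
  assumes h: "0 < h" and x: "x \<in> Rd d" and v: "v \<in> Rd d"
  shows "verlet_flow d U h (real k * h) x v = (pos h x v k, vel h x v k)"
proof -
  obtain q p where sol: "verlet_solution d U h x v q p"
    using verlet_solution_exists[OF h x v] by blast
  have qR: "q t \<in> Rd d" "p t \<in> Rd d" if "t \<ge> 0" for t
    using sol that unfolding verlet_solution_def by blast+
  have "q (real k * h) = pos h x v k \<and> p (real k * h) = vel h x v k"
  proof (induction k)
    case 0
    have "p 0 = vel h x v 0"
      using sol v by (intro Rd_eqI[of _ d]) (auto simp: verlet_solution_def vel_def)
    then show ?case using sol by (simp add: verlet_solution_def)
  next
    case (Suc k)
    have s: "real k * h \<le> real (Suc k) * h" "real (Suc k) * h - real k * h = h"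
      "0 \<le> real (Suc k) * h" using h by (auto simp: algebra_simps)
    have q: "q (real (Suc k) * h) = pos h x v (Suc k)"
    proof (rule Rd_eqI[OF qR(1)[OF s(3)] pos_in_Rd[OF x]])
      fix i assume i: "i < d"
      show "q (real (Suc k) * h) i = pos h x v (Suc k) i"
        using verlet_solution_cell(1)[OF h sol i s(1) order_refl] i Suc s(2)
        unfolding pos_Suc by (simp add: line_def vel_def)
    qed
    have "p (real (Suc k) * h) = vel h x v (Suc k)"
    proof (rule Rd_eqI[OF qR(2)[OF s(3)]])
      fix i assume i: "i < d"
      show "p (real (Suc k) * h) i = vel h x v (Suc k) i"
        using verlet_solution_cell(2)[OF h sol i s(1) order_refl] i Suc s(2) q
        unfolding vel_def half_vel_Suc by (simp add: algebra_simps del: leapfrog.simps)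
    qed (simp add: vel_def)
    with q show ?case by simp
  qed
  then show ?thesis
    using verlet_flow_eq[OF h _ sol, of "real k * h"] h by simp
qed

text \<open>The kicks at the two ends of a step do work by the trapezoidal rule, up to a term that
  telescopes.\<close>

lemma energy_change:
  assumes x: "x \<in> Rd d" and v: "v \<in> Rd d"
  shows "hamiltonian d U (pos h x v n, vel h x v n) - hamiltonian d U (x, v)
    = (\<Sum>k<n. work_error (pos h x v k) (\<lambda>i. h * half_vel h x v k i))
      + h\<^sup>2 / 8 * ((vnorm d (g (pos h x v n)))\<^sup>2 - (vnorm d (g x))\<^sup>2)"
proof (induction n)
  case 0
  have "vel h x v 0 = v" using v by (intro Rd_eqI[of _ d]) (auto simp: vel_def)
  then show ?case by simp
next
  case (Suc k)
  define q u q' where "q = pos h x v k" and "u = half_vel h x v k" and "q' = pos h x v (Suc k)"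
  have q': "line d q (\<lambda>i. h * u i) 1 = q'"
    unfolding q'_def pos_Suc q_def u_def by (rule Rd_eqI[of _ d]) (auto simp: line_def)
  have kin: "(vnorm d (\<lambda>i. u i + c * g y i))\<^sup>2
      = (vnorm d u)\<^sup>2 + 2 * c * vinner d u (g y) + c\<^sup>2 * (vnorm d (g y))\<^sup>2" for c y
    using vnorm_diff_sq[where d=d and x=u and y="\<lambda>i. - c * g y i"] vnorm_scale[where d=d and c="- c" and x="g y"]
      vinner_scale_left[where d=d and c="- c" and x="g y" and z=u] vinner_commute[where d=d and x=u]
    by (simp add: power_mult_distrib)
  have v1: "vnorm d (vel h x v k) = vnorm d (\<lambda>i. u i + h / 2 * g q i)"
    unfolding vel_def u_def q_def by simp
  have v2: "vnorm d (vel h x v (Suc k)) = vnorm d (\<lambda>i. u i + (- (h / 2)) * g q' i)"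
    unfolding vel_def half_vel_Suc u_def q'_def
    by (rule L2_set_cong) (auto simp: algebra_simps simp del: leapfrog.simps)
  have "hamiltonian d U (pos h x v (Suc k), vel h x v (Suc k)) - hamiltonian d U (pos h x v k, vel h x v k)
      = work_error q (\<lambda>i. h * u i) + h\<^sup>2 / 8 * ((vnorm d (g q'))\<^sup>2 - (vnorm d (g q))\<^sup>2)"
    unfolding hamiltonian_def fst_conv snd_conv v1 v2 kin work_error_def q' vinner_scale_left
    unfolding q_def[symmetric] q'_def[symmetric]
    by (simp add: field_simps power2_eq_square)
  then show ?case
    using Suc unfolding q_def u_def q'_def
    by (simp add: algebra_simps del: leapfrog.simps)
qed

end

section \<open>Bounds for one transition\<close>

text \<open>The conditions on the time horizon in the form in which they are used: \<open>L T R \<le> 1 / 16\<close> is the square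
  root of the one that involves \<open>R\<close>.\<close>

locale hmc_potential = smooth_potential +
  fixes T h :: real and n :: nat
  assumes h_pos: "0 < h" and T_pos: "0 < T" and T_eq: "T = real n * h"
    and LT_le: "L * T\<^sup>2 \<le> 1 / 4" "L * T\<^sup>2 \<le> K / L" and LTR_le: "L * T * R \<le> 1 / 16"
begin

abbreviation end_pos :: "(nat \<Rightarrow> real) \<Rightarrow> (nat \<Rightarrow> real) \<Rightarrow> nat \<Rightarrow> real" where
  "end_pos x v \<equiv> fst (verlet_flow d U h T x v)"

abbreviation energy_error :: "(nat \<Rightarrow> real) \<Rightarrow> (nat \<Rightarrow> real) \<Rightarrow> real" where
  "energy_error x v \<equiv> hamiltonian d U (verlet_flow d U h T x v) - hamiltonian d U (x, v)"

lemma flow_eq: "x \<in> Rd d \<Longrightarrow> v \<in> Rd d \<Longrightarrow> verlet_flow d U h T x v = (pos h x v n, vel h x v n)"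
  unfolding T_eq by (rule verlet_flow_eq_leapfrog[OF h_pos])

text \<open>A single trajectory behaves like the difference of two trajectories, since the origin is an
  equilibrium.\<close>

lemma single_growth:
  assumes "x \<in> Rd d" "vnorm d x \<le> A" "vnorm d (\<lambda>i. x i + T * v i) \<le> A"
  shows "linear_growth d n h L A (pos h x v) (\<lambda>j. g (pos h x v j)) x v"
  using assms h_pos bounds_nonneg(1) LT_le(1) pos_eq grad_le pos_in_Rd
  by unfold_locales (simp_all add: T_eq del: leapfrog.simps)

lemma pair_growth:
  assumes "x \<in> Rd d" "y \<in> Rd d" "vdist d x y \<le> A" "vnorm d (\<lambda>i. x i - y i + T * (v i - w i)) \<le> A"
  shows "linear_growth d n h L A (\<lambda>k i. pos h x v k i - pos h y w k i)
    (\<lambda>j i. g (pos h x v j) i - g (pos h y w j) i) (\<lambda>i. x i - y i) (\<lambda>i. v i - w i)"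
proof
  show "pos h x v k i - pos h y w k i = x i - y i + real k * h * (v i - w i)
      - h\<^sup>2 * (\<Sum>j<k. (real k - real j) * trapezoid_weight j * (g (pos h x v j) i - g (pos h y w j) i))"
    if "i < d" for k i
  proof -
    have "(\<Sum>j<k. c j * (a j - b j)) = (\<Sum>j<k. c j * a j) - (\<Sum>j<k. c j * b j)" for a b c :: "nat \<Rightarrow> real"
      by (simp add: right_diff_distrib sum_subtractf)
    then show ?thesis unfolding pos_eq[OF that] by (simp add: right_diff_distrib)
  qed
  show "vdist d (g (pos h x v j)) (g (pos h y w j)) \<le> L * vdist d (pos h x v j) (pos h y w j)" for j
    by (intro grad_lipschitz pos_in_Rd assms)
qed (use assms h_pos bounds_nonneg LT_le in \<open>simp_all add: T_eq\<close>)

lemma end_dist_le: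
  assumes "x \<in> Rd d" "y \<in> Rd d" "v \<in> Rd d" "w \<in> Rd d"
    and "vdist d x y \<le> A" "vnorm d (\<lambda>i. x i - y i + T * (v i - w i)) \<le> A"
  shows "vdist d (end_pos x v) (end_pos y w)
    \<le> vnorm d (\<lambda>i. x i - y i + T * (v i - w i)) + 4 / 7 * L * T\<^sup>2 * A"
proof -
  interpret linear_growth d n h L A "\<lambda>k i. pos h x v k i - pos h y w k i"
    "\<lambda>j i. g (pos h x v j) i - g (pos h y w j) i" "\<lambda>i. x i - y i" "\<lambda>i. v i - w i"
    by (rule pair_growth) fact+
  show ?thesis
    using displacement_le[of n, folded T_eq] assms
      vnorm_le_diff_add[where d=d and x="\<lambda>i. pos h x v n i - pos h y w n i"
        and y="\<lambda>i. x i - y i + T * (v i - w i)"]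
    by (simp add: flow_eq)
qed

lemma end_dist_contraction:
  assumes "x \<in> Rd d" "y \<in> Rd d" "v \<in> Rd d" and far: "2 * R \<le> vdist d x y"
  shows "vdist d (end_pos x v) (end_pos y v) \<le> (1 - 51 / 200 * K * T\<^sup>2) * vdist d x y"
proof -
  interpret linear_growth d n h L "vdist d x y" "\<lambda>k i. pos h x v k i - pos h y v k i"
    "\<lambda>j i. g (pos h x v j) i - g (pos h y v j) i" "\<lambda>i. x i - y i" "\<lambda>i. v i - v i"
    by (rule pair_growth) (use assms in auto)
  have "vdist d (pos h x v n) (pos h y v n) \<le> (1 - 51 / 200 * K * T\<^sup>2) * vdist d x y"
    unfolding T_eq
  proof (rule contraction)
    show "K * (vdist d (pos h x v j) (pos h y v j))\<^sup>2
        \<le> vinner d (\<lambda>i. pos h x v j i - pos h y v j i) (\<lambda>i. g (pos h x v j) i - g (pos h y v j) i)"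
      if "6 / 7 * vdist d x y \<le> vdist d (pos h x v j) (pos h y v j)" for j
      using that far R_nonneg by (intro strongly_convex_at_distance pos_in_Rd assms) linarith
  qed (use K_pos K_le_L LT_le in \<open>simp_all add: T_eq\<close>)
  then show ?thesis using assms by (simp add: flow_eq)
qed

lemma energy_error_eq:
  assumes "x \<in> Rd d" "v \<in> Rd d"
  shows "energy_error x v = (\<Sum>k<n. work_error (pos h x v k) (\<lambda>i. h * half_vel h x v k i))
      + h\<^sup>2 / 8 * ((vnorm d (g (pos h x v n)))\<^sup>2 - (vnorm d (g x))\<^sup>2)"
  using energy_change[OF assms, of h n] assms by (simp add: flow_eq)

text \<open>The \<open>T / h\<close> steps contribute errors of order \<open>h\<^sup>3\<close> each.\<close>

lemma energy_error_le:
  assumes x: "x \<in> Rd d" "v \<in> Rd d"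
    and P: "\<And>k. k < n \<Longrightarrow> vnorm d (half_vel h x v k) \<le> P"
    and Q: "\<And>k. k \<le> n \<Longrightarrow> vnorm d (pos h x v k) \<le> Q"
  shows "\<bar>energy_error x v\<bar> \<le> h\<^sup>2 * (T * M * P ^ 3 / 2 + L\<^sup>2 * Q\<^sup>2 / 8)"
proof -
  have "\<bar>work_error (pos h x v k) (\<lambda>i. h * half_vel h x v k i)\<bar> \<le> M * (h * P) ^ 3 / 2" if "k < n" for k
    using P[OF that] h_pos
    by (intro work_error_le pos_in_Rd x) (simp add: vnorm_scale)
  then have "\<bar>\<Sum>k<n. work_error (pos h x v k) (\<lambda>i. h * half_vel h x v k i)\<bar> \<le> (\<Sum>k<n. M * (h * P) ^ 3 / 2)"
    by (intro order_trans[OF sum_abs sum_mono]) auto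
  also have "\<dots> = h\<^sup>2 * (T * M * P ^ 3 / 2)"
    by (simp add: T_eq power_mult_distrib power3_eq_cube power2_eq_square)
  finally have 1: "\<bar>\<Sum>k<n. work_error (pos h x v k) (\<lambda>i. h * half_vel h x v k i)\<bar>
      \<le> h\<^sup>2 * (T * M * P ^ 3 / 2)" .
  have G: "(vnorm d (g (pos h x v k)))\<^sup>2 \<le> L\<^sup>2 * Q\<^sup>2" if "k \<le> n" for k
    using order_trans[OF grad_le[OF pos_in_Rd[OF x(1)]] mult_left_mono[OF Q[OF that] bounds_nonneg(1)]]
    by (simp add: power_mult_distrib[symmetric] power_mono)
  have "\<bar>(vnorm d (g (pos h x v n)))\<^sup>2 - (vnorm d (g x))\<^sup>2\<bar> \<le> L\<^sup>2 * Q\<^sup>2"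
    using G[of n] G[of 0] by (simp add: abs_le_iff) (smt (verit) zero_le_power2)
  then have "\<bar>h\<^sup>2 / 8 * ((vnorm d (g (pos h x v n)))\<^sup>2 - (vnorm d (g x))\<^sup>2)\<bar> \<le> h\<^sup>2 / 8 * (L\<^sup>2 * Q\<^sup>2)"
    unfolding abs_mult by (intro mult_mono) auto
  with 1 show ?thesis
    unfolding energy_error_eq[OF x] distrib_left times_divide_eq_right times_divide_eq_left by linarith
qed

lemma energy_error_diff_le:
  assumes x: "x \<in> Rd d" "v \<in> Rd d" and y: "y \<in> Rd d" "w \<in> Rd d"
    and P: "\<And>k. k < n \<Longrightarrow> vnorm d (half_vel h x v k) \<le> P" "\<And>k. k < n \<Longrightarrow> vnorm d (half_vel h y w k) \<le> P"
    and Q: "\<And>k. k \<le> n \<Longrightarrow> vnorm d (pos h x v k) \<le> Q" "\<And>k. k \<le> n \<Longrightarrow> vnorm d (pos h y w k) \<le> Q"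
    and W: "\<And>k. k < n \<Longrightarrow> vdist d (half_vel h x v k) (half_vel h y w k) \<le> W"
    and Z: "\<And>k. k \<le> n \<Longrightarrow> vdist d (pos h x v k) (pos h y w k) \<le> Z"
  shows "\<bar>energy_error x v - energy_error y w\<bar>
    \<le> h\<^sup>2 * (T * (N * Z * P ^ 3 + 3 * M * W * P\<^sup>2) / 2 + L\<^sup>2 * Z * Q / 2)"
proof -
  let ?\<delta> = "\<lambda>k i. h * half_vel h x v k i" and ?\<epsilon> = "\<lambda>k i. h * half_vel h y w k i"
  have step: "line d (pos h x v k) (\<lambda>i. h * half_vel h x v k i) 1 = pos h x v (Suc k)" for x v k
    unfolding pos_Suc by (simp add: line_def)
  have "\<bar>work_error (pos h x v k) (?\<delta> k) - work_error (pos h y w k) (?\<epsilon> k)\<bar>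
      \<le> (N * Z * (h * P) ^ 3 + 3 * M * (h * W) * (h * P)\<^sup>2) / 2" if k: "k < n" for k
  proof (rule work_error_diff_le)
    show "vdist d (?\<delta> k) (?\<epsilon> k) \<le> h * W"
      using W[OF k] h_pos vnorm_scale[where c=h and d=d and x="\<lambda>i. half_vel h x v k i - half_vel h y w k i"]
      by (simp add: right_diff_distrib)
    show "vdist d (line d (pos h x v k) (?\<delta> k) 1) (line d (pos h y w k) (?\<epsilon> k) 1) \<le> Z"
      unfolding step using k by (intro Z) simp
    show "vdist d (pos h x v k) (pos h y w k) \<le> Z" using k by (intro Z) simp
  qed (use P[OF k] x y h_pos in \<open>simp_all add: pos_in_Rd vnorm_scale\<close>)
  then have "\<bar>\<Sum>k<n. work_error (pos h x v k) (?\<delta> k) - work_error (pos h y w k) (?\<epsilon> k)\<bar>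
      \<le> (\<Sum>k<n. (N * Z * (h * P) ^ 3 + 3 * M * (h * W) * (h * P)\<^sup>2) / 2)"
    by (intro order_trans[OF sum_abs sum_mono]) auto
  also have "\<dots> = h\<^sup>2 * (T * (N * Z * P ^ 3 + 3 * M * W * P\<^sup>2) / 2)"
    by (simp add: T_eq power3_eq_cube power2_eq_square algebra_simps)
  finally have 1: "\<bar>(\<Sum>k<n. work_error (pos h x v k) (?\<delta> k)) - (\<Sum>k<n. work_error (pos h y w k) (?\<epsilon> k))\<bar>
      \<le> h\<^sup>2 * (T * (N * Z * P ^ 3 + 3 * M * W * P\<^sup>2) / 2)"
    by (simp add: sum_subtractf)
  have Q0: "0 \<le> Q" using order_trans[OF L2_set_nonneg Q(1)[of 0]] by simp
  have Z0: "0 \<le> Z" using order_trans[OF L2_set_nonneg Z[of 0]] by simp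
  have G: "\<bar>(vnorm d (g (pos h x v k)))\<^sup>2 - (vnorm d (g (pos h y w k)))\<^sup>2\<bar> \<le> (L * Z) * (2 * (L * Q))"
    if k: "k \<le> n" for k
  proof (rule order_trans[OF vnorm_sq_diff_le mult_mono])
    show "vdist d (g (pos h x v k)) (g (pos h y w k)) \<le> L * Z"
      by (intro order_trans[OF grad_lipschitz mult_left_mono[OF Z[OF k]]] pos_in_Rd x y bounds_nonneg)
    have "vnorm d (g (pos h x v k)) \<le> L * Q"
      by (intro order_trans[OF grad_le mult_left_mono[OF Q(1)[OF k]]] pos_in_Rd x bounds_nonneg)
    moreover have "vnorm d (g (pos h y w k)) \<le> L * Q"
      by (intro order_trans[OF grad_le mult_left_mono[OF Q(2)[OF k]]] pos_in_Rd y bounds_nonneg)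
    ultimately show "vnorm d (g (pos h x v k)) + vnorm d (g (pos h y w k)) \<le> 2 * (L * Q)" by simp
  qed (use bounds_nonneg Q0 Z0 in auto)
  have 2: "\<bar>((vnorm d (g (pos h x v n)))\<^sup>2 - (vnorm d (g x))\<^sup>2)
      - ((vnorm d (g (pos h y w n)))\<^sup>2 - (vnorm d (g y))\<^sup>2)\<bar> \<le> 4 * (L\<^sup>2 * Z * Q)"
    using G[of n] G[of 0] by (simp add: power2_eq_square algebra_simps abs_le_iff)
  have eq: "energy_error x v - energy_error y w
      = ((\<Sum>k<n. work_error (pos h x v k) (?\<delta> k)) - (\<Sum>k<n. work_error (pos h y w k) (?\<epsilon> k)))
        + h\<^sup>2 / 8 * (((vnorm d (g (pos h x v n)))\<^sup>2 - (vnorm d (g x))\<^sup>2)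
          - ((vnorm d (g (pos h y w n)))\<^sup>2 - (vnorm d (g y))\<^sup>2))"
    unfolding energy_error_eq[OF x] energy_error_eq[OF y] by (simp add: algebra_simps)
  have "\<bar>h\<^sup>2 / 8 * (((vnorm d (g (pos h x v n)))\<^sup>2 - (vnorm d (g x))\<^sup>2)
          - ((vnorm d (g (pos h y w n)))\<^sup>2 - (vnorm d (g y))\<^sup>2))\<bar> \<le> h\<^sup>2 / 8 * (4 * (L\<^sup>2 * Z * Q))"
    unfolding abs_mult by (intro mult_mono 2) auto
  with 1 show ?thesis
    unfolding eq distrib_left times_divide_eq_right times_divide_eq_left by linarith
qed

text \<open>A constant that depends on \<open>L\<close> only and bounds \<open>L\<close>, \<open>T\<close> and the growth of positions and
  velocities during one transition.\<close>

definition D :: real where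
  "D = 3 * (1 + L + 1 / L)\<^sup>2"

lemma D_ge: "1 \<le> D" "L \<le> D" "T \<le> D"
  and growth_const: "8 / 7 * (1 + T) \<le> D" "1 + 8 / 7 * L * T * (1 + T) \<le> D"
proof -
  define E where "E = 1 + L + 1 / L"
  have L0: "0 < 1 / L" using L_pos by simp
  have E: "1 \<le> E" "L \<le> E" "1 + 1 / L \<le> E" using L_pos L0 by (auto simp: E_def)
  have E2: "E \<le> E\<^sup>2" using E by (simp add: power2_eq_square mult_le_cancel_left1)
  have DE: "D = 3 * E\<^sup>2" by (simp add: D_def E_def)
  have "T \<le> 1 + 1 / L"
  proof (cases "T \<le> 1")
    case False
    then have "T \<le> T\<^sup>2" by (simp add: power2_eq_square)
    also have "\<dots> \<le> 1 / L" using LT_le(1) L_pos by (simp add: field_simps)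
    finally show ?thesis by simp
  qed (use L0 in linarith)
  then have T: "T \<le> E" "1 + T \<le> 2 * E" using E by auto
  have "(L * T)\<^sup>2 \<le> L / 4" using mult_left_mono[OF LT_le(1), of L] L_pos
    by (simp add: power2_eq_square mult_ac)
  also have "\<dots> \<le> E\<^sup>2" using E E2 L_pos by linarith
  finally have LT: "L * T \<le> E" by (rule power2_le_imp_le) (use E in simp)
  show "1 \<le> D" "L \<le> D" "T \<le> D" using E T E2 by (auto simp: DE)
  show "8 / 7 * (1 + T) \<le> D" using T(2) E(1) E2 by (simp add: DE)
  have "L * T * (1 + T) \<le> E * (2 * E)"
    using LT T T_pos E by (intro mult_mono) auto
  then have a: "8 / 7 * L * T * (1 + T) \<le> 16 / 7 * E\<^sup>2" by (simp add: power2_eq_square)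
  have "1 \<le> L \<or> 1 \<le> 1 / L" using L_pos by auto
  then have "2 \<le> E" using L_pos L0 unfolding E_def by linarith
  then have "2\<^sup>2 \<le> E\<^sup>2" by (intro power_mono) auto
  with a show "1 + 8 / 7 * L * T * (1 + T) \<le> D" unfolding DE by simp
qed

lemma trajectory_le:
  assumes x: "x \<in> Rd d" "v \<in> Rd d" and S: "vnorm d x \<le> S" "vnorm d v \<le> S"
  shows "k \<le> n \<Longrightarrow> vnorm d (pos h x v k) \<le> D * S"
    and "k < n \<Longrightarrow> vnorm d (half_vel h x v k) \<le> D * S"
    and "vdist d (end_pos x v) x \<le> T * D * S"
proof -
  have S0: "0 \<le> S" using order_trans[OF L2_set_nonneg S(1)] .
  have "vnorm d (\<lambda>i. T * v i) \<le> T * S" using S T_pos by (simp add: vnorm_scale)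
  then have "vnorm d (\<lambda>i. x i + T * v i) \<le> (1 + T) * S"
    using vnorm_add_le[where d=d and x=x and y="\<lambda>i. T * v i"] S by (simp add: algebra_simps)
  moreover have "S \<le> (1 + T) * S" using T_pos S0 by (simp add: algebra_simps)
  ultimately interpret linear_growth d n h L "(1 + T) * S" "pos h x v" "\<lambda>j. g (pos h x v j)" x v
    using S by (intro single_growth x) auto
  show "vnorm d (pos h x v k) \<le> D * S" if "k \<le> n"
    by (rule order_trans[OF growth_le[OF that]])
      (use mult_right_mono[OF growth_const(1) S0] in \<open>simp only: mult.assoc\<close>)
  have hv: "vnorm d (half_vel h x v k) \<le> D * S" if k: "k < n" for k
  proof -
    have "vnorm d (half_vel h x v k) = vnorm d (\<lambda>i. v i - h * (\<Sum>j\<le>k. trapezoid_weight j * g (pos h x v j) i))"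
      by (rule L2_set_cong) (simp_all only: half_vel_eq)
    also have "\<dots> \<le> S + 8 / 7 * L * T * ((1 + T) * S)"
      using velocity_le[OF k] S by (simp add: T_eq)
    also have "\<dots> = (1 + 8 / 7 * L * T * (1 + T)) * S" by (simp add: algebra_simps)
    also have "\<dots> \<le> D * S" by (intro mult_right_mono growth_const S0)
    finally show ?thesis .
  qed
  then show "k < n \<Longrightarrow> vnorm d (half_vel h x v k) \<le> D * S" .
  have "vdist d (pos h x v k) x \<le> real k * (h * (D * S))" if "k \<le> n" for k
    using that
  proof (induction k)
    case 0
    then show ?case by (simp add: L2_set_def)
  next
    case (Suc k)
    have "vdist d (pos h x v (Suc k)) (pos h x v k) = vnorm d (\<lambda>i. h * half_vel h x v k i)"
      unfolding pos_Suc by (rule L2_set_cong) (auto simp: line_def)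
    also have "\<dots> \<le> h * (D * S)"
      using hv[of k] Suc.prems h_pos by (simp add: vnorm_scale)
    finally show ?case
      using Suc vdist_triangle[where x="pos h x v (Suc k)" and y="pos h x v k" and z=x and d=d]
      by (simp add: algebra_simps del: leapfrog.simps)
  qed
  from this[of n] show "vdist d (end_pos x v) x \<le> T * D * S"
    using x by (simp add: flow_eq) (simp add: T_eq mult_ac)
qed

lemma energy_error_order:
  assumes x: "x \<in> Rd d" "v \<in> Rd d" and S: "vnorm d x \<le> S" "vnorm d v \<le> S" "1 \<le> S"
  shows "\<bar>energy_error x v\<bar> \<le> h\<^sup>2 * (D ^ 4 * (M + 1)) * S ^ 3"
proof -
  have "\<bar>energy_error x v\<bar> \<le> h\<^sup>2 * (T * M * (D * S) ^ 3 / 2 + L\<^sup>2 * (D * S)\<^sup>2 / 8)"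
    using trajectory_le[OF x S(1,2)] by (intro energy_error_le x) auto
  also have "\<dots> \<le> h\<^sup>2 * (D * M * (D * S) ^ 3 / 2 + D\<^sup>2 * (D\<^sup>2 * S ^ 3) / 8)"
  proof (intro mult_left_mono add_mono divide_right_mono mult_right_mono mult_mono power_mono D_ge)
    have "(D * S)\<^sup>2 = D\<^sup>2 * S\<^sup>2" by (simp add: power_mult_distrib)
    also have "\<dots> \<le> D\<^sup>2 * S ^ 3" using S by (intro mult_left_mono power_increasing) auto
    finally show "(D * S)\<^sup>2 \<le> D\<^sup>2 * S ^ 3" .
  qed (use S D_ge bounds_nonneg in auto)
  also have "\<dots> = h\<^sup>2 * (D ^ 4 * (M / 2 + 1 / 8)) * S ^ 3"
    by (simp add: algebra_simps power_mult_distrib eval_nat_numeral)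
  also have "\<dots> \<le> h\<^sup>2 * (D ^ 4 * (M + 1)) * S ^ 3"
    using S D_ge bounds_nonneg by (intro mult_right_mono mult_left_mono) auto
  finally show ?thesis .
qed

text \<open>The energy errors of two trajectories differ by a multiple of their distance when the
  initial velocities differ by at most \<open>r / T\<close>.\<close>

lemma energy_error_diff_order:
  assumes x: "x \<in> Rd d" "v \<in> Rd d" and y: "y \<in> Rd d" "w \<in> Rd d"
    and S: "vnorm d x \<le> S" "vnorm d v \<le> S" "vnorm d y \<le> S" "vnorm d w \<le> S" "1 \<le> S"
    and r: "vdist d x y = r" "vnorm d (\<lambda>i. x i - y i + T * (v i - w i)) \<le> r" "T * vdist d v w \<le> r"
  shows "\<bar>energy_error x v - energy_error y w\<bar> \<le> h\<^sup>2 * r * (D ^ 4 * (N + 3 * M + 1)) * S ^ 3"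
proof -
  have r0: "0 \<le> r" using r(1) L2_set_nonneg by blast
  interpret linear_growth d n h L r "\<lambda>k i. pos h x v k i - pos h y w k i"
    "\<lambda>j i. g (pos h x v j) i - g (pos h y w j) i" "\<lambda>i. x i - y i" "\<lambda>i. v i - w i"
    by (rule pair_growth) (use x y r in auto)
  define W where "W = vdist d v w + 8 / 7 * L * T * r"
  have hv: "vdist d (half_vel h x v k) (half_vel h y w k) \<le> W" if k: "k < n" for k
  proof -
    have "vdist d (half_vel h x v k) (half_vel h y w k)
        = vnorm d (\<lambda>i. (v i - w i) - h * (\<Sum>j\<le>k. trapezoid_weight j * (g (pos h x v j) i - g (pos h y w j) i)))"
      unfolding half_vel_eq by (rule L2_set_cong) (auto simp: algebra_simps sum_subtractf)
    also have "\<dots> \<le> W" using velocity_le[OF k] by (simp add: W_def T_eq)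
    finally show ?thesis .
  qed
  have TW: "T * W \<le> 2 * r"
  proof -
    have "T * W = T * vdist d v w + 8 / 7 * (L * T\<^sup>2) * r"
      by (simp add: W_def power2_eq_square algebra_simps)
    also have "\<dots> \<le> r + 8 / 7 * (1 / 4) * r"
      using r(3) LT_le(1) r0 by (intro add_mono mult_right_mono mult_left_mono) auto
    finally show ?thesis using r0 by simp
  qed
  have SD: "0 \<le> S" "0 \<le> D" using S D_ge by auto
  have S3: "S\<^sup>2 \<le> S ^ 3" "S \<le> S ^ 3" using S power_increasing[of 2 3 S] power_increasing[of 1 3 S] by auto
  have D4: "D\<^sup>2 \<le> D ^ 4" "D ^ 3 \<le> D ^ 4" using D_ge by (auto intro!: power_increasing)
  have "\<bar>energy_error x v - energy_error y w\<bar>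
      \<le> h\<^sup>2 * (T * (N * (8 / 7 * r) * (D * S) ^ 3 + 3 * M * W * (D * S)\<^sup>2) / 2 + L\<^sup>2 * (8 / 7 * r) * (D * S) / 2)"
    using trajectory_le[OF x S(1,2)] trajectory_le[OF y S(3,4)] hv growth_le
    by (intro energy_error_diff_le x y) auto
  also have "\<dots> \<le> h\<^sup>2 * (r * N * (D ^ 4 * S ^ 3) + r * (3 * M) * (D ^ 4 * S ^ 3) + r * (D ^ 4 * S ^ 3))"
  proof (intro mult_left_mono)
    have "T * (N * (8 / 7 * r) * (D * S) ^ 3) / 2 \<le> D * (N * (8 / 7 * r) * (D * S) ^ 3) / 2"
      using D_ge bounds_nonneg r0 SD by (intro divide_right_mono mult_right_mono) auto
    also have "\<dots> = 4 / 7 * (r * N * (D ^ 4 * S ^ 3))"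
      by (simp add: power_mult_distrib eval_nat_numeral)
    also have "\<dots> \<le> r * N * (D ^ 4 * S ^ 3)"
    proof -
      have "0 \<le> r * N * (D ^ 4 * S ^ 3)" using r0 bounds_nonneg SD by (intro mult_nonneg_nonneg) auto
      then show ?thesis by linarith
    qed
    finally have 1: "T * (N * (8 / 7 * r) * (D * S) ^ 3) / 2 \<le> r * N * (D ^ 4 * S ^ 3)" .
    have "T * (3 * M * W * (D * S)\<^sup>2) / 2 = (T * W) * (3 * M * (D\<^sup>2 * S\<^sup>2)) / 2"
      by (simp add: power_mult_distrib)
    also have "\<dots> \<le> (2 * r) * (3 * M * (D ^ 4 * S ^ 3)) / 2"
    proof (intro divide_right_mono mult_mono[OF TW])
      show "3 * M * (D\<^sup>2 * S\<^sup>2) \<le> 3 * M * (D ^ 4 * S ^ 3)"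
        using bounds_nonneg SD D4 S3 by (intro mult_left_mono mult_mono) auto
    qed (use bounds_nonneg r0 SD in auto)
    finally have 2: "T * (3 * M * W * (D * S)\<^sup>2) / 2 \<le> r * (3 * M) * (D ^ 4 * S ^ 3)" by simp
    have "L\<^sup>2 * (8 / 7 * r) * (D * S) / 2 = 4 / 7 * (r * (L\<^sup>2 * D * S))" by simp
    also have "\<dots> \<le> 1 * (r * (D\<^sup>2 * D * S ^ 3))"
      using r0 SD S3 D_ge L_pos by (intro mult_mono mult_left_mono power_mono) auto
    also have "\<dots> \<le> r * (D ^ 4 * S ^ 3)"
      using r0 SD D4 by (auto intro!: mult_left_mono mult_right_mono simp: eval_nat_numeral mult_ac)
    finally have 3: "L\<^sup>2 * (8 / 7 * r) * (D * S) / 2 \<le> r * (D ^ 4 * S ^ 3)" .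
    show "T * (N * (8 / 7 * r) * (D * S) ^ 3 + 3 * M * W * (D * S)\<^sup>2) / 2 + L\<^sup>2 * (8 / 7 * r) * (D * S) / 2
        \<le> r * N * (D ^ 4 * S ^ 3) + r * (3 * M) * (D ^ 4 * S ^ 3) + r * (D ^ 4 * S ^ 3)"
      using 1 2 3 by (simp only: distrib_left add_divide_distrib)
  qed simp
  also have "\<dots> = h\<^sup>2 * r * (D ^ 4 * (N + 3 * M + 1)) * S ^ 3" by (simp add: algebra_simps)
  finally show ?thesis .
qed

end

section \<open>The concave distance function\<close>

locale concave_distance =
  fixes a R\<^sub>1 :: real
  assumes a_pos: "0 < a" and R1_pos: "0 < R\<^sub>1"
begin

abbreviation slope :: "real \<Rightarrow> real" where
  "slope r \<equiv> exp (- (a * min r R\<^sub>1))"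

abbreviation f :: "real \<Rightarrow> real" where
  "f \<equiv> concave_metric a R\<^sub>1"

lemma slope_integrable: "slope integrable_on {x..y}"
  by (intro integrable_continuous_real continuous_intros)

lemma slope_antimono: "x \<le> y \<Longrightarrow> slope y \<le> slope x"
  using a_pos by (simp add: mult_left_mono)

lemma mono_f: "mono f"
  unfolding concave_metric_def
  by (intro monoI integral_subset_le slope_integrable) auto

lemma f_measurable [measurable]: "f \<in> borel_measurable borel"
  by (rule borel_measurable_mono[OF mono_f])

lemma f_0: "f 0 = 0"
  by (simp add: concave_metric_def)

lemma f_nonneg: "0 \<le> f r"
  unfolding concave_metric_def by (intro integral_nonneg slope_integrable) auto

lemma f_tangent:
  assumes "0 \<le> r" "0 \<le> s"
  shows "f s \<le> f r + slope r * (s - r)"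
proof (cases "r \<le> s")
  case True
  have "f s = f r + integral {r..s} slope"
    using Henstock_Kurzweil_Integration.integral_combine[OF assms(1) True slope_integrable]
    by (simp add: concave_metric_def)
  also have "integral {r..s} slope \<le> integral {r..s} (\<lambda>_. slope r)"
    by (intro integral_le slope_integrable slope_antimono) auto
  finally show ?thesis using True by (simp add: mult.commute)
next
  case False
  then have le: "s \<le> r" by simp
  have "f r = f s + integral {s..r} slope"
    using Henstock_Kurzweil_Integration.integral_combine[OF assms(2) le slope_integrable]
    by (simp add: concave_metric_def)
  moreover have "integral {s..r} (\<lambda>_. slope r) \<le> integral {s..r} slope"
    by (intro integral_le slope_integrable slope_antimono) auto
  ultimately show ?thesis using le by (simp add: algebra_simps)
qed

lemma f_le: "0 \<le> r \<Longrightarrow> f r \<le> r"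
  using f_tangent[of 0 r] R1_pos by (simp add: f_0)

lemma f_eq:
  assumes "0 \<le> r" "r \<le> R\<^sub>1"
  shows "f r = (1 - exp (- (a * r))) / a"
proof -
  have "((\<lambda>s. exp (- (a * s))) has_integral (- exp (- (a * r)) / a) - (- exp (- (a * 0)) / a)) {0..r}"
    using assms a_pos
    by (intro fundamental_theorem_of_calculus)
      (auto intro!: derivative_eq_intros simp: has_real_derivative_iff_has_vector_derivative[symmetric])
  then have "integral {0..r} (\<lambda>s. exp (- (a * s))) = (1 - exp (- (a * r))) / a"
    using a_pos by (simp add: integral_unique diff_divide_distrib)
  moreover have "f r = integral {0..r} (\<lambda>s. exp (- (a * s)))"
    unfolding concave_metric_def using assms by (intro integral_cong) (auto simp: min_def)
  ultimately show ?thesis by simp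
qed

text \<open>The ratio \<open>r f'(r) / f(r)\<close> is smallest at \<open>r = R\<^sub>1\<close>: before that point because
  \<open>(e\<^sup>t - 1) / t\<close> increases, and after it because \<open>f\<close> is affine.\<close>

lemma f_le_slope:
  assumes r: "0 \<le> r"
  shows "a * R\<^sub>1 * exp (- (a * R\<^sub>1)) * f r \<le> r * slope r"
proof (cases "r \<le> R\<^sub>1")
  case True
  define y t where "y = a * R\<^sub>1" and "t = a * r"
  have y: "0 < y" "0 \<le> t" "t \<le> y" using a_pos R1_pos r True by (auto simp: y_def t_def)
  have "exp ((1 - t / y) *\<^sub>R 0 + (t / y) *\<^sub>R y) \<le> (1 - t / y) * exp 0 + (t / y) * exp y"
    using y by (intro convex_onD[OF exp_convex]) auto
  then have "y * exp t \<le> y * ((1 - t / y) + t / y * exp y)"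
    using y by (intro mult_left_mono) auto
  also have "\<dots> = y - t + t * exp y" using y by (simp add: field_simps)
  finally have "y * (exp t - 1) \<le> t * exp y" using y by (simp add: algebra_simps)
  then have "exp (- t) * exp (- y) * (y * (exp t - 1)) \<le> exp (- t) * exp (- y) * (t * exp y)"
    by (intro mult_left_mono) auto
  also have "\<dots> = t * exp (- t) * (exp y * exp (- y))" by (simp only: mult_ac)
  also have "exp y * exp (- y) = 1" by (simp add: exp_minus)
  also have "exp (- t) * exp (- y) * (y * (exp t - 1)) = y * exp (- y) * (exp t * exp (- t) - exp (- t))"
    by (simp only: right_diff_distrib left_diff_distrib mult_ac mult_1_right)
  also have "exp t * exp (- t) = 1" by (simp add: exp_minus)
  finally have "y * exp (- y) * (1 - exp (- t)) \<le> t * exp (- t)" by simp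
  then show ?thesis
    using True r a_pos unfolding f_eq[OF r True] y_def t_def by (simp add: field_simps)
next
  case False
  define y where "y = a * R\<^sub>1"
  have "y * f R\<^sub>1 = R\<^sub>1 * (1 - exp (- y))"
    using f_eq[of R\<^sub>1] a_pos R1_pos by (simp add: y_def)
  also have "\<dots> \<le> R\<^sub>1" using R1_pos by (simp add: mult_left_le)
  finally have 1: "y * f R\<^sub>1 \<le> R\<^sub>1" .
  have "y * exp (- y) \<le> 1"
  proof -
    have "y \<le> exp y" using exp_ge_add_one_self[of y] by linarith
    then show ?thesis by (simp add: exp_minus field_simps)
  qed
  then have 2: "y * exp (- y) * (r - R\<^sub>1) \<le> 1 * (r - R\<^sub>1)"
    using False by (intro mult_right_mono) auto
  have "y * f r \<le> y * (f R\<^sub>1 + exp (- y) * (r - R\<^sub>1))"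
    using f_tangent[of R\<^sub>1 r] r R1_pos a_pos by (intro mult_left_mono) (auto simp: y_def)
  also have "\<dots> \<le> r" using 1 2 by (simp add: algebra_simps)
  finally have "exp (- y) * (y * f r) \<le> exp (- y) * r" by (intro mult_left_mono) auto
  then show ?thesis using False by (simp add: y_def mult_ac)
qed

text \<open>The tangent at \<open>r + 5 / (2 a)\<close> bounds \<open>f\<close> beyond \<open>r\<close> by an affine function whose slope is
  small, which makes large excursions cheap.\<close>

lemma f_far:
  assumes r: "0 \<le> r" "r + 5 / (2 * a) \<le> R\<^sub>1" and s: "0 \<le> s"
  shows "f s \<le> f r + slope r * (1 - 7 / 2 * exp (- (5 / 2)) + exp (- (5 / 2)) * (a * (s - r))) / a"
proof -
  define q where "q = r + 5 / (2 * a)"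
  have "0 \<le> 5 / (2 * a)" using a_pos by simp
  then have q: "0 \<le> q" "q \<le> R\<^sub>1" "r \<le> R\<^sub>1" using r unfolding q_def by linarith+
  have aq: "a * q = a * r + 5 / 2" using a_pos by (simp add: q_def distrib_left)
  have sq: "slope q = slope r * exp (- (5 / 2))"
    using q aq by (simp add: exp_add[symmetric])
  define B X where "B = exp (- (5 / 2 :: real))" and "X = a * (s - r)"
  have fq: "f q = f r + slope r * (1 - B) / a"
    using f_eq[OF q(1,2)] f_eq[OF r(1) q(3)] q aq a_pos
    by (simp add: B_def diff_divide_distrib[symmetric] right_diff_distrib exp_add[symmetric]
        add_divide_distrib[symmetric])
  have sd: "s - q = (X - 5 / 2) / a"
    using a_pos by (simp add: q_def X_def field_simps)
  have "f s \<le> f q + slope r * B * (s - q)"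
    using f_tangent[OF q(1) s] unfolding sq B_def .
  also have "\<dots> = f r + (slope r * (1 - B) / a + slope r * B * ((X - 5 / 2) / a))"
    unfolding fq sd by simp
  also have "slope r * (1 - B) / a + slope r * B * ((X - 5 / 2) / a)
      = slope r * (1 - 7 / 2 * B + B * X) / a"
    using a_pos by (simp add: field_simps)
  finally show ?thesis by (simp only: B_def X_def)
qed

end

section \<open>Gaussian vectors\<close>

abbreviation gaussian :: "nat \<Rightarrow> (nat \<Rightarrow> real) measure" where
  "gaussian d \<equiv> \<Pi>\<^sub>M i\<in>{..<d}. density lborel std_normal_density"

lemma prob_space_std_normal: "prob_space (density lborel std_normal_density)"
  by (rule prob_space_normal_density) simp

lemma prob_space_gaussian: "prob_space (gaussian d)"
  by (intro prob_space_PiM prob_space_std_normal)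

lemma sets_gaussian: "sets (gaussian d) = sets (Pi\<^sub>M {..<d} (\<lambda>_. borel))"
  by (intro sets_PiM_cong) simp_all

lemma space_gaussian: "space (gaussian d) = Rd d"
  by (simp add: space_PiM Rd_def)

lemma gaussian_measurable_cong: "measurable (gaussian d) M = measurable (Pi\<^sub>M {..<d} (\<lambda>_. borel)) M"
  by (intro measurable_cong_sets sets_gaussian refl)

lemma coordinate_measurable [measurable]: "i < d \<Longrightarrow> (\<lambda>x. x i) \<in> borel_measurable (gaussian d)"
  unfolding gaussian_measurable_cong by measurable

lemma distributed_coordinate:
  assumes "i < d"
  shows "distributed (gaussian d) lborel (\<lambda>x. x i) std_normal_density"
proof -
  have "distr (gaussian d) (density lborel std_normal_density) (\<lambda>x. x i) = density lborel std_normal_density"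
    using assms by (intro distr_PiM_component prob_space_std_normal) auto
  moreover have "distr (gaussian d) (density lborel std_normal_density) (\<lambda>x. x i)
      = distr (gaussian d) lborel (\<lambda>x. x i)"
    by (intro distr_cong) auto
  ultimately show ?thesis using assms by (simp add: distributed_def)
qed

lemma indep_coordinates: "d > 0 \<Longrightarrow> prob_space.indep_vars (gaussian d) (\<lambda>_. borel) (\<lambda>i x. x i) {..<d}"
proof -
  assume d: "d > 0"
  interpret prob_space "gaussian d" by (rule prob_space_gaussian)
  have "distr (gaussian d) (\<Pi>\<^sub>M i\<in>{..<d}. borel) (\<lambda>x. \<lambda>i\<in>{..<d}. x i)
      = distr (gaussian d) (gaussian d) (\<lambda>x. x)"
    by (intro distr_cong) (auto simp: sets_gaussian space_gaussian Rd_def PiE_def extensional_restrict)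
  also have "\<dots> = (\<Pi>\<^sub>M i\<in>{..<d}. distr (gaussian d) borel (\<lambda>x. x i))"
    unfolding distr_id2[OF refl]
  proof (rule PiM_cong[OF refl])
    fix i assume "i \<in> {..<d}"
    then have "distr (gaussian d) lborel (\<lambda>x. x i) = density lborel std_normal_density"
      using distributed_coordinate unfolding distributed_def by auto
    moreover have "distr (gaussian d) lborel (\<lambda>x. x i) = distr (gaussian d) borel (\<lambda>x. x i)"
      by (intro distr_cong) auto
    ultimately show "density lborel (\<lambda>x. ennreal (std_normal_density x)) = distr (gaussian d) borel (\<lambda>x. x i)"
      by simp
  qed
  finally show ?thesis
    using d by (subst indep_vars_iff_distr_eq_PiM') auto
qed

text \<open>A linear combination of independent normal variables is normal. Coordinates with coefficient \<open>0\<close>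
  are left out, since they have no normal density.\<close>

lemma distributed_unit_direction:
  assumes e: "vnorm d e = 1"
  shows "distributed (gaussian d) lborel (vinner d e) std_normal_density"
proof -
  interpret prob_space "gaussian d" by (rule prob_space_gaussian)
  define I where "I = {i. i < d \<and> e i \<noteq> 0}"
  have I: "finite I" "I \<subseteq> {..<d}" by (auto simp: I_def)
  have e2: "(\<Sum>i\<in>I. \<bar>e i\<bar>\<^sup>2) = 1"
  proof -
    have "(\<Sum>i<d. e i * e i) = 1" using e vnorm_sq[where d=d and x=e] by (simp add: vinner_def)
    moreover have "(\<Sum>i\<in>I. \<bar>e i\<bar>\<^sup>2) = (\<Sum>i<d. e i * e i)"
    proof -
      have "(\<Sum>i\<in>I. \<bar>e i\<bar>\<^sup>2) = (\<Sum>i\<in>I. e i * e i)" by (simp add: power2_eq_square)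
      also have "\<dots> = (\<Sum>i<d. e i * e i)" by (intro sum.mono_neutral_left) (auto simp: I_def)
      finally show ?thesis .
    qed
    ultimately show ?thesis by simp
  qed
  then have ne: "I \<noteq> {}" by auto
  then have d: "d > 0" by (auto simp: I_def)
  have "indep_vars (\<lambda>_. borel) (\<lambda>i x. e i * x i) I"
    by (intro indep_vars_compose2[where M'="\<lambda>_. borel" and X="\<lambda>i x. x i" and Y="\<lambda>i x. e i * x"]
        indep_vars_subset[OF indep_coordinates[OF d] I(2)]) auto
  moreover have "distributed (gaussian d) lborel (\<lambda>x. e i * x i) (normal_density 0 \<bar>e i\<bar>)" if "i \<in> I" for i
    using normal_density_affine[OF distributed_coordinate[of i d], where \<alpha>="e i" and \<beta>=0] that by (auto simp: I_def)
  ultimately have "distributed (gaussian d) lborel (\<lambda>x. \<Sum>i\<in>I. e i * x i)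
      (normal_density (\<Sum>i\<in>I. 0) (sqrt (\<Sum>i\<in>I. \<bar>e i\<bar>\<^sup>2)))"
    using I ne by (intro sum_indep_normal) (auto simp: I_def)
  moreover have "(\<Sum>i\<in>I. e i * x i) = vinner d e x" for x
    unfolding vinner_def by (intro sum.mono_neutral_left) (auto simp: I_def)
  ultimately show ?thesis unfolding e2 by simp
qed

lemma gaussian_direction:
  assumes e: "vnorm d e = 1" and p: "p \<in> borel_measurable borel"
  shows "integrable (gaussian d) (\<lambda>\<xi>. p (vinner d e \<xi>)) \<longleftrightarrow> integrable lborel (\<lambda>s. std_normal_density s * p s)"
    and "(\<integral>\<xi>. p (vinner d e \<xi>) \<partial>gaussian d) = (\<integral>s. std_normal_density s * p s \<partial>lborel)"
  using distributed_integrable[OF distributed_unit_direction[OF e], of p]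
    distributed_integral[OF distributed_unit_direction[OF e], of p] p by auto

text \<open>Powers of the norm are estimated by coordinatewise moments, which keeps the dependence on
  the dimension explicit.\<close>

lemma sum_sq_le: "(\<Sum>i<d. c i)\<^sup>2 \<le> real d * (\<Sum>i<d. (c i)\<^sup>2)" for c :: "nat \<Rightarrow> real"
proof -
  have "(vinner d (\<lambda>_. 1) c)\<^sup>2 \<le> (vnorm d (\<lambda>_. 1) * vnorm d c)\<^sup>2"
    using vinner_le[where d=d and x="\<lambda>_. 1" and y=c] by (intro power2_le_iff_abs_le[THEN iffD2]) auto
  then show ?thesis
    by (simp only: power_mult_distrib vnorm_sq) (simp add: vinner_def power2_eq_square)
qed

lemma vnorm_power8_le: "(vnorm d x) ^ 8 \<le> real d ^ 3 * (\<Sum>i<d. (x i) ^ 8)"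
proof -
  have "((vnorm d x)\<^sup>2)\<^sup>2 \<le> real d * (\<Sum>i<d. ((x i)\<^sup>2)\<^sup>2)"
    unfolding vnorm_sq vinner_def power2_eq_square[symmetric] by (rule sum_sq_le)
  then have "(((vnorm d x)\<^sup>2)\<^sup>2)\<^sup>2 \<le> (real d * (\<Sum>i<d. ((x i)\<^sup>2)\<^sup>2))\<^sup>2"
    by (intro power_mono) auto
  also have "\<dots> \<le> (real d)\<^sup>2 * (real d * (\<Sum>i<d. (((x i)\<^sup>2)\<^sup>2)\<^sup>2))"
    unfolding power_mult_distrib by (intro mult_left_mono sum_sq_le) auto
  also have "\<dots> = real d ^ 3 * (\<Sum>i<d. (x i) ^ 8)"
    by (simp add: power_mult[symmetric]) (simp add: power2_eq_square power3_eq_cube)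
  finally show ?thesis by (simp add: power_mult[symmetric])
qed

lemma gaussian_coordinate_moment8:
  assumes "i < d"
  shows "integrable (gaussian d) (\<lambda>x. (x i) ^ 8)" "(\<integral>x. (x i) ^ 8 \<partial>gaussian d) = 105"
proof -
  have m: "has_bochner_integral lborel (\<lambda>x::real. std_normal_density x * x ^ 8) 105"
    using std_normal_moment_even[of 4] by (simp add: fact_numeral)
  note D = distributed_coordinate[OF assms]
  show "integrable (gaussian d) (\<lambda>x. (x i) ^ 8)"
    using distributed_integrable[OF D, of "\<lambda>s. s ^ 8"] m by (auto simp: has_bochner_integral_iff)
  show "(\<integral>x. (x i) ^ 8 \<partial>gaussian d) = 105"
    using distributed_integral[OF D, of "\<lambda>s. s ^ 8"] m by (auto simp: has_bochner_integral_iff)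
qed

lemma vnorm_measurable [measurable]: "vnorm d \<in> borel_measurable (gaussian d)"
  unfolding L2_set_def by measurable

lemma vinner_measurable [measurable]: "vinner d e \<in> borel_measurable (gaussian d)"
  unfolding vinner_def by measurable

text \<open>All moments that occur are dominated by this one. The product of \<open>\<bar>s\<bar>\<close> and \<open>\<bar>\<xi>\<bar>\<^sup>4\<close> is split so
  that \<open>s\<close>, which is one-dimensional, does not contribute a power of the dimension.\<close>

lemma gaussian_moment:
  assumes d: "d \<ge> 1" and e: "vnorm d e = 1" and R2: "0 \<le> R\<^sub>2"
  defines "m \<equiv> \<lambda>\<xi>. (1 + \<bar>vinner d e \<xi>\<bar>) * (1 + R\<^sub>2 + vnorm d \<xi>) ^ 4"
  shows "integrable (gaussian d) m" "(\<integral>\<xi>. m \<xi> \<partial>gaussian d) \<le> 1000 * (R\<^sub>2\<^sup>2 + real d)\<^sup>2"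
proof -
  interpret prob_space "gaussian d" by (rule prob_space_gaussian)
  define c where "c = 1 + R\<^sub>2"
  have c: "1 \<le> c" using R2 by (simp add: c_def)
  define p where "p \<xi> = real d ^ 3 * (\<Sum>i<d. (\<xi> i) ^ 8)" for \<xi> :: "nat \<Rightarrow> real"
  define M where "M \<xi> = 4 * c ^ 4 * (3 + (vinner d e \<xi>)\<^sup>2)
      + 4 * (real d)\<^sup>2 * (1 + (vinner d e \<xi>)\<^sup>2) + 8 * p \<xi> / (real d)\<^sup>2" for \<xi>
  have power4: "(u + v) ^ 4 \<le> 8 * (u ^ 4 + v ^ 4)" for u v :: real
  proof -
    have sq: "(u + v)\<^sup>2 \<le> 2 * (u\<^sup>2 + v\<^sup>2)" for u v :: real
      using zero_le_power2[of "u - v"] by (simp add: power2_diff power2_sum)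
    have "((u + v)\<^sup>2)\<^sup>2 \<le> (2 * (u\<^sup>2 + v\<^sup>2))\<^sup>2" by (intro power_mono sq) auto
    also have "\<dots> = 4 * (u\<^sup>2 + v\<^sup>2)\<^sup>2" by (simp only: power_mult_distrib) simp
    also have "\<dots> \<le> 4 * (2 * ((u\<^sup>2)\<^sup>2 + (v\<^sup>2)\<^sup>2))" by (intro mult_left_mono sq) auto
    finally show ?thesis by (simp add: power_mult[symmetric])
  qed
  have m_le: "m \<xi> \<le> M \<xi>" for \<xi>
  proof -
    define s t D where "s = \<bar>vinner d e \<xi>\<bar>" and "t = vnorm d \<xi> ^ 4" and "D = (real d)\<^sup>2"
    have D: "1 \<le> D" using d by (simp add: D_def)
    have s: "0 \<le> s" "2 * s \<le> 1 + s\<^sup>2" using zero_le_power2[of "1 - s"]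
      by (simp_all add: s_def power2_diff)
    have t: "t\<^sup>2 \<le> p \<xi>" "0 \<le> t"
      using vnorm_power8_le[where d=d and x=\<xi>] by (simp_all add: t_def p_def power_mult[symmetric])
    have 1: "2 * u * t \<le> D * u\<^sup>2 + p \<xi> / D" for u
    proof -
      have "2 * (D * u) * t \<le> (D * u)\<^sup>2 + t\<^sup>2"
        using zero_le_power2[of "D * u - t"] by (simp add: power2_diff)
      also have "\<dots> \<le> (D * u)\<^sup>2 + p \<xi>" using t by simp
      finally show ?thesis using D by (simp add: field_simps power2_eq_square)
    qed
    have "m \<xi> \<le> (1 + s) * (8 * (c ^ 4 + t))"
      unfolding m_def s_def t_def c_def by (intro mult_left_mono power4) auto
    also have "\<dots> = 4 * c ^ 4 * (2 + 2 * s) + 4 * (2 * 1 * t) + 4 * (2 * s * t)"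
      by (simp add: algebra_simps)
    also have "\<dots> \<le> 4 * c ^ 4 * (3 + s\<^sup>2) + 4 * (D * 1\<^sup>2 + p \<xi> / D) + 4 * (D * s\<^sup>2 + p \<xi> / D)"
    proof (intro add_mono)
      show "4 * c ^ 4 * (2 + 2 * s) \<le> 4 * c ^ 4 * (3 + s\<^sup>2)"
        using s c by (intro mult_left_mono) auto
    qed (intro mult_left_mono 1; simp)+
    also have "\<dots> = M \<xi>" by (simp add: M_def s_def D_def algebra_simps)
    finally show ?thesis .
  qed
  have s2: "integrable (gaussian d) (\<lambda>\<xi>. (vinner d e \<xi>)\<^sup>2)" "(\<integral>\<xi>. (vinner d e \<xi>)\<^sup>2 \<partial>gaussian d) = 1"
    using gaussian_direction[OF e, of "\<lambda>s. s\<^sup>2"] std_normal_moment_even[of 1]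
    by (auto simp: has_bochner_integral_iff)
  have p: "integrable (gaussian d) p" "(\<integral>\<xi>. p \<xi> \<partial>gaussian d) = 105 * real d ^ 4"
    unfolding p_def using gaussian_coordinate_moment8
    by (auto simp: integral_sum eval_nat_numeral)
  have M: "integrable (gaussian d) M"
    unfolding M_def using s2(1) p(1) by simp
  show int: "integrable (gaussian d) m"
  proof (rule Bochner_Integration.integrable_bound[OF M])
    show "m \<in> borel_measurable (gaussian d)" unfolding m_def by measurable
    show "AE \<xi> in gaussian d. norm (m \<xi>) \<le> norm (M \<xi>)"
    proof (rule AE_I2)
      fix \<xi>
      have "0 \<le> m \<xi>" unfolding m_def using R2 by (intro mult_nonneg_nonneg zero_le_power) auto
      then show "norm (m \<xi>) \<le> norm (M \<xi>)" using m_le[of \<xi>] by simp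
    qed
  qed
  have "(\<integral>\<xi>. m \<xi> \<partial>gaussian d) \<le> (\<integral>\<xi>. M \<xi> \<partial>gaussian d)"
    by (intro integral_mono int M m_le)
  also have "\<dots> = 16 * c ^ 4 + 8 * (real d)\<^sup>2 + 8 * (105 * real d ^ 4) / (real d)\<^sup>2"
    unfolding M_def using s2 p by (simp add: prob_space)
  also have "\<dots> = 16 * c ^ 4 + 848 * (real d)\<^sup>2"
    using d by (simp add: eval_nat_numeral)
  also have "\<dots> \<le> 16 * (8 * (1 ^ 4 + R\<^sub>2 ^ 4)) + 848 * (real d)\<^sup>2"
    unfolding c_def by (intro add_mono mult_left_mono power4) auto
  also have "\<dots> = 128 + 128 * R\<^sub>2 ^ 4 + 848 * (real d)\<^sup>2" by simp
  also have "\<dots> \<le> 1000 * (R\<^sub>2\<^sup>2 + real d)\<^sup>2"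
  proof -
    have eq: "1000 * (R\<^sub>2\<^sup>2 + real d)\<^sup>2 = 1000 * R\<^sub>2 ^ 4 + 2000 * (R\<^sub>2\<^sup>2 * real d) + 1000 * (real d)\<^sup>2"
      by (simp add: power2_sum power_mult[symmetric])
    have "1 \<le> (real d)\<^sup>2" "0 \<le> R\<^sub>2\<^sup>2 * real d" "0 \<le> R\<^sub>2 ^ 4" using d by auto
    then show ?thesis unfolding eq by linarith
  qed
  finally show "(\<integral>\<xi>. m \<xi> \<partial>gaussian d) \<le> 1000 * (R\<^sub>2\<^sup>2 + real d)\<^sup>2" .
qed

text \<open>The probability that the coupling of the velocities falls back to reflection, given the
  component \<open>s\<close> of the velocity in the direction of \<open>x - y\<close>.\<close>

definition reflect_prob :: "real \<Rightarrow> real \<Rightarrow> real" where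
  "reflect_prob b s = max 0 (1 - std_normal_density (s + b) / std_normal_density s)"

lemma reflect_prob_measurable [measurable]: "reflect_prob b \<in> borel_measurable borel"
  unfolding reflect_prob_def by measurable

lemma reflect_prob_bounds: "0 \<le> reflect_prob b s" "reflect_prob b s \<le> 1"
  by (simp_all add: reflect_prob_def)

lemma normal_density_ratio: "std_normal_density (s + b) / std_normal_density s = exp (- (b * s + b\<^sup>2 / 2))"
  by (simp add: std_normal_density_def exp_diff[symmetric] power2_sum field_simps)

lemma reflect_prob_le:
  assumes "0 \<le> b"
  shows "reflect_prob b s \<le> b * (\<bar>s\<bar> + b / 2)"
proof -
  have "1 - exp (- z) \<le> z" for z :: real
    using exp_ge_add_one_self[of "- z"] by simp
  then have "1 - exp (- (b * s + b\<^sup>2 / 2)) \<le> b * s + b\<^sup>2 / 2" .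
  also have "\<dots> \<le> b * (\<bar>s\<bar> + b / 2)"
    using mult_left_mono[OF abs_ge_self assms, of s] by (simp add: power2_eq_square algebra_simps)
  finally show ?thesis
    using assms unfolding reflect_prob_def normal_density_ratio by simp
qed

text \<open>The mean reflection probability is the total variation distance of two normal laws whose
  means differ by \<open>b\<close>, which is the probability that a standard normal variable is at distance at most
  \<open>b / 2\<close> from \<open>0\<close>.\<close>

lemma integral_reflect_prob:
  assumes b: "0 < b"
  shows "integrable lborel (\<lambda>s. std_normal_density s * reflect_prob b s)"
    and "(\<integral>s. std_normal_density s * reflect_prob b s \<partial>lborel) \<le> 2 / 5 * b"
proof -
  let ?\<phi> = std_normal_density
  have int: "integrable lborel ?\<phi>" by (rule integrable_normal_density) simp
  have int': "integrable lborel (\<lambda>s. ?\<phi> (b + 1 * s))"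
    by (rule lborel_integrable_real_affine[OF int]) simp
  show "integrable lborel (\<lambda>s. ?\<phi> s * reflect_prob b s)"
    by (rule Bochner_Integration.integrable_bound[OF int])
      (auto simp: abs_mult reflect_prob_bounds mult_left_le)
  define A where "A s = indicator {- b / 2<..} s * ?\<phi> s" for s
  define B where "B s = indicator {b / 2<..} s * ?\<phi> s" for s
  have iA: "integrable lborel A" and iB: "integrable lborel B"
    unfolding A_def B_def by (auto intro!: integrable_real_mult_indicator int simp: mult.commute)
  have "?\<phi> s * reflect_prob b s = A s - B (b + 1 * s)" for s
  proof -
    have "?\<phi> s > 0" by (simp add: normal_density_pos)
    then have 1: "?\<phi> s * reflect_prob b s = max 0 (?\<phi> s - ?\<phi> (s + b))"
      by (simp add: reflect_prob_def max_def field_simps)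
    have "?\<phi> (s + b) \<le> ?\<phi> s \<longleftrightarrow> ?\<phi> (s + b) / ?\<phi> s \<le> 1"
      using \<open>?\<phi> s > 0\<close> by (simp add: field_simps)
    also have "\<dots> \<longleftrightarrow> 0 \<le> b * (s + b / 2)"
    proof -
      have "b * s + b\<^sup>2 / 2 = b * (s + b / 2)" by (simp add: algebra_simps power2_eq_square)
      then show ?thesis unfolding normal_density_ratio by simp
    qed
    also have "\<dots> \<longleftrightarrow> - b / 2 \<le> s" using b by (simp add: zero_le_mult_iff) linarith
    finally have 2: "?\<phi> (s + b) \<le> ?\<phi> s \<longleftrightarrow> - b / 2 \<le> s" .
    have 3: "?\<phi> (b / 2) = ?\<phi> (- b / 2)" by (simp add: std_normal_density_def power2_eq_square)
    show ?thesis
      unfolding 1 A_def B_def using 2 3 by (cases "s = - b / 2") (auto simp: indicator_def add.commute max_def)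
  qed
  then have "(\<integral>s. ?\<phi> s * reflect_prob b s \<partial>lborel) = (\<integral>s. A s \<partial>lborel) - (\<integral>s. B (b + 1 * s) \<partial>lborel)"
    by (simp only:) (rule Bochner_Integration.integral_diff[OF iA lborel_integrable_real_affine[OF iB]], simp)
  also have "(\<integral>s. B (b + 1 * s) \<partial>lborel) = (\<integral>s. B s \<partial>lborel)"
    using lborel_integral_real_affine[of 1 B b] by simp
  also have "(\<integral>s. A s \<partial>lborel) - (\<integral>s. B s \<partial>lborel) = (\<integral>s. A s - B s \<partial>lborel)"
    by (simp add: Bochner_Integration.integral_diff[OF iA iB])
  also have "\<dots> \<le> (\<integral>s. indicator {- b / 2..b / 2} s * (2 / 5) \<partial>lborel)"
  proof (rule integral_mono)
    show "integrable lborel (\<lambda>s. A s - B s)" by (intro Bochner_Integration.integrable_diff iA iB)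
    show "integrable lborel (\<lambda>s. indicator {- b / 2..b / 2} s * (2 / 5) :: real)"
      by (intro integrable_mult_left integrable_real_indicator) (auto simp: emeasure_lborel_Icc_eq)
    fix s :: real
    have "5 / 2 \<le> sqrt (2 * pi)"
    proof (rule real_le_rsqrt)
      show "(5 / 2)\<^sup>2 \<le> 2 * pi" using pi_approx(1) by (simp add: power2_eq_square)
    qed
    then have "?\<phi> s \<le> 2 / 5"
    proof -
      have "?\<phi> s \<le> 1 / sqrt (2 * pi)" unfolding std_normal_density_def
        by (simp add: divide_right_mono)
      also have "\<dots> \<le> 2 / 5" using \<open>5 / 2 \<le> sqrt (2 * pi)\<close> by (simp add: field_simps)
      finally show ?thesis .
    qed
    then show "A s - B s \<le> indicator {- b / 2..b / 2} s * (2 / 5)"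
      using b by (auto simp: A_def B_def indicator_def)
  qed
  also have "\<dots> = 2 / 5 * b" using b by simp
  finally show "(\<integral>s. ?\<phi> s * reflect_prob b s \<partial>lborel) \<le> 2 / 5 * b" .
qed

lemma gaussian_reflect_prob:
  assumes e: "vnorm d e = 1" and b: "0 < b" "b \<le> 1 / 2"
  shows "integrable (gaussian d) (\<lambda>\<xi>. reflect_prob b (vinner d e \<xi>))"
    and "(\<integral>\<xi>. reflect_prob b (vinner d e \<xi>) \<partial>gaussian d) \<le> 2 / 5 * b"
    and "integrable (gaussian d) (\<lambda>\<xi>. reflect_prob b (vinner d e \<xi>) * \<bar>vinner d e \<xi>\<bar>)"
    and "(\<integral>\<xi>. reflect_prob b (vinner d e \<xi>) * \<bar>vinner d e \<xi>\<bar> \<partial>gaussian d) \<le> 5 / 4 * b"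
proof -
  interpret prob_space "gaussian d" by (rule prob_space_gaussian)
  show "integrable (gaussian d) (\<lambda>\<xi>. reflect_prob b (vinner d e \<xi>))"
    using gaussian_direction(1)[OF e reflect_prob_measurable] integral_reflect_prob(1)[OF b(1)] by blast
  show "(\<integral>\<xi>. reflect_prob b (vinner d e \<xi>) \<partial>gaussian d) \<le> 2 / 5 * b"
    using gaussian_direction(2)[OF e reflect_prob_measurable] integral_reflect_prob(2)[OF b(1)] by simp
  have s2: "integrable (gaussian d) (\<lambda>\<xi>. (vinner d e \<xi>)\<^sup>2)" "(\<integral>\<xi>. (vinner d e \<xi>)\<^sup>2 \<partial>gaussian d) = 1"
    using gaussian_direction[OF e, of "\<lambda>s. s\<^sup>2"] std_normal_moment_even[of 1]
    by (auto simp: has_bochner_integral_iff)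
  have le: "reflect_prob b s * \<bar>s\<bar> \<le> b * (9 / 8 * s\<^sup>2 + 1 / 8)" for s
  proof -
    have "2 * \<bar>s\<bar> \<le> 1 + s\<^sup>2" using zero_le_power2[of "1 - \<bar>s\<bar>"] by (simp add: power2_diff)
    moreover have "b / 2 * \<bar>s\<bar> \<le> 1 / 4 * \<bar>s\<bar>" using b by (intro mult_right_mono) auto
    ultimately have "(\<bar>s\<bar> + b / 2) * \<bar>s\<bar> \<le> 9 / 8 * s\<^sup>2 + 1 / 8"
      by (simp add: distrib_right power2_eq_square)
    then have "b * ((\<bar>s\<bar> + b / 2) * \<bar>s\<bar>) \<le> b * (9 / 8 * s\<^sup>2 + 1 / 8)"
      using b by (intro mult_left_mono) auto
    moreover have "reflect_prob b s * \<bar>s\<bar> \<le> (b * (\<bar>s\<bar> + b / 2)) * \<bar>s\<bar>"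
      using b by (intro mult_right_mono reflect_prob_le) auto
    ultimately show ?thesis by (simp add: mult.assoc)
  qed
  have iM: "integrable (gaussian d) (\<lambda>\<xi>. b * (9 / 8 * (vinner d e \<xi>)\<^sup>2 + 1 / 8))"
    using s2 by auto
  show int: "integrable (gaussian d) (\<lambda>\<xi>. reflect_prob b (vinner d e \<xi>) * \<bar>vinner d e \<xi>\<bar>)"
    by (rule Bochner_Integration.integrable_bound[OF iM], measurable)
      (use le b in \<open>auto simp: reflect_prob_bounds abs_mult intro!: order_trans[OF le] abs_ge_self\<close>)
  have "(\<integral>\<xi>. reflect_prob b (vinner d e \<xi>) * \<bar>vinner d e \<xi>\<bar> \<partial>gaussian d)
      \<le> (\<integral>\<xi>. b * (9 / 8 * (vinner d e \<xi>)\<^sup>2 + 1 / 8) \<partial>gaussian d)"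
    by (intro integral_mono int iM le)
  also have "\<dots> = 5 / 4 * b" using s2 by (simp add: prob_space)
  finally show "(\<integral>\<xi>. reflect_prob b (vinner d e \<xi>) * \<bar>vinner d e \<xi>\<bar> \<partial>gaussian d) \<le> 5 / 4 * b" .
qed

section \<open>Measurability\<close>

abbreviation vec_borel :: "nat \<Rightarrow> (nat \<Rightarrow> real) measure" where
  "vec_borel d \<equiv> Pi\<^sub>M {..<d} (\<lambda>_. borel)"

text \<open>Restriction to the first \<open>d\<close> coordinates is continuous on the space of all sequences, whose Borel
  sets are generated by the coordinates.\<close>

lemma continuous_on_Rd_measurable:
  fixes F :: "(nat \<Rightarrow> real) \<Rightarrow> real"
  assumes "continuous_on (Rd d) F"
  shows "F \<in> borel_measurable (vec_borel d)"
proof -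
  have "continuous_on UNIV (\<lambda>x::nat \<Rightarrow> real. restrict x {..<d})"
  proof (rule continuous_on_coordinatewise_then_product)
    show "continuous_on UNIV (\<lambda>x::nat \<Rightarrow> real. restrict x {..<d} i)" for i
      by (cases "i < d") (auto simp: restrict_def)
  qed
  then have "continuous_on UNIV (\<lambda>x. F (restrict x {..<d}))"
    by (rule continuous_on_compose2[OF assms]) auto
  then have 1: "(\<lambda>x. F (restrict x {..<d})) \<in> borel_measurable borel"
    by (rule borel_measurable_continuous_onI)
  have 2: "(\<lambda>x. restrict x {..<d}) \<in> measurable (vec_borel d) borel"
  proof (rule measurable_coordinatewise_then_product)
    show "(\<lambda>x. restrict x {..<d} i) \<in> borel_measurable (vec_borel d)" for i
      by (cases "i < d") (auto simp: restrict_def)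
  qed
  have "(\<lambda>x. F (restrict (restrict x {..<d}) {..<d})) \<in> borel_measurable (vec_borel d)"
    by (rule measurable_compose[OF 2 1])
  then show ?thesis
    by (rule measurable_cong[THEN iffD1, rotated])
      (auto simp: space_PiM PiE_def extensional_restrict)
qed

lemma vec_coordinate_measurable:
  "v \<in> measurable M (vec_borel d) \<Longrightarrow> i < d \<Longrightarrow> (\<lambda>\<omega>. v \<omega> i) \<in> borel_measurable M"
  by (rule measurable_compose[OF _ measurable_component_singleton]) auto

lemma vec_measurableI:
  "(\<And>i. i < d \<Longrightarrow> (\<lambda>\<omega>. v \<omega> i) \<in> borel_measurable M) \<Longrightarrow>
     (\<lambda>\<omega>. \<lambda>i\<in>{..<d}. v \<omega> i) \<in> measurable M (vec_borel d)"
  by (rule measurable_restrict) auto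

lemma vnorm_vec_measurable:
  assumes "v \<in> measurable M (vec_borel d)"
  shows "(\<lambda>\<omega>. vnorm d (v \<omega>)) \<in> borel_measurable M"
proof -
  have "(\<lambda>\<omega>. \<Sum>i<d. (v \<omega> i)\<^sup>2) \<in> borel_measurable M"
    by (intro borel_measurable_sum borel_measurable_power vec_coordinate_measurable[OF assms]) auto
  then show ?thesis unfolding L2_set_def by measurable
qed

context smooth_potential
begin

lemma U_measurable: "U \<in> borel_measurable (vec_borel d)"
proof (rule continuous_on_Rd_measurable)
  show "continuous_on (Rd d) U"
    using C4 unfolding C_k_def by (auto dest!: spec[of _ "[]"])
qed

lemma grad_coordinate_measurable:
  assumes "i < d"
  shows "(\<lambda>x. g x i) \<in> borel_measurable (vec_borel d)"
proof -
  have "continuous_on (Rd d) (partials [i] U)"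
    using C4 assms unfolding C_k_def by (auto dest!: spec[of _ "[i]"])
  then show ?thesis
    using continuous_on_Rd_measurable assms by (simp add: grad_def)
qed

lemma leapfrog_measurable:
  assumes x: "x \<in> Rd d" and v: "v \<in> measurable \<Omega> (vec_borel d)"
  shows "(\<lambda>\<omega>. pos h x (v \<omega>) k) \<in> measurable \<Omega> (vec_borel d)"
    and "i < d \<Longrightarrow> (\<lambda>\<omega>. half_vel h x (v \<omega>) k i) \<in> borel_measurable \<Omega>"
proof (induction k arbitrary: i)
  case 0
  { case 1
    have "x \<in> space (vec_borel d)" using x by (simp add: space_PiM Rd_def)
    then show ?case by simp
  next
    case 2
    then show ?case using vec_coordinate_measurable[OF v] by simp }
next
  case (Suc k)
  { case 1
    show ?case unfolding pos_Suc line_def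
      using vec_coordinate_measurable[OF Suc(1)] Suc(2)
      by (intro vec_measurableI borel_measurable_add borel_measurable_times) auto
  next
    case 2
    have "(\<lambda>\<omega>. pos h x (v \<omega>) (Suc k)) \<in> measurable \<Omega> (vec_borel d)"
      unfolding pos_Suc line_def
      using vec_coordinate_measurable[OF Suc(1)] Suc(2)
      by (intro vec_measurableI borel_measurable_add borel_measurable_times) auto
    from measurable_compose[OF this grad_coordinate_measurable[OF 2]]
    have "(\<lambda>\<omega>. g (pos h x (v \<omega>) (Suc k)) i) \<in> borel_measurable \<Omega>" .
    then show ?case
      unfolding half_vel_Suc
      by (intro borel_measurable_diff borel_measurable_times borel_measurable_const Suc(2)[OF 2]) }
qed

end

context hmc_potential
begin

lemma vec_space: "v \<in> measurable \<Omega> (vec_borel d) \<Longrightarrow> \<omega> \<in> space \<Omega> \<Longrightarrow> v \<omega> \<in> Rd d"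
  using measurable_space[of v \<Omega> "vec_borel d" \<omega>] by (simp add: space_PiM Rd_def)

lemma end_pos_measurable:
  assumes "x \<in> Rd d" "v \<in> measurable \<Omega> (vec_borel d)"
  shows "(\<lambda>\<omega>. end_pos x (v \<omega>)) \<in> measurable \<Omega> (vec_borel d)"
  using leapfrog_measurable(1)[OF assms, of h n]
  by (rule measurable_cong[THEN iffD1, rotated]) (simp add: flow_eq[OF assms(1) vec_space[OF assms(2)]])

lemma energy_error_measurable:
  assumes x: "x \<in> Rd d" and v: "v \<in> measurable \<Omega> (vec_borel d)"
  shows "(\<lambda>\<omega>. energy_error x (v \<omega>)) \<in> borel_measurable \<Omega>"
proof -
  note p = leapfrog_measurable(1)[OF x v, of h n]
  have "(\<lambda>\<omega>. vel h x (v \<omega>) n) \<in> measurable \<Omega> (vec_borel d)"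
    unfolding vel_def
    by (intro vec_measurableI borel_measurable_add borel_measurable_times borel_measurable_const
        leapfrog_measurable(2)[OF x v] measurable_compose[OF p grad_coordinate_measurable])
  then have "(\<lambda>\<omega>. U (pos h x (v \<omega>) n) + 1 / 2 * (vnorm d (vel h x (v \<omega>) n))\<^sup>2
      - (U x + 1 / 2 * (vnorm d (v \<omega>))\<^sup>2)) \<in> borel_measurable \<Omega>"
    by (intro borel_measurable_diff borel_measurable_add borel_measurable_times borel_measurable_const
        borel_measurable_power vnorm_vec_measurable v measurable_compose[OF p U_measurable])
  then show ?thesis
    by (rule measurable_cong[THEN iffD1, rotated])
      (simp add: flow_eq[OF x vec_space[OF v]] hamiltonian_def)
qed

lemma hmc_step_measurable:
  assumes x: "x \<in> Rd d" and v: "v \<in> measurable \<Omega> (vec_borel d)" and u: "u \<in> borel_measurable \<Omega>" and i: "i < d"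
  shows "(\<lambda>\<omega>. hmc_step adj d U h T (u \<omega>) x (v \<omega>) i) \<in> borel_measurable \<Omega>"
proof -
  define E q where "E = (\<lambda>\<omega>. energy_error x (v \<omega>))" and "q = (\<lambda>\<omega>. end_pos x (v \<omega>) i)"
  have [measurable]: "E \<in> borel_measurable \<Omega>" "q \<in> borel_measurable \<Omega>" "u \<in> borel_measurable \<Omega>"
    unfolding E_def q_def
    by (intro energy_error_measurable[OF x v] u vec_coordinate_measurable[OF end_pos_measurable[OF x v] i])+
  have "(\<lambda>\<omega>. hmc_step adj d U h T (u \<omega>) x (v \<omega>) i)
      = (\<lambda>\<omega>. if adj \<longrightarrow> u \<omega> \<le> exp (- E \<omega>) then q \<omega> else x i)"
    by (simp add: hmc_step_def hmc_accept_def E_def q_def fun_eq_iff)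
  also have "\<dots> \<in> borel_measurable \<Omega>" by measurable
  finally show ?thesis .
qed

end

section \<open>Integration over the coupling\<close>

abbreviation unif :: "real measure" where
  "unif \<equiv> uniform_measure lborel {0<..<1}"

lemma prob_space_unif: "prob_space unif"
  by (intro prob_space_uniform_measure) simp_all

lemma AE_unif:
  assumes "\<And>u. 0 < u \<Longrightarrow> u < 1 \<Longrightarrow> P u"
  shows "AE u in unif. P u"
  by (rule AE_uniform_measureI) (simp, simp add: assms)

lemma measure_unif_le:
  assumes "A \<in> sets borel" "A \<inter> {0<..<1} \<subseteq> {l..l + n}" "0 \<le> n"
  shows "measure unif A \<le> n"
proof -
  have "measure unif A = measure lborel ({0<..<1} \<inter> A) / measure lborel {0<..<1::real}"
    by (rule measure_uniform_measure) (simp_all add: assms(1))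
  also have "measure lborel ({0<..<1} \<inter> A) \<le> measure lborel {l..l + n}"
  proof (rule measure_mono_fmeasurable)
    show "{l..l + n} \<in> fmeasurable lborel"
      by (auto simp: fmeasurable_def emeasure_lborel_Icc_eq)
  qed (use assms in auto)
  finally show ?thesis using assms(3) by (simp add: divide_right_mono)
qed

lemma integral_unif_indicator:
  assumes "A \<in> sets borel"
  shows "integrable unif (indicator A :: real \<Rightarrow> real)" "(\<integral>u. indicator A u \<partial>unif) = measure unif A"
proof -
  interpret prob_space unif by (rule prob_space_unif)
  show "integrable unif (indicator A :: real \<Rightarrow> real)"
    by (rule integrable_const_bound[where B=1]) (use assms in \<open>auto intro!: borel_measurable_indicator\<close>)
  show "(\<integral>u. indicator A u \<partial>unif) = measure unif A" by simp
qed

lemma unif_indicator_le: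
  fixes c0 c1 c2 :: real
  assumes n: "0 \<le> n1" "0 \<le> n2" and c: "0 \<le> c1" "0 \<le> c2"
    and nonneg: "\<And>u. 0 \<le> \<Phi> u"
    and le: "\<And>u. 0 < u \<Longrightarrow> u < 1 \<Longrightarrow>
      \<Phi> u \<le> c0 + c1 * indicator {1 - n1<..1} u + c2 * indicator {l<..l + n2} u"
  shows "(\<integral>\<^sup>+u. ennreal (\<Phi> u) \<partial>unif) \<le> ennreal (c0 + c1 * n1 + c2 * n2)"
proof -
  interpret prob_space unif by (rule prob_space_unif)
  define \<Psi> where "\<Psi> u = c0 + c1 * indicator {1 - n1<..1} u + c2 * indicator {l<..l + n2} u" for u
  note I = integral_unif_indicator[of "{1 - n1<..1}"] integral_unif_indicator[of "{l<..l + n2}"]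
  have int: "integrable unif \<Psi>"
    unfolding \<Psi>_def using I by (intro Bochner_Integration.integrable_add integrable_mult_right) simp_all
  have "(\<integral>\<^sup>+u. ennreal (\<Phi> u) \<partial>unif) \<le> (\<integral>\<^sup>+u. ennreal (\<Psi> u) \<partial>unif)"
    by (intro nn_integral_mono_AE AE_unif ennreal_leI) (use le in \<open>auto simp: \<Psi>_def\<close>)
  also have "\<dots> = ennreal (\<integral>u. \<Psi> u \<partial>unif)"
    by (intro nn_integral_eq_integral int AE_unif order_trans[OF nonneg le, folded \<Psi>_def])
  also have "\<dots> \<le> ennreal (c0 + c1 * n1 + c2 * n2)"
  proof (rule ennreal_leI)
    have "(\<integral>u. \<Psi> u \<partial>unif) = c0 + c1 * measure unif {1 - n1<..1} + c2 * measure unif {l<..l + n2}"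
      unfolding \<Psi>_def using I by (simp add: prob_space)
    also have "\<dots> \<le> c0 + c1 * n1 + c2 * n2"
    proof (intro add_mono mult_left_mono c)
      show "measure unif {1 - n1<..1} \<le> n1" by (rule measure_unif_le[of _ "1 - n1"]) (use n in auto)
      show "measure unif {l<..l + n2} \<le> n2" by (rule measure_unif_le[of _ l]) (use n in auto)
    qed simp
    finally show "(\<integral>u. \<Psi> u \<partial>unif) \<le> c0 + c1 * n1 + c2 * n2" .
  qed
  finally show ?thesis .
qed

text \<open>The uniform variable of the velocity coupling selects the second branch with probability
  \<open>max 0 (1 - \<rho>)\<close>.\<close>

lemma unif_branch:
  fixes A B :: real
  assumes "0 < \<rho>" "0 \<le> A" "0 \<le> B"
  shows "(\<integral>\<^sup>+u. ennreal (if u \<le> \<rho> then A else B) \<partial>unif) = ennreal ((1 - max 0 (1 - \<rho>)) * A + max 0 (1 - \<rho>) * B)"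
proof -
  interpret prob_space unif by (rule prob_space_unif)
  have "measure unif {\<rho><..} = measure lborel ({0<..<1} \<inter> {\<rho><..}) / measure lborel {0<..<1::real}"
    by (rule measure_uniform_measure) simp_all
  also have "{0<..<1} \<inter> {\<rho><..} = {\<rho><..<1}" using assms by auto
  finally have m: "measure unif {\<rho><..} = max 0 (1 - \<rho>)" by (cases "\<rho> \<le> 1") auto
  have eq: "(if u \<le> \<rho> then A else B) = A + (B - A) * indicator {\<rho><..} u" for u
    by (auto simp: indicator_def)
  have int: "integrable unif (\<lambda>u. A + (B - A) * indicator {\<rho><..} u)"
    using integral_unif_indicator(1)[of "{\<rho><..}"]
    by (intro Bochner_Integration.integrable_add integrable_mult_right) simp_all
  have "(\<integral>\<^sup>+u. ennreal (if u \<le> \<rho> then A else B) \<partial>unif) = ennreal (\<integral>u. A + (B - A) * indicator {\<rho><..} u \<partial>unif)"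
    unfolding eq using assms by (intro nn_integral_eq_integral int AE_I2) (auto simp: indicator_def)
  also have "(\<integral>u. A + (B - A) * indicator {\<rho><..} u \<partial>unif) = A + (B - A) * max 0 (1 - \<rho>)"
    using integral_unif_indicator[of "{\<rho><..}"] by (simp add: prob_space m)
  finally show ?thesis by (simp add: algebra_simps)
qed

lemma nn_integral_coupling:
  assumes [measurable]: "\<Phi> \<in> borel_measurable (coupling_measure d)"
  shows "(\<integral>\<^sup>+\<omega>. \<Phi> \<omega> \<partial>coupling_measure d)
    = (\<integral>\<^sup>+\<xi>. \<integral>\<^sup>+u'. \<integral>\<^sup>+u. \<Phi> (\<xi>, u, u') \<partial>unif \<partial>unif \<partial>gaussian d)"
proof -
  interpret unif: prob_space unif by (rule prob_space_unif)
  interpret uu: pair_sigma_finite unif unif ..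
  interpret uu: sigma_finite_measure "unif \<Otimes>\<^sub>M unif" by (rule uu.P.sigma_finite_measure_axioms)
  have meas: "\<Phi> \<in> borel_measurable (gaussian d \<Otimes>\<^sub>M (unif \<Otimes>\<^sub>M unif))"
    using assms unfolding coupling_measure_def .
  have "(\<integral>\<^sup>+\<omega>. \<Phi> \<omega> \<partial>coupling_measure d) = (\<integral>\<^sup>+\<xi>. \<integral>\<^sup>+p. \<Phi> (\<xi>, p) \<partial>(unif \<Otimes>\<^sub>M unif) \<partial>gaussian d)"
    unfolding coupling_measure_def by (rule uu.nn_integral_fst[OF meas, symmetric])
  also have "\<dots> = (\<integral>\<^sup>+\<xi>. \<integral>\<^sup>+u'. \<integral>\<^sup>+u. \<Phi> (\<xi>, u, u') \<partial>unif \<partial>unif \<partial>gaussian d)"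
  proof (rule nn_integral_cong)
    fix \<xi> assume "\<xi> \<in> space (gaussian d)"
    then have "(\<lambda>p. \<Phi> (\<xi>, p)) \<in> borel_measurable (unif \<Otimes>\<^sub>M unif)"
      using meas by (rule measurable_compose_Pair1)
    from uu.nn_integral_snd[OF this]
    show "(\<integral>\<^sup>+p. \<Phi> (\<xi>, p) \<partial>(unif \<Otimes>\<^sub>M unif)) = (\<integral>\<^sup>+u'. \<integral>\<^sup>+u. \<Phi> (\<xi>, u, u') \<partial>unif \<partial>unif)"
      by simp
  qed
  finally show ?thesis .
qed

text \<open>For a given velocity, \<open>A\<close> and \<open>B\<close> bound the mean over the accept-reject variable in the two
  branches of the velocity coupling.\<close>

lemma coupling_integral_le:
  assumes \<Phi>: "\<Phi> \<in> borel_measurable (coupling_measure d)" "\<And>\<omega>. 0 \<le> \<Phi> \<omega>"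
    and \<rho>: "\<And>\<xi>. 0 < \<rho> \<xi>"
    and A: "\<And>\<xi> u'. \<xi> \<in> Rd d \<Longrightarrow> u' \<le> \<rho> \<xi> \<Longrightarrow> 0 < u' \<Longrightarrow> u' < 1 \<Longrightarrow>
      0 \<le> A \<xi> \<and> (\<integral>\<^sup>+u. ennreal (\<Phi> (\<xi>, u, u')) \<partial>unif) \<le> ennreal (A \<xi>)"
    and B: "\<And>\<xi> u'. \<xi> \<in> Rd d \<Longrightarrow> \<rho> \<xi> < u' \<Longrightarrow> 0 < u' \<Longrightarrow> u' < 1 \<Longrightarrow>
      0 \<le> B \<xi> \<and> (\<integral>\<^sup>+u. ennreal (\<Phi> (\<xi>, u, u')) \<partial>unif) \<le> ennreal (B \<xi>)"
    and Z: "integrable (gaussian d) Z"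
      "\<And>\<xi>. \<xi> \<in> Rd d \<Longrightarrow> (1 - max 0 (1 - \<rho> \<xi>)) * A \<xi> + max 0 (1 - \<rho> \<xi>) * B \<xi> \<le> Z \<xi>"
  shows "integrable (coupling_measure d) \<Phi>"
    and "(\<integral>\<omega>. \<Phi> \<omega> \<partial>coupling_measure d) \<le> (\<integral>\<xi>. Z \<xi> \<partial>gaussian d)"
proof -
  have inner: "(\<integral>\<^sup>+u'. \<integral>\<^sup>+u. ennreal (\<Phi> (\<xi>, u, u')) \<partial>unif \<partial>unif) \<le> ennreal (Z \<xi>) \<and> 0 \<le> Z \<xi>"
    if \<xi>: "\<xi> \<in> Rd d" for \<xi>
  proof -
    (* The hypothesis on B is vacuous when the reflection branch has probability 0. *)
    define B' where "B' = (if \<rho> \<xi> < 1 then B \<xi> else 0)"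
    have A0: "0 \<le> A \<xi>" using A[OF \<xi>, of "min (\<rho> \<xi>) (1 / 2)"] \<rho>[of \<xi>] by auto
    have B0: "0 \<le> B'" using B[OF \<xi>, of "(\<rho> \<xi> + 1) / 2"] \<rho>[of \<xi>] by (auto simp: B'_def)
    have le: "(\<integral>\<^sup>+u'. \<integral>\<^sup>+u. ennreal (\<Phi> (\<xi>, u, u')) \<partial>unif \<partial>unif)
        \<le> (\<integral>\<^sup>+u'. ennreal (if u' \<le> \<rho> \<xi> then A \<xi> else B') \<partial>unif)"
    proof (intro nn_integral_mono_AE AE_unif)
      fix u' :: real assume u': "0 < u'" "u' < 1"
      show "(\<integral>\<^sup>+u. ennreal (\<Phi> (\<xi>, u, u')) \<partial>unif) \<le> ennreal (if u' \<le> \<rho> \<xi> then A \<xi> else B')"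
        using A[OF \<xi> _ u'] B[OF \<xi> _ u'] u' by (auto simp: B'_def)
    qed
    also have "\<dots> = ennreal ((1 - max 0 (1 - \<rho> \<xi>)) * A \<xi> + max 0 (1 - \<rho> \<xi>) * B')"
      by (rule unif_branch[OF \<rho> A0 B0])
    also have eq: "max 0 (1 - \<rho> \<xi>) * B' = max 0 (1 - \<rho> \<xi>) * B \<xi>" by (simp add: B'_def)
    finally have 1: "(\<integral>\<^sup>+u'. \<integral>\<^sup>+u. ennreal (\<Phi> (\<xi>, u, u')) \<partial>unif \<partial>unif) \<le> ennreal (Z \<xi>)"
      using ennreal_leI[OF Z(2)[OF \<xi>]] order_trans by blast
    have "0 \<le> (1 - max 0 (1 - \<rho> \<xi>)) * A \<xi> + max 0 (1 - \<rho> \<xi>) * B'"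
      using A0 B0 \<rho>[of \<xi>] by (intro add_nonneg_nonneg mult_nonneg_nonneg) auto
    with Z(2)[OF \<xi>] 1 show ?thesis by (simp add: eq)
  qed
  have "(\<integral>\<^sup>+\<omega>. ennreal (\<Phi> \<omega>) \<partial>coupling_measure d) \<le> (\<integral>\<^sup>+\<xi>. ennreal (Z \<xi>) \<partial>gaussian d)"
    using \<Phi>(1) inner
    by (subst nn_integral_coupling) (auto intro!: nn_integral_mono simp: space_gaussian)
  also have "\<dots> = ennreal (\<integral>\<xi>. Z \<xi> \<partial>gaussian d)"
    using inner by (intro nn_integral_eq_integral Z(1) AE_I2) (auto simp: space_gaussian)
  finally have le: "(\<integral>\<^sup>+\<omega>. ennreal (\<Phi> \<omega>) \<partial>coupling_measure d) \<le> ennreal (\<integral>\<xi>. Z \<xi> \<partial>gaussian d)" .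
  then have "(\<integral>\<^sup>+\<omega>. ennreal (\<Phi> \<omega>) \<partial>coupling_measure d) < \<infinity>"
    by (simp add: le_less_trans[OF _ ennreal_less_top])
  then show int: "integrable (coupling_measure d) \<Phi>"
    using \<Phi> by (intro integrableI_nonneg) auto
  have "0 \<le> (\<integral>\<xi>. Z \<xi> \<partial>gaussian d)"
    using inner by (intro integral_nonneg_AE AE_I2) (auto simp: space_gaussian)
  moreover have "(\<integral>\<^sup>+\<omega>. ennreal (\<Phi> \<omega>) \<partial>coupling_measure d) = ennreal (\<integral>\<omega>. \<Phi> \<omega> \<partial>coupling_measure d)"
    using \<Phi>(2) by (intro nn_integral_eq_integral int AE_I2) auto
  ultimately show "(\<integral>\<omega>. \<Phi> \<omega> \<partial>coupling_measure d) \<le> (\<integral>\<xi>. Z \<xi> \<partial>gaussian d)"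
    using le by simp
qed

section \<open>One step of the coupling\<close>

text \<open>The acceptance probability \<open>min 1 (e\<^sup>-\<^sup>s)\<close> is a Lipschitz function of the energy error.\<close>

lemma exp_minus_lipschitz: "min 1 (exp (- s)) \<le> exp (- t) + \<bar>t - s\<bar>" for s t :: real
proof (cases "t \<le> s")
  case True
  then have "exp (- s) \<le> exp (- t)" by simp
  then show ?thesis by linarith
next
  case False
  define q where "q = max 0 s"
  have "min 1 (exp (- s)) = exp (- q)" by (auto simp: q_def min_def max_def)
  moreover have "exp (- q) \<le> exp (- t) + \<bar>t - s\<bar>"
  proof (cases "t \<le> 0")
    case True
    then have "exp (- q) \<le> exp (- t)" by (simp add: q_def)
    then show ?thesis by linarith
  next
    case t: False
    have "1 - exp (- (t - q)) \<le> t - q"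
      using exp_ge_add_one_self[of "- (t - q)"] by linarith
    then have "exp (- q) * (1 - exp (- (t - q))) \<le> 1 * (t - q)"
      using False t by (intro mult_mono) (auto simp: q_def max_def)
    moreover have "exp (- q) * exp (- (t - q)) = exp (- t)" by (simp add: exp_add[symmetric])
    moreover have "t - q \<le> \<bar>t - s\<bar>" by (simp add: q_def)
    ultimately show ?thesis by (simp add: right_diff_distrib)
  qed
  ultimately show ?thesis by simp
qed

lemma exp_five_halves: "12 \<le> exp (5 / 2 :: real)" "exp (5 / 2 :: real) \<le> 25 / 2"
proof -
  have e: "2718 / 1000 \<le> exp (1::real)" "exp (1::real) \<le> 2719 / 1000"
  proof -
    have "inverse (2 ^ 32) \<le> (1 / 10000 :: real)" by simp
    with e_approx_32 have "\<bar>exp 1 - 5837465777 / 2147483648\<bar> \<le> (1 / 10000 :: real)" by linarith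
    then show "2718 / 1000 \<le> exp (1::real)" "exp (1::real) \<le> 2719 / 1000" by linarith+
  qed
  have sq: "(exp (5 / 2 :: real))\<^sup>2 = exp 1 ^ 5"
    by (simp add: exp_of_nat_mult[symmetric] power2_eq_square exp_add[symmetric])
  have "(12::real)\<^sup>2 \<le> (2718 / 1000) ^ 5" by (simp add: field_simps)
  also have "\<dots> \<le> exp 1 ^ 5" using e by (intro power_mono) auto
  finally show "12 \<le> exp (5 / 2 :: real)" unfolding sq[symmetric] by (rule power2_le_imp_le) simp
  have "exp (1::real) ^ 5 \<le> (2719 / 1000) ^ 5" using e by (intro power_mono) auto
  also have "\<dots> \<le> (25 / 2)\<^sup>2" by (simp add: field_simps)
  finally show "exp (5 / 2 :: real) \<le> 25 / 2" unfolding sq[symmetric] by (rule power2_le_imp_le) simp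
qed

context hmc_potential
begin

definition energy_const :: real where
  "energy_const = D ^ 4 * (M + 1)"

definition energy_diff_const :: real where
  "energy_diff_const = D ^ 4 * (N + 3 * M + 1)"

lemma energy_consts_nonneg: "0 \<le> energy_const" "0 \<le> energy_diff_const"
  using bounds_nonneg by (simp_all add: energy_const_def energy_diff_const_def)

lemma velocity_measurable: "fst \<in> measurable (coupling_measure d) (vec_borel d)"
proof -
  have "fst \<in> measurable (coupling_measure d) (gaussian d)"
    unfolding coupling_measure_def by (rule measurable_fst)
  then show ?thesis by (simp cong: measurable_cong_sets add: sets_gaussian)
qed

lemma coupled_velocity_measurable:
  "(\<lambda>\<omega>. coupled_velocity d R' \<gamma> x y (fst \<omega>) (snd (snd \<omega>))) \<in> measurable (coupling_measure d) (vec_borel d)"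
proof -
  note v = velocity_measurable
  have u [measurable]: "(\<lambda>\<omega>. snd (snd \<omega>)) \<in> borel_measurable (coupling_measure d)"
    unfolding coupling_measure_def by measurable
  have c: "(\<lambda>\<omega>. fst \<omega> i) \<in> borel_measurable (coupling_measure d)" if "i < d" for i
    by (rule vec_coordinate_measurable[OF v that])
  define s where "s \<omega> = vinner d (\<lambda>i. (x i - y i) / vdist d x y) (fst \<omega>)" for \<omega> :: "(nat \<Rightarrow> real) \<times> real \<times> real"
  have s [measurable]: "s \<in> borel_measurable (coupling_measure d)"
    unfolding s_def vinner_def
    by (intro borel_measurable_sum borel_measurable_times borel_measurable_const c) auto
  have p: "(\<lambda>\<omega>. std_normal_density (s \<omega> + \<gamma> * vdist d x y) / std_normal_density (s \<omega>)) \<in> borel_measurable (coupling_measure d)"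
    by measurable
  have eq: "(\<lambda>\<omega>. coupled_velocity d R' \<gamma> x y (fst \<omega>) (snd (snd \<omega>))) = (\<lambda>\<omega>. if 2 * R' \<le> vdist d x y then fst \<omega>
      else if snd (snd \<omega>) \<le> std_normal_density (s \<omega> + \<gamma> * vdist d x y) / std_normal_density (s \<omega>)
        then (\<lambda>i\<in>{..<d}. fst \<omega> i + \<gamma> * (x i - y i))
        else (\<lambda>i\<in>{..<d}. fst \<omega> i - 2 * s \<omega> * ((x i - y i) / vdist d x y)))"
    by (simp only: coupled_velocity_def Let_def s_def)
  show ?thesis
    unfolding eq
  proof (intro measurable_If v vec_measurableI borel_measurable_add borel_measurable_diff
      borel_measurable_times borel_measurable_const c s)
    show "{\<omega> \<in> space (coupling_measure d). 2 * R' \<le> vdist d x y} \<in> sets (coupling_measure d)" by simp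
    show "{\<omega> \<in> space (coupling_measure d). snd (snd \<omega>)
        \<le> std_normal_density (s \<omega> + \<gamma> * vdist d x y) / std_normal_density (s \<omega>)} \<in> sets (coupling_measure d)"
      using u p by (rule borel_measurable_le)
  qed
qed

lemma coupled_distance_measurable:
  assumes "x \<in> Rd d" "y \<in> Rd d"
  shows "coupled_distance adj d U h T R' \<gamma> x y \<in> borel_measurable (coupling_measure d)"
proof -
  note v = velocity_measurable
  have u: "(\<lambda>\<omega>. fst (snd \<omega>)) \<in> borel_measurable (coupling_measure d)"
    unfolding coupling_measure_def by measurable
  have eq: "coupled_distance adj d U h T R' \<gamma> x y = (\<lambda>\<omega>.
      sqrt (\<Sum>i<d. (hmc_step adj d U h T (fst (snd \<omega>)) x (fst \<omega>) i
        - hmc_step adj d U h T (fst (snd \<omega>)) y (coupled_velocity d R' \<gamma> x y (fst \<omega>) (snd (snd \<omega>))) i)\<^sup>2))"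
    by (simp add: coupled_distance_def L2_set_def fun_eq_iff)
  have "(\<lambda>\<omega>. \<Sum>i<d. (hmc_step adj d U h T (fst (snd \<omega>)) x (fst \<omega>) i
        - hmc_step adj d U h T (fst (snd \<omega>)) y (coupled_velocity d R' \<gamma> x y (fst \<omega>) (snd (snd \<omega>))) i)\<^sup>2)
      \<in> borel_measurable (coupling_measure d)"
    by (intro borel_measurable_sum borel_measurable_power borel_measurable_diff
        hmc_step_measurable assms v u coupled_velocity_measurable) auto
  then show ?thesis unfolding eq by measurable
qed

end

locale hmc_pair = hmc_potential d U L M N K R T h n + concave_distance a R\<^sub>1
  for d U L M N K R T h n a R\<^sub>1 +
  fixes adj :: bool and x y :: "nat \<Rightarrow> real" and R\<^sub>2 r :: real
  assumes x: "x \<in> Rd d" "vnorm d x \<le> R\<^sub>2" and y: "y \<in> Rd d" "vnorm d y \<le> R\<^sub>2"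
    and R2_nonneg: "0 \<le> R\<^sub>2" and dist: "vdist d x y = r" and r_pos: "0 < r"
begin

abbreviation step_dist :: "(nat \<Rightarrow> real) \<Rightarrow> (nat \<Rightarrow> real) \<Rightarrow> real \<Rightarrow> real" where
  "step_dist v w u \<equiv> vdist d (hmc_step adj d U h T u x v) (hmc_step adj d U h T u y w)"

abbreviation proposal_dist :: "(nat \<Rightarrow> real) \<Rightarrow> (nat \<Rightarrow> real) \<Rightarrow> real" where
  "proposal_dist v w \<equiv> vdist d (end_pos x v) (end_pos y w)"

abbreviation new_dist :: "real \<Rightarrow> (nat \<Rightarrow> real) \<times> real \<times> real \<Rightarrow> real" where
  "new_dist \<gamma> \<equiv> coupled_distance adj d U h T R \<gamma> x y"

text \<open>Given the velocities, the distance after the transition is the one of the two proposals if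
  both are accepted, unchanged if both are rejected, and increases by at most the length \<open>J\<close> of
  a proposed move if exactly one is accepted. The last event has probability at most \<open>n2\<close>, the
  difference of the energy errors, and for this reason it is cheap even when the points are close.\<close>

lemma accept_reject_le:
  assumes v: "v \<in> Rd d" "w \<in> Rd d"
    and V: "f (proposal_dist v w) \<le> f r + slope r * V" "- V \<le> r"
    and J: "vdist d (end_pos x v) x \<le> J" "vdist d (end_pos y w) y \<le> J"
    and n: "0 \<le> n1" "0 \<le> n2"
    and E: "adj \<Longrightarrow> \<bar>energy_error x v\<bar> \<le> n1" "adj \<Longrightarrow> \<bar>energy_error y w\<bar> \<le> n1"
      "adj \<Longrightarrow> \<bar>energy_error x v - energy_error y w\<bar> \<le> n2"
  defines "C \<equiv> f r + slope r * (V + max 0 (- V) * n1 + J * n2)"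
  shows "0 \<le> C \<and> (\<integral>\<^sup>+u. ennreal (f (step_dist v w u)) \<partial>unif) \<le> ennreal C"
proof -
  have r0: "0 \<le> r" using r_pos by simp
  have J0: "0 \<le> J" using order_trans[OF L2_set_nonneg J(1)] .
  define \<Phi> where "\<Phi> u = f (step_dist v w u)" for u
  define \<alpha> \<beta> where "\<alpha> = exp (- energy_error x v)" and "\<beta> = exp (- energy_error y w)"
  have one: "f s \<le> f r + slope r * J" if "s \<le> r + J" "0 \<le> s" for s
  proof -
    have "f s \<le> f r + slope r * (s - r)" by (rule f_tangent[OF r0 that(2)])
    also have "slope r * (s - r) \<le> slope r * J" using that by (intro mult_left_mono) auto
    finally show ?thesis by simp
  qed
  have accept: "hmc_step adj d U h T u x v = (if adj \<longrightarrow> u \<le> \<alpha> then end_pos x v else x)"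
    "hmc_step adj d U h T u y w = (if adj \<longrightarrow> u \<le> \<beta> then end_pos y w else y)" for u
    by (simp_all add: hmc_step_def hmc_accept_def \<alpha>_def \<beta>_def)
  have V0: "0 \<le> slope r * V + slope r * max 0 (- V)"
    unfolding distrib_left[symmetric] by (intro mult_nonneg_nonneg) auto
  have bound: "\<Phi> u \<le> (f r + slope r * V) + slope r * max 0 (- V) * indicator {1 - n1<..1} u
      + slope r * J * indicator {min \<alpha> \<beta><..min \<alpha> \<beta> + n2} u" if u: "0 < u" "u < 1" for u
  proof -
    consider (both) "adj \<longrightarrow> u \<le> \<alpha>" "adj \<longrightarrow> u \<le> \<beta>" | (fst) "adj" "u \<le> \<alpha>" "\<not> u \<le> \<beta>"
      | (snd) "adj" "\<not> u \<le> \<alpha>" "u \<le> \<beta>" | (none) "adj" "\<not> u \<le> \<alpha>" "\<not> u \<le> \<beta>" by blast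
    then show ?thesis
    proof cases
      case both
      then have "\<Phi> u \<le> f r + slope r * V"
        unfolding \<Phi>_def accept using V by (simp add: dist)
      then show ?thesis using J0 by (simp add: add_increasing2)
    next
      case fst
      have d: "vdist d (end_pos x v) y \<le> r + J"
        using vdist_triangle[where d=d and x="end_pos x v" and y=x and z=y] J by (simp add: dist)
      have "\<Phi> u \<le> f r + slope r * J"
        unfolding \<Phi>_def accept using one[OF d] fst by simp
      moreover have "1 - n1 < u"
        using fst E(2) exp_ge_add_one_self[of "- energy_error y w"] unfolding \<beta>_def by linarith
      moreover have "min \<alpha> \<beta> < u" "u \<le> min \<alpha> \<beta> + n2"
        using fst u E(3) exp_minus_lipschitz[of "energy_error x v" "energy_error y w"]
        unfolding \<alpha>_def \<beta>_def by linarith+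
      ultimately show ?thesis using u V0 by simp
    next
      case snd
      have d: "vdist d x (end_pos y w) \<le> r + J"
        using vdist_triangle[where d=d and x=x and y=y and z="end_pos y w"] J
          vdist_commute[where d=d and x=y and y="end_pos y w"] by (simp add: dist)
      have "\<Phi> u \<le> f r + slope r * J"
        unfolding \<Phi>_def accept using one[OF d] snd by simp
      moreover have "1 - n1 < u"
        using snd E(1) exp_ge_add_one_self[of "- energy_error x v"] unfolding \<alpha>_def by linarith
      moreover have "min \<alpha> \<beta> < u" "u \<le> min \<alpha> \<beta> + n2"
        using snd u E(3) exp_minus_lipschitz[of "energy_error y w" "energy_error x v"]
        unfolding \<alpha>_def \<beta>_def by linarith+
      ultimately show ?thesis using u V0 by simp
    next
      case none
      have "\<Phi> u = f r" unfolding \<Phi>_def accept using none by (simp add: dist)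
      moreover have "1 - n1 < u"
        using none E(1) exp_ge_add_one_self[of "- energy_error x v"] unfolding \<alpha>_def by linarith
      moreover have "0 \<le> slope r * J * indicator {min \<alpha> \<beta><..min \<alpha> \<beta> + n2} u" using J0 by simp
      ultimately show ?thesis using u V0 by simp
    qed
  qed
  have "(\<integral>\<^sup>+u. ennreal (\<Phi> u) \<partial>unif) \<le> ennreal ((f r + slope r * V) + slope r * max 0 (- V) * n1 + slope r * J * n2)"
    by (rule unif_indicator_le[OF n _ _ _ bound]) (use J0 in \<open>auto simp: \<Phi>_def f_nonneg\<close>)
  moreover have "f r + slope r * V + slope r * max 0 (- V) * n1 + slope r * J * n2 = C"
    by (simp add: C_def dist algebra_simps)
  moreover have "0 \<le> C"
  proof -
    have "0 \<le> f r + slope r * (0 - r)" using f_tangent[OF r0, of 0] by (simp add: f_0)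
    also have "\<dots> \<le> f r + slope r * (V + max 0 (- V) * n1 + J * n2)"
    proof (intro add_left_mono mult_left_mono)
      have "0 \<le> max 0 (- V) * n1 + J * n2" using n J0 by simp
      then show "0 - r \<le> V + max 0 (- V) * n1 + J * n2" using V(2) unfolding dist by linarith
    qed simp
    finally show ?thesis by (simp add: C_def dist)
  qed
  ultimately show ?thesis by (simp add: \<Phi>_def)
qed

text \<open>The square of the step size if there is an accept-reject step.\<close>

definition \<theta> :: real where
  "\<theta> = (if adj then h\<^sup>2 else 0)"

definition size_bound :: "(nat \<Rightarrow> real) \<Rightarrow> real" where
  "size_bound \<xi> = 1 + R\<^sub>2 + vnorm d \<xi>"

definition dir :: "nat \<Rightarrow> real" where
  "dir i = (1 / r) * (x i - y i)"

abbreviation along :: "(nat \<Rightarrow> real) \<Rightarrow> real" where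
  "along \<equiv> vinner d dir"

definition weight :: "(nat \<Rightarrow> real) \<Rightarrow> real" where
  "weight \<xi> = (1 + \<bar>along \<xi>\<bar>) * size_bound \<xi> ^ 4"

lemma theta_nonneg: "0 \<le> \<theta>"
  by (simp add: \<theta>_def)

lemma theta_adjusted: "adj \<Longrightarrow> \<theta> = h\<^sup>2"
  unfolding \<theta>_def by simp

lemma dir_unit: "vnorm d dir = 1"
  unfolding dir_def vnorm_scale using dist r_pos by simp

lemma r_dir: "r * dir i = x i - y i"
  using r_pos by (simp add: dir_def)

lemma size_bound_ge:
  "1 \<le> size_bound \<xi>" "vnorm d x \<le> size_bound \<xi>" "vnorm d y \<le> size_bound \<xi>" "vnorm d \<xi> \<le> size_bound \<xi>"
  using x y R2_nonneg by (auto simp: size_bound_def add_increasing2)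

lemma weight_ge: "size_bound \<xi> ^ 4 \<le> weight \<xi>" "size_bound \<xi> ^ 3 \<le> weight \<xi>"
proof -
  note S = size_bound_ge(1)[of \<xi>]
  have "1 * size_bound \<xi> ^ 4 \<le> weight \<xi>"
    unfolding weight_def using S by (intro mult_right_mono) auto
  then show 1: "size_bound \<xi> ^ 4 \<le> weight \<xi>" by simp
  show "size_bound \<xi> ^ 3 \<le> weight \<xi>" by (rule order_trans[OF power_increasing[OF _ S] 1]) simp
qed

lemmas weight_moment = gaussian_moment[OF d_pos dir_unit R2_nonneg, folded size_bound_def, folded weight_def]

lemma cost_measurable: "(\<lambda>\<omega>. f (new_dist \<gamma> \<omega>)) \<in> borel_measurable (coupling_measure d)"
  by (rule measurable_compose[OF coupled_distance_measurable[OF x(1) y(1)] f_measurable])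

text \<open>The accept-reject step with the energy errors and the lengths of the moves expressed by a
  common bound \<open>S\<close> for the positions and velocities.\<close>

lemma branch_le:
  assumes v: "v \<in> Rd d" "w \<in> Rd d"
    and S: "1 \<le> S" "vnorm d x \<le> S" "vnorm d v \<le> S" "vnorm d y \<le> S" "vnorm d w \<le> S"
    and V: "f (proposal_dist v w) \<le> f r + slope r * V" "- V \<le> r"
    and \<delta>: "adj \<Longrightarrow> \<bar>energy_error x v - energy_error y w\<bar> \<le> \<theta> * \<delta> * S ^ 3" "0 \<le> \<delta>"
  defines "C \<equiv> f r + slope r * (V + max 0 (- V) * (\<theta> * energy_const * S ^ 3) + T * D * S * (\<theta> * \<delta> * S ^ 3))"
  shows "0 \<le> C \<and> (\<integral>\<^sup>+u. ennreal (f (step_dist v w u)) \<partial>unif) \<le> ennreal C"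
  unfolding C_def
proof (rule accept_reject_le[OF v V])
  show "vdist d (end_pos x v) x \<le> T * D * S" "vdist d (end_pos y w) y \<le> T * D * S"
    by (intro trajectory_le x y v S)+
  show "0 \<le> \<theta> * energy_const * S ^ 3" "0 \<le> \<theta> * \<delta> * S ^ 3"
    using energy_consts_nonneg S(1) \<delta>(2) theta_nonneg by simp_all
  show "\<bar>energy_error x v\<bar> \<le> \<theta> * energy_const * S ^ 3" if adj
    using energy_error_order[OF x(1) v(1) S(2,3,1)] by (simp add: theta_adjusted[OF that] energy_const_def)
  show "\<bar>energy_error y w\<bar> \<le> \<theta> * energy_const * S ^ 3" if adj
    using energy_error_order[OF y(1) v(2) S(4,5,1)] by (simp add: theta_adjusted[OF that] energy_const_def)
qed (rule \<delta>(1))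

text \<open>Velocities that differ by a vector antiparallel to \<open>x - y\<close>, of length at most \<open>r / T\<close>; they are
  equal in the synchronous coupling.\<close>

lemma parallel_branch_le:
  assumes v: "v \<in> Rd d" "w \<in> Rd d" "vnorm d w \<le> size_bound v"
    and w: "vnorm d (\<lambda>i. x i - y i + T * (v i - w i)) \<le> r" "T * vdist d v w \<le> r"
    and G: "proposal_dist v w \<le> r - G" "0 \<le> G" "G \<le> r"
  defines "C \<equiv> f r + slope r * (- G
    + \<theta> * (G * energy_const + r * T * D * energy_diff_const) * weight v)"
  shows "0 \<le> C \<and> (\<integral>\<^sup>+u. ennreal (f (step_dist v w u)) \<partial>unif) \<le> ennreal C"
proof -
  define S where "S = size_bound v"
  note S = size_bound_ge[of v, folded S_def]
  define A where "A = f r + slope r * (- G + max 0 (- (- G)) * (\<theta> * energy_const * S ^ 3)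
    + T * D * S * (\<theta> * (r * energy_diff_const) * S ^ 3))"
  have "0 \<le> A \<and> (\<integral>\<^sup>+u. ennreal (f (step_dist v w u)) \<partial>unif) \<le> ennreal A"
    unfolding A_def
  proof (rule branch_le[OF v(1,2) S(1,2,4,3) v(3)[folded S_def]])
    have "f (proposal_dist v w) \<le> f (r - G)" by (rule monoD[OF mono_f G(1)])
    also have "\<dots> \<le> f r + slope r * (- G)" using f_tangent[of r "r - G"] r_pos G by simp
    finally show "f (proposal_dist v w) \<le> f r + slope r * (- G)" .
    show "\<bar>energy_error x v - energy_error y w\<bar> \<le> \<theta> * (r * energy_diff_const) * S ^ 3" if adj
      using energy_error_diff_order[OF x(1) v(1) y(1) v(2) S(2,4,3) v(3)[folded S_def] S(1) dist w]
      by (simp add: theta_adjusted[OF that] energy_diff_const_def mult.assoc)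
  qed (use G r_pos energy_consts_nonneg in auto)
  moreover have "A \<le> C"
  proof -
    have "G * (\<theta> * energy_const * S ^ 3) \<le> \<theta> * G * energy_const * weight v"
      using mult_left_mono[OF weight_ge(2), of "\<theta> * G * energy_const" v] theta_nonneg G energy_consts_nonneg
      by (simp add: S_def mult_ac)
    moreover have "(T * D * S) * (\<theta> * (r * energy_diff_const) * S ^ 3)
        \<le> \<theta> * (r * T * D * energy_diff_const) * weight v"
      using mult_left_mono[OF weight_ge(1), of "\<theta> * (r * T * D * energy_diff_const)" v]
        theta_nonneg T_pos D_ge r_pos energy_consts_nonneg by (simp add: S_def mult_ac eval_nat_numeral)
    ultimately have "max 0 (- (- G)) * (\<theta> * energy_const * S ^ 3)
        + (T * D * S) * (\<theta> * (r * energy_diff_const) * S ^ 3)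
        \<le> \<theta> * (G * energy_const + r * T * D * energy_diff_const) * weight v"
      using G by (simp add: algebra_simps)
    then show ?thesis
      unfolding A_def C_def add.assoc by (intro add_left_mono mult_left_mono) auto
  qed
  ultimately show ?thesis by (meson ennreal_leI order_trans)
qed

text \<open>At a distance of at least \<open>2 R\<close> the contraction is deterministic, and only the rejections and
  the mean cost of a single acceptance have to be subtracted.\<close>

lemma synchronous_expectation_le:
  assumes far: "2 * R \<le> r"
  defines "G \<equiv> 51 / 200 * K * T\<^sup>2 * r"
  shows "integrable (coupling_measure d) (\<lambda>\<omega>. f (new_dist \<gamma> \<omega>))"
    and "(\<integral>\<omega>. f (new_dist \<gamma> \<omega>) \<partial>coupling_measure d) \<le> f r + slope r * (- G
      + \<theta> * (G * energy_const + r * T * D * energy_diff_const) * (1000 * (R\<^sub>2\<^sup>2 + real d)\<^sup>2))"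
proof -
  interpret prob_space "gaussian d" by (rule prob_space_gaussian)
  define \<kappa> where "\<kappa> = \<theta> * (G * energy_const + r * T * D * energy_diff_const)"
  define Z where "Z \<xi> = f r + slope r * (- G + \<kappa> * weight \<xi>)" for \<xi>
  have G0: "0 \<le> G" using K_pos r_pos by (simp add: G_def)
  have "K * T\<^sup>2 \<le> 1 / 4" using LT_le(1) mult_right_mono[OF K_le_L, of "T\<^sup>2"] by simp
  then have "51 / 200 * (K * T\<^sup>2) * r \<le> 1 * r" using r_pos by (intro mult_right_mono) auto
  then have Gr: "G \<le> r" by (simp add: G_def mult.assoc)
  have inner: "0 \<le> Z \<xi> \<and> (\<integral>\<^sup>+u. ennreal (f (new_dist \<gamma> (\<xi>, u, u'))) \<partial>unif) \<le> ennreal (Z \<xi>)"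
    if \<xi>: "\<xi> \<in> Rd d" for \<xi> u'
  proof -
    have "0 \<le> Z \<xi> \<and> (\<integral>\<^sup>+u. ennreal (f (step_dist \<xi> \<xi> u)) \<partial>unif) \<le> ennreal (Z \<xi>)"
      unfolding Z_def \<kappa>_def
    proof (rule parallel_branch_le[OF \<xi> \<xi> size_bound_ge(4) _ _ _ G0 Gr])
      show "proposal_dist \<xi> \<xi> \<le> r - G"
        using end_dist_contraction[OF x(1) y(1) \<xi>] far dist by (simp add: G_def algebra_simps)
      show "vnorm d (\<lambda>i. x i - y i + T * (\<xi> i - \<xi> i)) \<le> r" using dist by simp
      have "vdist d \<xi> \<xi> = 0" by (simp add: L2_set_def)
      then show "T * vdist d \<xi> \<xi> \<le> r" using r_pos by simp
    qed
    then show ?thesis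
      using far by (simp add: coupled_distance_def coupled_velocity_def Let_def dist)
  qed
  have ZZ: "(1 - max 0 (1 - 1)) * Z \<xi> + max 0 (1 - 1) * Z \<xi> \<le> Z \<xi>" for \<xi> by simp
  have Zi: "integrable (gaussian d) Z" unfolding Z_def using weight_moment(1) by simp
  note res = coupling_integral_le[where \<rho>="\<lambda>_. 1", OF cost_measurable f_nonneg zero_less_one inner inner Zi ZZ]
  show "integrable (coupling_measure d) (\<lambda>\<omega>. f (new_dist \<gamma> \<omega>))" by (rule res(1))
  have "0 \<le> \<kappa>" using theta_nonneg G0 T_pos D_ge r_pos energy_consts_nonneg by (simp add: \<kappa>_def)
  have "(\<integral>\<xi>. Z \<xi> \<partial>gaussian d) = f r + slope r * (- G + \<kappa> * (\<integral>\<xi>. weight \<xi> \<partial>gaussian d))"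
    unfolding Z_def using weight_moment(1) by (simp add: prob_space)
  also have "\<dots> \<le> f r + slope r * (- G + \<kappa> * (1000 * (R\<^sub>2\<^sup>2 + real d)\<^sup>2))"
    using weight_moment(2) \<open>0 \<le> \<kappa>\<close> by (intro add_left_mono mult_left_mono) auto
  finally show "(\<integral>\<omega>. f (new_dist \<gamma> \<omega>) \<partial>coupling_measure d) \<le> f r + slope r * (- G
      + \<theta> * (G * energy_const + r * T * D * energy_diff_const) * (1000 * (R\<^sub>2\<^sup>2 + real d)\<^sup>2))"
    using res(2) unfolding \<kappa>_def by (rule order_trans[rotated])
qed

end

locale near_pair = hmc_pair +
  fixes \<gamma> b :: real
  assumes a_eq: "a = 1 / T" and far_R1: "r + 5 / 2 * T \<le> R\<^sub>1" and near: "r < 2 * R"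
    and \<gamma>_pos: "0 < \<gamma>" and \<gamma>_le: "\<gamma> * T \<le> 1" "\<gamma> * r \<le> 1 / 2" "L * T\<^sup>2 \<le> \<gamma> * T / 4"
    and b_eq: "b = \<gamma> * r"
begin

lemma b_bounds: "0 < b" "b \<le> 1 / 2" "T * b \<le> r"
  using \<gamma>_pos \<gamma>_le r_pos mult_right_mono[OF \<gamma>_le(1), of r] by (auto simp: b_eq mult_ac)

definition shift_prob_bound :: "(nat \<Rightarrow> real) \<Rightarrow> real" where
  "shift_prob_bound \<xi> = std_normal_density (along \<xi> + b) / std_normal_density (along \<xi>)"

lemma velocity_eq: "coupled_velocity d R \<gamma> x y \<xi> u' =
    (if u' \<le> shift_prob_bound \<xi> then (\<lambda>i\<in>{..<d}. \<xi> i + \<gamma> * (x i - y i))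
     else (\<lambda>i\<in>{..<d}. \<xi> i - 2 * along \<xi> * dir i))"
proof -
  have dir: "dir = (\<lambda>i. (x i - y i) / r)" by (simp add: dir_def fun_eq_iff)
  show ?thesis using near unfolding shift_prob_bound_def coupled_velocity_def Let_def dist dir
    by (simp add: b_eq)
qed

text \<open>The shift reduces the distance of the freely moving points by \<open>T b\<close>, of which the forces take
  back at most a seventh.\<close>

lemma shift_branch_le:
  assumes \<xi>: "\<xi> \<in> Rd d" and u': "u' \<le> shift_prob_bound \<xi>"
  defines "C \<equiv> f r + slope r * (- (6 / 7 * (T * b))
    + \<theta> * (6 / 7 * (T * b) * energy_const + r * T * D * energy_diff_const) * weight \<xi>)"
  shows "0 \<le> C \<and> (\<integral>\<^sup>+u. ennreal (f (new_dist \<gamma> (\<xi>, u, u'))) \<partial>unif) \<le> ennreal C"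
proof -
  define \<eta> where "\<eta> = (\<lambda>i\<in>{..<d}. \<xi> i + \<gamma> * (x i - y i))"
  have \<eta>R: "\<eta> \<in> Rd d" by (simp add: \<eta>_def)
  have "vdist d \<xi> \<eta> = vnorm d (\<lambda>i. (- \<gamma>) * (x i - y i))"
    by (rule L2_set_cong) (auto simp: \<eta>_def)
  then have \<eta>d: "vdist d \<xi> \<eta> = b" unfolding vnorm_scale using \<gamma>_pos dist by (simp add: b_eq)
  have \<eta>S: "vnorm d \<eta> \<le> size_bound \<xi>"
    using vnorm_le_diff_add[where d=d and x=\<eta> and y=\<xi>] vdist_commute[where d=d and x=\<eta> and y=\<xi>]
      \<eta>d b_bounds R2_nonneg by (simp add: size_bound_def)
  have "vnorm d (\<lambda>i. x i - y i + T * (\<xi> i - \<eta> i)) = vnorm d (\<lambda>i. (1 - \<gamma> * T) * (x i - y i))"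
    by (rule L2_set_cong) (auto simp: \<eta>_def algebra_simps)
  then have free: "vnorm d (\<lambda>i. x i - y i + T * (\<xi> i - \<eta> i)) = r - T * b"
    unfolding vnorm_scale using \<gamma>_le dist by (simp add: b_eq algebra_simps)
  have free_le: "vnorm d (\<lambda>i. x i - y i + T * (\<xi> i - \<eta> i)) \<le> r"
    unfolding free using T_pos b_bounds by simp
  have "new_dist \<gamma> (\<xi>, u, u') = step_dist \<xi> \<eta> u" for u
    using u' by (simp add: coupled_distance_def velocity_eq \<eta>_def)
  moreover have "0 \<le> C \<and> (\<integral>\<^sup>+u. ennreal (f (step_dist \<xi> \<eta> u)) \<partial>unif) \<le> ennreal C"
    unfolding C_def
  proof (rule parallel_branch_le[OF \<xi> \<eta>R \<eta>S free_le])
    have "proposal_dist \<xi> \<eta> \<le> (r - T * b) + 4 / 7 * (L * T\<^sup>2) * r"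
      using end_dist_le[OF x(1) y(1) \<xi> \<eta>R _ free_le] dist unfolding free by (simp add: mult_ac)
    also have "\<dots> \<le> (r - T * b) + 4 / 7 * (\<gamma> * T / 4) * r"
      using \<gamma>_le(3) r_pos by (intro add_left_mono mult_right_mono mult_left_mono) auto
    also have "\<dots> = r - 6 / 7 * (T * b)" by (simp add: b_eq algebra_simps)
    finally show "proposal_dist \<xi> \<eta> \<le> r - 6 / 7 * (T * b)" .
  qed (use \<eta>d b_bounds T_pos r_pos in auto)
  ultimately show ?thesis by simp
qed

text \<open>Reflection changes the distance by at most \<open>2 T \<bar>s\<bar>\<close>, where \<open>s\<close> is the component of the velocity
  along \<open>x - y\<close>; the forces add at most a seventh of this and of \<open>T b\<close>.\<close>

definition reflect_cost :: "(nat \<Rightarrow> real) \<Rightarrow> real" where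
  "reflect_cost \<xi> =
     T * (1 - 7 / 2 * exp (- (5 / 2)) + exp (- (5 / 2)) * (16 / 7 * \<bar>along \<xi>\<bar> + b / 7))"

lemma exp_minus_five_halves: "2 / 25 \<le> exp (- (5 / 2) :: real)" "exp (- (5 / 2) :: real) \<le> 1 / 12"
  using exp_five_halves unfolding exp_minus by (simp_all add: field_simps)

lemma reflect_cost_nonneg: "0 \<le> reflect_cost \<xi>"
  unfolding reflect_cost_def using T_pos exp_minus_five_halves b_bounds
  by (intro mult_nonneg_nonneg add_nonneg_nonneg) auto

lemma reflect_branch_le:
  assumes \<xi>: "\<xi> \<in> Rd d" and u': "shift_prob_bound \<xi> < u'"
  defines "C \<equiv> f r + slope r * (reflect_cost \<xi>
    + T * D * size_bound \<xi> * (\<theta> * (2 * energy_const) * size_bound \<xi> ^ 3))"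
  shows "0 \<le> C \<and> (\<integral>\<^sup>+u. ennreal (f (new_dist \<gamma> (\<xi>, u, u'))) \<partial>unif) \<le> ennreal C"
proof -
  define \<eta> where "\<eta> = (\<lambda>i\<in>{..<d}. \<xi> i - 2 * along \<xi> * dir i)"
  define \<beta> where "\<beta> = exp (- (5 / 2 :: real))"
  note S = size_bound_ge[of \<xi>]
  have \<eta>R: "\<eta> \<in> Rd d" by (simp add: \<eta>_def)
  have \<eta>S: "vnorm d \<eta> \<le> size_bound \<xi>"
  proof -
    have "vnorm d (\<lambda>i. 2 * along \<xi> * dir i) = 2 * \<bar>along \<xi>\<bar>" unfolding vnorm_scale dir_unit by simp
    then have ee: "(vnorm d (\<lambda>i. 2 * along \<xi> * dir i))\<^sup>2 = 4 * (along \<xi>)\<^sup>2" by (simp add: power_mult_distrib)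
    have "vinner d \<xi> (\<lambda>i. 2 * along \<xi> * dir i) = 2 * along \<xi> * along \<xi>"
      using vinner_scale_left[where d=d and c="2 * along \<xi>" and x=dir and z=\<xi>]
        vinner_commute[where d=d and x=\<xi> and y="\<lambda>i. 2 * along \<xi> * dir i"] by simp
    then have "(vnorm d (\<lambda>i. \<xi> i - 2 * along \<xi> * dir i))\<^sup>2 = (vnorm d \<xi>)\<^sup>2"
      unfolding vnorm_diff_sq ee by (simp add: power2_eq_square[of "along \<xi>"])
    then have "vnorm d \<eta> = vnorm d \<xi>"
      unfolding \<eta>_def vnorm_restrict by (simp add: power2_eq_iff_nonneg)
    then show ?thesis using S(4) by simp
  qed
  define A where "A = r + 2 * T * \<bar>along \<xi>\<bar>"
  have free: "vnorm d (\<lambda>i. x i - y i + T * (\<xi> i - \<eta> i)) \<le> A"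
  proof -
    have "vnorm d (\<lambda>i. x i - y i + T * (\<xi> i - \<eta> i)) = vnorm d (\<lambda>i. (r + 2 * T * along \<xi>) * dir i)"
      by (rule L2_set_cong) (auto simp: \<eta>_def r_dir[symmetric] algebra_simps)
    also have "\<dots> = \<bar>r + 2 * T * along \<xi>\<bar>" unfolding vnorm_scale dir_unit by simp
    also have "\<dots> \<le> A"
      using abs_triangle_ineq[of r "2 * T * along \<xi>"] r_pos T_pos by (simp add: A_def abs_mult)
    finally show ?thesis .
  qed
  have rA: "r \<le> A" using T_pos by (simp add: A_def)
  define t where "t = 16 / 7 * \<bar>along \<xi>\<bar> + b / 7"
  have "proposal_dist \<xi> \<eta> \<le> A + 4 / 7 * (L * T\<^sup>2) * A"
    using end_dist_le[OF x(1) y(1) \<xi> \<eta>R _ free] rA dist free by (simp add: mult_ac)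
  also have "\<dots> = A + (4 / 7 * (L * T\<^sup>2) * r + 4 / 7 * (L * T\<^sup>2) * (2 * T * \<bar>along \<xi>\<bar>))"
    by (simp add: A_def algebra_simps)
  also have "\<dots> \<le> A + (4 / 7 * (\<gamma> * T / 4) * r + 4 / 7 * (1 / 4) * (2 * T * \<bar>along \<xi>\<bar>))"
    using \<gamma>_le(3) LT_le(1) r_pos T_pos by (intro add_left_mono add_mono mult_right_mono mult_left_mono) auto
  also have "\<dots> = r + T * t" by (simp add: A_def b_eq t_def algebra_simps)
  finally have "f (proposal_dist \<xi> \<eta>) \<le> f (r + T * t)" by (rule monoD[OF mono_f])
  also have "\<dots> \<le> f r + slope r * (1 - 7 / 2 * \<beta> + \<beta> * (a * (r + T * t - r))) / a"
    unfolding \<beta>_def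
  proof (rule f_far)
    have "0 \<le> T * t" unfolding t_def using T_pos b_bounds by (intro mult_nonneg_nonneg add_nonneg_nonneg) auto
    then show "0 \<le> r + T * t" using r_pos by linarith
  qed (use r_pos a_eq far_R1 in simp_all)
  also have "\<dots> = f r + slope r * reflect_cost \<xi>"
    using T_pos by (simp add: reflect_cost_def \<beta>_def t_def a_eq mult_ac)
  finally have V: "f (proposal_dist \<xi> \<eta>) \<le> f r + slope r * reflect_cost \<xi>" .
  have E: "\<bar>energy_error x \<xi> - energy_error y \<eta>\<bar> \<le> \<theta> * (2 * energy_const) * size_bound \<xi> ^ 3" if adj
  proof -
    have "\<bar>energy_error x \<xi>\<bar> \<le> \<theta> * energy_const * size_bound \<xi> ^ 3"
      "\<bar>energy_error y \<eta>\<bar> \<le> \<theta> * energy_const * size_bound \<xi> ^ 3"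
      using energy_error_order[OF x(1) \<xi> S(2,4,1)] energy_error_order[OF y(1) \<eta>R S(3) \<eta>S S(1)]
      by (simp_all add: theta_adjusted[OF that] energy_const_def)
    moreover have "\<theta> * (2 * energy_const) * size_bound \<xi> ^ 3 = 2 * (\<theta> * energy_const * size_bound \<xi> ^ 3)" by simp
    ultimately show ?thesis by linarith
  qed
  have "new_dist \<gamma> (\<xi>, u, u') = step_dist \<xi> \<eta> u" for u
    using u' by (simp add: coupled_distance_def velocity_eq \<eta>_def)
  moreover have "- reflect_cost \<xi> \<le> r" using reflect_cost_nonneg[of \<xi>] r_pos by linarith
  ultimately show ?thesis
    using branch_le[OF \<xi> \<eta>R S(1,2,4,3) \<eta>S V _ E] energy_consts_nonneg reflect_cost_nonneg[of \<xi>]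
    by (simp add: C_def)
qed

text \<open>Below the distance \<open>2 R\<close> the shift of the velocity brings the points closer by \<open>T b\<close>, and
  the reflection, which on average would compensate this gain for a linear distance, costs less
  because \<open>f\<close> saturates on the scale \<open>T\<close> of the displacement \<open>2 T s\<close>. Relative to \<open>T b\<close> the gain is
  \<open>6 / 7\<close>; the reflection has probability at most \<open>2 b / 5\<close>, and its cost relative to \<open>T\<close> is
  \<open>1 - 7 \<beta> / 2 + \<beta> (16 \<bar>s\<bar> + b) / 7\<close> with \<open>\<beta> = e\<^sup>-\<^sup>5\<^sup>/\<^sup>2 \<le> 1 / 12\<close>.\<close>

lemma reflection_expectation_le:
  shows "integrable (coupling_measure d) (\<lambda>\<omega>. f (new_dist \<gamma> \<omega>))"
    and "(\<integral>\<omega>. f (new_dist \<gamma> \<omega>) \<partial>coupling_measure d) \<le> f r + slope r * (- (3 / 20) * (T * b)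
      + \<theta> * (T * b * energy_const + r * T * D * energy_diff_const + 2 * (T * b) * D * energy_const)
        * (1000 * (R\<^sub>2\<^sup>2 + real d)\<^sup>2))"
proof -
  interpret prob_space "gaussian d" by (rule prob_space_gaussian)
  define \<beta> where "\<beta> = exp (- (5 / 2 :: real))"
  have \<beta>: "2 / 25 \<le> \<beta>" "\<beta> \<le> 1 / 12" unfolding \<beta>_def by (rule exp_minus_five_halves)+
  note b = b_bounds
  define G where "G = 6 / 7 * (T * b)"
  have G0: "0 \<le> G" "G \<le> T * b" using T_pos b by (auto simp: G_def)
  define F where "F \<xi> = reflect_prob b (along \<xi>)" for \<xi>
  have F: "0 \<le> F \<xi>" "F \<xi> \<le> 1" "F \<xi> \<le> b * (1 + \<bar>along \<xi>\<bar>)" for \<xi>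
  proof -
    show "0 \<le> F \<xi>" "F \<xi> \<le> 1" by (simp_all add: F_def reflect_prob_bounds)
    have "b * (\<bar>along \<xi>\<bar> + b / 2) \<le> b * (1 + \<bar>along \<xi>\<bar>)" using b by (intro mult_left_mono) auto
    then show "F \<xi> \<le> b * (1 + \<bar>along \<xi>\<bar>)"
      using reflect_prob_le[of b "along \<xi>"] b unfolding F_def by linarith
  qed
  have F_eq: "max 0 (1 - shift_prob_bound \<xi>) = F \<xi>" for \<xi>
    by (simp add: F_def reflect_prob_def shift_prob_bound_def)
  have \<rho>0: "0 < shift_prob_bound \<xi>" for \<xi> unfolding shift_prob_bound_def by (simp add: normal_density_pos)
  define k1 k2 where "k1 = \<theta> * (T * b * energy_const + r * T * D * energy_diff_const)"
    and "k2 = \<theta> * (2 * (T * b) * D * energy_const)"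
  have k0: "0 \<le> k1" "0 \<le> k2"
    using theta_nonneg T_pos b D_ge r_pos energy_consts_nonneg by (simp_all add: k1_def k2_def)
  have w0: "0 \<le> weight \<xi>" for \<xi>
    using size_bound_ge(1)[of \<xi>] unfolding weight_def by (intro mult_nonneg_nonneg) auto
  define A where "A \<xi> = f r + slope r * (- G + k1 * weight \<xi>)" for \<xi>
  define rest where "rest \<xi> = T * D * size_bound \<xi> * (\<theta> * (2 * energy_const) * size_bound \<xi> ^ 3)" for \<xi>
  define B where "B \<xi> = f r + slope r * (reflect_cost \<xi> + rest \<xi>)" for \<xi>
  have shift: "0 \<le> A \<xi> \<and> (\<integral>\<^sup>+u. ennreal (f (new_dist \<gamma> (\<xi>, u, u'))) \<partial>unif) \<le> ennreal (A \<xi>)"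
    if \<xi>: "\<xi> \<in> Rd d" and u': "u' \<le> shift_prob_bound \<xi>" for \<xi> u'
  proof -
    have "\<theta> * (6 / 7 * (T * b) * energy_const + r * T * D * energy_diff_const) * weight \<xi> \<le> k1 * weight \<xi>"
      unfolding k1_def using theta_nonneg w0 energy_consts_nonneg T_pos b
      by (intro mult_right_mono mult_left_mono add_right_mono) auto
    then have "f r + slope r * (- (6 / 7 * (T * b))
        + \<theta> * (6 / 7 * (T * b) * energy_const + r * T * D * energy_diff_const) * weight \<xi>) \<le> A \<xi>"
      unfolding A_def G_def by (intro add_left_mono mult_left_mono) auto
    with shift_branch_le[OF \<xi> u'] show ?thesis by (meson ennreal_leI order_trans)
  qed
  have reflect: "0 \<le> B \<xi> \<and> (\<integral>\<^sup>+u. ennreal (f (new_dist \<gamma> (\<xi>, u, u'))) \<partial>unif) \<le> ennreal (B \<xi>)"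
    if "\<xi> \<in> Rd d" "shift_prob_bound \<xi> < u'" for \<xi> u'
    using reflect_branch_le[OF that] unfolding B_def rest_def .
  define c1 where "c1 = G + T * (1 - 7 / 2 * \<beta> + \<beta> * (b / 7))"
  define Z where "Z \<xi> = f r + slope r * (- G + F \<xi> * c1 + 16 / 7 * T * \<beta> * (F \<xi> * \<bar>along \<xi>\<bar>) + (k1 + k2) * weight \<xi>)" for \<xi>
  have ABZ: "(1 - max 0 (1 - shift_prob_bound \<xi>)) * A \<xi> + max 0 (1 - shift_prob_bound \<xi>) * B \<xi> \<le> Z \<xi>" for \<xi>
  proof -
    have "F \<xi> * rest \<xi> \<le> (b * (1 + \<bar>along \<xi>\<bar>)) * rest \<xi>"
      using F size_bound_ge(1)[of \<xi>] theta_nonneg T_pos D_ge energy_consts_nonneg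
      by (intro mult_right_mono) (auto simp: rest_def)
    also have "\<dots> = k2 * weight \<xi>" by (simp add: rest_def k2_def weight_def eval_nat_numeral mult_ac)
    finally have 2: "F \<xi> * rest \<xi> \<le> k2 * weight \<xi>" .
    have 1: "(1 - F \<xi>) * (k1 * weight \<xi>) \<le> 1 * (k1 * weight \<xi>)"
      using F k0 w0 by (intro mult_right_mono) auto
    have "(1 - F \<xi>) * A \<xi> + F \<xi> * B \<xi> = f r + slope r * ((1 - F \<xi>) * (- G) + F \<xi> * reflect_cost \<xi>
        + ((1 - F \<xi>) * (k1 * weight \<xi>) + F \<xi> * rest \<xi>))"
      unfolding A_def B_def by (simp add: algebra_simps)
    also have "\<dots> \<le> f r + slope r * ((1 - F \<xi>) * (- G) + F \<xi> * reflect_cost \<xi> + (1 * (k1 * weight \<xi>) + k2 * weight \<xi>))"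
      by (intro add_left_mono mult_left_mono add_mono 1 2) simp
    also have "\<dots> = Z \<xi>" by (simp add: Z_def reflect_cost_def \<beta>_def c1_def algebra_simps)
    finally show ?thesis unfolding F_eq .
  qed
  note FI = gaussian_reflect_prob[OF dir_unit b(1,2), folded F_def]
  have Zi: "integrable (gaussian d) Z" unfolding Z_def using weight_moment(1) FI(1,3) by simp
  note res = coupling_integral_le[where \<rho>=shift_prob_bound, OF cost_measurable f_nonneg \<rho>0 shift reflect Zi ABZ]
  show "integrable (coupling_measure d) (\<lambda>\<omega>. f (new_dist \<gamma> \<omega>))" by (rule res(1))
  have c1: "0 \<le> c1" unfolding c1_def using G0 T_pos \<beta> b
    by (intro add_nonneg_nonneg mult_nonneg_nonneg) auto
  let ?W = "1000 * (R\<^sub>2\<^sup>2 + real d)\<^sup>2"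
  have "(\<integral>\<xi>. Z \<xi> \<partial>gaussian d) = f r + slope r * (- G + (\<integral>\<xi>. F \<xi> \<partial>gaussian d) * c1
      + 16 / 7 * T * \<beta> * (\<integral>\<xi>. F \<xi> * \<bar>along \<xi>\<bar> \<partial>gaussian d) + (k1 + k2) * (\<integral>\<xi>. weight \<xi> \<partial>gaussian d))"
    unfolding Z_def using weight_moment(1) FI(1,3) by (simp add: prob_space)
  also have "\<dots> \<le> f r + slope r * (- G + 2 / 5 * b * c1 + 16 / 7 * T * \<beta> * (5 / 4 * b) + (k1 + k2) * ?W)"
    using weight_moment(2) FI(2,4) k0 c1 T_pos \<beta>
    by (intro add_left_mono mult_left_mono add_mono mult_right_mono order_refl) auto
  also have "\<dots> \<le> f r + slope r * (- (3 / 20) * (T * b) + (k1 + k2) * ?W)"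
  proof (intro add_left_mono mult_left_mono add_right_mono)
    have p: "\<beta> * b \<le> \<beta> * (1 / 2)" using b \<beta> by (intro mult_left_mono) auto
    have "12 / 35 * b + 2 / 5 - 7 / 5 * \<beta> + 2 / 35 * (\<beta> * b) + 20 / 7 * \<beta> - 6 / 7 \<le> - (3 / 20)"
      using p \<beta> b by linarith
    then have "(T * b) * (12 / 35 * b + 2 / 5 - 7 / 5 * \<beta> + 2 / 35 * (\<beta> * b) + 20 / 7 * \<beta> - 6 / 7)
        \<le> (T * b) * (- (3 / 20))"
      using T_pos b by (intro mult_left_mono) auto
    then show "- G + 2 / 5 * b * c1 + 16 / 7 * T * \<beta> * (5 / 4 * b) \<le> - (3 / 20) * (T * b)"
      by (simp add: G_def c1_def algebra_simps)
  qed simp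
  finally show "(\<integral>\<omega>. f (new_dist \<gamma> \<omega>) \<partial>coupling_measure d) \<le> f r + slope r * (- (3 / 20) * (T * b)
      + \<theta> * (T * b * energy_const + r * T * D * energy_diff_const + 2 * (T * b) * D * energy_const) * ?W)"
    using res(2) unfolding k1_def k2_def distrib_left[symmetric] by (rule order_trans[rotated])
qed

end

section \<open>The step size and the contraction rate\<close>

text \<open>The large factor makes the loss by rejections at most one per mille of the gain up to factors
  of order one; the slack in the contraction estimates is a few per cent.\<close>

definition step_const :: "real \<Rightarrow> real \<Rightarrow> real \<Rightarrow> real \<Rightarrow> real" where
  "step_const K L M N =
    (let D = 3 * (1 + L + 1 / L)\<^sup>2; A = D ^ 4 * (M + 1); B = D ^ 4 * (N + 3 * M + 1)
     in max 1 (1000000 * (A + D * B / K + 2 * D * A + (D + 4) * D * B)))"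

text \<open>The estimates for unadjusted transitions are uniform in the step size, and the value \<open>1 / R\<^sub>2\<close> has
  the required order. Arguments without a meaning for the sampler get the value \<open>1\<close>.\<close>

definition step_bound ::
  "bool \<Rightarrow> real \<Rightarrow> real \<Rightarrow> real \<Rightarrow> real \<Rightarrow> real \<Rightarrow> real \<Rightarrow> real \<Rightarrow> nat \<Rightarrow> real" where
  "step_bound adj K L M N R T R\<^sub>2 d =
    (if adj \<and> d \<ge> 1
     then 1 / (step_const K L M N * ((1 + T powr (- 1 / 2) + R powr (1 / 2)) * (R\<^sub>2\<^sup>2 + real d)))
     else if \<not> adj \<and> R\<^sub>2 > 0 then 1 / R\<^sub>2 else 1)"

lemma step_const_ge_1: "1 \<le> step_const K L M N"
  by (simp add: step_const_def Let_def)

lemma powr_sum_ge_1: "1 \<le> 1 + T powr (- 1 / 2) + R powr (1 / 2)" for T R :: real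
  by (simp add: add_increasing2)

lemma step_bound_pos: "0 < step_bound adj K L M N R T R\<^sub>2 d"
proof -
  have "0 < 1 + T powr (- 1 / 2) + R powr (1 / 2)" using powr_sum_ge_1[of T R] by linarith
  moreover have "0 < step_const K L M N" using step_const_ge_1[of K L M N] by linarith
  moreover have "0 < R\<^sub>2\<^sup>2 + real d" if "d \<ge> 1" using that by (intro add_nonneg_pos) auto
  ultimately show ?thesis unfolding step_bound_def by auto
qed

lemma step_bound_order:
  "\<exists>C>0. \<forall>R T R\<^sub>2 d. R \<ge> 0 \<and> T > 0 \<and> R\<^sub>2 > 0 \<and> d \<ge> 1 \<longrightarrow>
    inverse (step_bound False K L M N R T R\<^sub>2 d) \<le> C * R\<^sub>2 \<and>
    inverse (step_bound True K L M N R T R\<^sub>2 d)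
      \<le> C * ((1 + T powr (- 1 / 2) + R powr (1 / 2)) * (R\<^sub>2\<^sup>2 + real d))"
  using step_const_ge_1[of K L M N]
  by (intro exI[of _ "step_const K L M N"]) (auto simp: step_bound_def)

context hmc_potential
begin

lemma step_const_ge:
  "1000000 * energy_const \<le> step_const K L M N"
  "1000000 * (D * energy_diff_const) \<le> K * step_const K L M N"
  "1000000 * (energy_const + 2 * D * energy_const + (D + 4) * D * energy_diff_const) \<le> step_const K L M N"
proof -
  define A B where "A = energy_const" and "B = energy_diff_const"
  have nn: "0 \<le> A" "0 \<le> D * B / K" "0 \<le> 2 * D * A" "0 \<le> (D + 4) * D * B"
    using energy_consts_nonneg D_ge K_pos by (simp_all add: A_def B_def)
  have Q: "1000000 * (A + D * B / K + 2 * D * A + (D + 4) * D * B) \<le> step_const K L M N"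
    by (simp add: step_const_def Let_def A_def B_def energy_const_def energy_diff_const_def D_def)
  show "1000000 * energy_const \<le> step_const K L M N"
    unfolding A_def[symmetric] by (rule order_trans[OF _ Q]) (use nn in simp)
  have "1000000 * (D * B / K) \<le> step_const K L M N"
    by (rule order_trans[OF _ Q], rule mult_left_mono) (use nn in linarith, simp)
  from mult_left_mono[OF this, of K] K_pos
  show "1000000 * (D * energy_diff_const) \<le> K * step_const K L M N" by (simp add: B_def)
  show "1000000 * (energy_const + 2 * D * energy_const + (D + 4) * D * energy_diff_const) \<le> step_const K L M N"
    unfolding A_def[symmetric] B_def[symmetric]
    by (rule order_trans[OF _ Q], rule mult_left_mono) (use nn in linarith, simp)
qed

text \<open>The square of \<open>1 + T\<^sup>-\<^sup>1\<^sup>/\<^sup>2 + R\<^sup>1\<^sup>/\<^sup>2\<close> dominates \<open>1 + 1 / T + R\<close>, which controls the three relative sizes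
  of the loss by rejections.\<close>

lemma step_small:
  assumes R2: "0 < R\<^sub>2" and h: "adj \<Longrightarrow> h \<le> step_bound adj K L M N R T R\<^sub>2 d"
  defines "\<epsilon> \<equiv> (if adj then h\<^sup>2 else 0) * (R\<^sub>2\<^sup>2 + real d)\<^sup>2"
  shows "0 \<le> \<epsilon>" "\<epsilon> * step_const K L M N \<le> 1" "\<epsilon> * step_const K L M N \<le> T"
    "\<epsilon> * step_const K L M N * R \<le> 1"
proof -
  define Q where "Q = step_const K L M N"
  have Q: "1 \<le> Q" by (simp add: Q_def step_const_ge_1)
  show e0: "0 \<le> \<epsilon>" by (simp add: \<epsilon>_def)
  have "\<epsilon> * Q * (1 + 1 / T + R) \<le> 1"
  proof (cases adj)
    case True
    define X where "X = R\<^sub>2\<^sup>2 + real d"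
    define W where "W = 1 + T powr (- 1 / 2) + R powr (1 / 2)"
    have X: "0 < X" using R2 by (simp add: X_def add_pos_nonneg)
    have W1: "1 \<le> W" unfolding W_def by (rule powr_sum_ge_1)
    have "h \<le> 1 / (Q * (W * X))"
      using h[OF True] True d_pos unfolding step_bound_def Q_def W_def X_def by simp
    then have "h * (Q * (W * X)) \<le> 1" using Q W1 X by (simp add: pos_le_divide_eq)
    then have "(h * (Q * (W * X)))\<^sup>2 \<le> 1\<^sup>2" using h_pos Q W1 X by (intro power_mono) auto
    then have 1: "h\<^sup>2 * X\<^sup>2 * (Q\<^sup>2 * W\<^sup>2) \<le> 1" by (simp add: power_mult_distrib mult_ac)
    have T2: "(T powr (- 1 / 2))\<^sup>2 = 1 / T"
    proof -
      have "T powr (- 1 / 2) = 1 / sqrt T" using T_pos by (simp add: powr_minus_divide powr_half_sqrt)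
      then show ?thesis using T_pos by (simp add: power_divide)
    qed
    have R2: "(R powr (1 / 2))\<^sup>2 = R"
      using R_nonneg by (simp add: powr_half_sqrt)
    have W: "1 + 1 / T + R \<le> W\<^sup>2"
    proof -
      have "0 \<le> T powr (- 1 / 2) * R powr (1 / 2)" "0 \<le> T powr (- 1 / 2)" "0 \<le> R powr (1 / 2)" by simp_all
      moreover have "W\<^sup>2 = 1 + (T powr (- 1 / 2))\<^sup>2 + (R powr (1 / 2))\<^sup>2 + 2 * (T powr (- 1 / 2))
          + 2 * (R powr (1 / 2)) + 2 * (T powr (- 1 / 2) * R powr (1 / 2))"
        by (simp add: W_def power2_sum algebra_simps)
      ultimately show ?thesis unfolding T2 R2 by linarith
    qed
    have "Q * (1 + 1 / T + R) \<le> Q\<^sup>2 * W\<^sup>2"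
      using Q W T_pos R_nonneg by (intro mult_mono) (auto simp: power2_eq_square)
    then have "\<epsilon> * (Q * (1 + 1 / T + R)) \<le> \<epsilon> * (Q\<^sup>2 * W\<^sup>2)" using e0 by (rule mult_left_mono)
    also have "\<dots> \<le> 1" using 1 True by (simp add: \<epsilon>_def X_def)
    finally show ?thesis by (simp add: mult.assoc)
  qed (simp add: \<epsilon>_def)
  then have s: "\<epsilon> * Q + \<epsilon> * Q / T + \<epsilon> * Q * R \<le> 1" by (simp add: distrib_left)
  have nn: "0 \<le> \<epsilon> * Q" "0 \<le> \<epsilon> * Q / T" "0 \<le> \<epsilon> * Q * R" using e0 Q T_pos R_nonneg by simp_all
  show "\<epsilon> * step_const K L M N \<le> 1" "\<epsilon> * step_const K L M N * R \<le> 1"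
    using s nn unfolding Q_def[symmetric] by linarith+
  have "\<epsilon> * Q / T \<le> 1" using s nn by linarith
  then show "\<epsilon> * step_const K L M N \<le> T" using T_pos by (simp add: Q_def)
qed

lemma KTR_le: "K * T * R \<le> 1 / 16"
proof -
  have "K * (T * R) \<le> L * (T * R)"
    using K_le_L T_pos R_nonneg by (intro mult_right_mono) auto
  then show ?thesis using LTR_le by (simp only: mult.assoc)
qed

end

context hmc_pair
begin

text \<open>The net gain \<open>K T\<^sup>2 r f'(r) / 4\<close> is at least \<open>c f(r)\<close> because \<open>f_le_slope\<close> gives the factor
  \<open>z e\<^sup>-\<^sup>z\<close> with \<open>z = R\<^sub>1 / T = 5 / 2 (1 + R / T)\<close>, and \<open>e\<^sup>5\<^sup>/\<^sup>2 \<le> 25 / 2\<close> turns it into the one in \<open>c\<close>.\<close>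

lemma far_contraction:
  assumes h: "adj \<Longrightarrow> h \<le> step_bound adj K L M N R T R\<^sub>2 d" and R2: "0 < R\<^sub>2"
    and far: "2 * R \<le> r" and a: "a = 1 / T" and R1: "R\<^sub>1 = 5 / 2 * (R + T)"
    and c: "c \<le> 1 / 20 * K * T\<^sup>2 * (1 + R / T) * exp (- (R / (2 * T))) * exp (- (2 * R / T))"
  shows "integrable (coupling_measure d) (\<lambda>\<omega>. f (new_dist \<gamma> \<omega>)) \<and>
    (\<integral>\<omega>. f (new_dist \<gamma> \<omega>) \<partial>coupling_measure d) \<le> (1 - c) * f r"
proof -
  define G where "G = 51 / 200 * K * T\<^sup>2 * r"
  define \<epsilon> where "\<epsilon> = \<theta> * (R\<^sub>2\<^sup>2 + real d)\<^sup>2"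
  define Q where "Q = step_const K L M N"
  note small = step_small[OF R2 h, folded \<theta>_def, folded \<epsilon>_def Q_def]
  note E = synchronous_expectation_le[OF far, where \<gamma>=\<gamma>, folded G_def]
  have p: "0 \<le> K * T\<^sup>2 * r" using K_pos r_pos by simp
  have "\<theta> * (G * energy_const + r * T * D * energy_diff_const) * (1000 * (R\<^sub>2\<^sup>2 + real d)\<^sup>2)
      = 1 / 1000 * (G * (\<epsilon> * (1000000 * energy_const)) + r * T * (\<epsilon> * (1000000 * (D * energy_diff_const))))"
    by (simp add: \<epsilon>_def algebra_simps)
  also have "\<dots> \<le> 1 / 1000 * (G * 1 + r * T * (K * T))"
  proof (intro mult_left_mono add_mono)
    show "\<epsilon> * (1000000 * energy_const) \<le> 1"
      using mult_left_mono[OF step_const_ge(1) small(1)] small(2) by (simp add: Q_def)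
    have "\<epsilon> * (1000000 * (D * energy_diff_const)) \<le> K * (\<epsilon> * Q)"
      using mult_left_mono[OF step_const_ge(2) small(1)] by (simp add: Q_def mult_ac)
    also have "\<dots> \<le> K * T" using small(3) K_pos by (intro mult_left_mono) auto
    finally show "\<epsilon> * (1000000 * (D * energy_diff_const)) \<le> K * T" .
  qed (use r_pos T_pos K_pos in \<open>auto simp: G_def\<close>)
  also have "\<dots> \<le> 1 / 200 * (K * T\<^sup>2 * r)"
    using p by (simp add: G_def power2_eq_square mult_ac)
  finally have "- G + \<theta> * (G * energy_const + r * T * D * energy_diff_const) * (1000 * (R\<^sub>2\<^sup>2 + real d)\<^sup>2)
      \<le> - (1 / 4) * (K * T\<^sup>2 * r)" by (simp add: G_def)
  then have "slope r * (- G + \<theta> * (G * energy_const + r * T * D * energy_diff_const) * (1000 * (R\<^sub>2\<^sup>2 + real d)\<^sup>2))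
      \<le> slope r * (- (1 / 4) * (K * T\<^sup>2 * r))" by (intro mult_left_mono) auto
  moreover have "c * f r \<le> 1 / 4 * (K * T\<^sup>2) * (r * slope r)"
  proof -
    define z where "z = a * R\<^sub>1"
    have z: "z = 5 / 2 * (1 + R / T)" using T_pos by (simp add: z_def a R1 field_simps)
    have "exp (- (R / (2 * T))) * exp (- (2 * R / T)) = exp (5 / 2) * exp (- z)"
      using T_pos by (simp add: z exp_add[symmetric] field_simps)
    then have "c \<le> 1 / 20 * K * T\<^sup>2 * (1 + R / T) * (exp (5 / 2) * exp (- z))" using c by (simp add: mult.assoc)
    also have "\<dots> \<le> 1 / 20 * K * T\<^sup>2 * (1 + R / T) * (25 / 2 * exp (- z))"
      using K_pos T_pos R_nonneg exp_five_halves by (intro mult_left_mono mult_right_mono) auto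
    also have "\<dots> = 1 / 4 * (K * T\<^sup>2) * (z * exp (- z))" by (simp add: z)
    finally have "c * f r \<le> 1 / 4 * (K * T\<^sup>2) * (z * exp (- z)) * f r"
      by (rule mult_right_mono) (rule f_nonneg)
    also have "\<dots> = 1 / 4 * (K * T\<^sup>2) * (z * exp (- z) * f r)" by (simp add: mult_ac)
    also have "\<dots> \<le> 1 / 4 * (K * T\<^sup>2) * (r * slope r)"
      using f_le_slope[of r] r_pos K_pos unfolding z_def by (intro mult_left_mono) auto
    finally show ?thesis .
  qed
  moreover have "slope r * (- (1 / 4) * (K * T\<^sup>2 * r)) = - (1 / 4 * (K * T\<^sup>2) * (r * slope r))"
    by (simp add: mult_ac)
  ultimately have "(\<integral>\<omega>. f (new_dist \<gamma> \<omega>) \<partial>coupling_measure d) \<le> f r - c * f r"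
    using E(2) by linarith
  then show ?thesis using E(1) by (simp add: left_diff_distrib)
qed

text \<open>The net gain \<open>\<gamma> T r f'(r) / 10\<close> is at least \<open>c f(r)\<close>: if \<open>\<gamma> T = T / (4 R)\<close> is small, then so is the
  second term of the minimum in \<open>c\<close>, since \<open>K T R \<le> 1 / 16\<close> and \<open>(1 + t) e\<^sup>-\<^sup>t\<^sup>/\<^sup>2 \<le> 2\<close>.\<close>

lemma near_contraction:
  assumes h: "adj \<Longrightarrow> h \<le> step_bound adj K L M N R T R\<^sub>2 d" and R2: "0 < R\<^sub>2"
    and near: "r < 2 * R" and a: "a = 1 / T" and R1: "R\<^sub>1 = 5 / 2 * (R + T)"
    and \<gamma>: "\<gamma> = min (1 / T) (1 / R / 4)"
    and c: "c = 1 / 10 * min 1 (1 / 2 * K * T\<^sup>2 * (1 + R / T) * exp (- (R / (2 * T)))) * exp (- (2 * R / T))"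
  shows "integrable (coupling_measure d) (\<lambda>\<omega>. f (new_dist \<gamma> \<omega>)) \<and>
    (\<integral>\<omega>. f (new_dist \<gamma> \<omega>) \<partial>coupling_measure d) \<le> (1 - c) * f r"
proof -
  have R: "0 < R" using near r_pos by simp
  have \<gamma>0: "0 < \<gamma>" using R T_pos by (simp add: \<gamma>)
  have \<gamma>T: "\<gamma> * T = min 1 (T / (4 * R))" using R T_pos by (auto simp: \<gamma> min_def field_simps)
  have \<gamma>T1: "\<gamma> * T \<le> 1" by (simp add: \<gamma>T)
  have \<gamma>r: "\<gamma> * r \<le> 1 / 2"
  proof -
    have "\<gamma> * r \<le> (1 / R / 4) * (2 * R)" using \<gamma>0 near r_pos R by (intro mult_mono) (auto simp: \<gamma>)
    then show ?thesis using R by simp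
  qed
  have LT\<gamma>: "L * T\<^sup>2 \<le> \<gamma> * T / 4"
  proof -
    have "L * T\<^sup>2 * (16 * R) \<le> T"
      using mult_right_mono[OF LTR_le, of "16 * T"] T_pos by (simp add: power2_eq_square mult_ac)
    then have "L * T\<^sup>2 \<le> T / (4 * R) / 4" using R by (simp add: field_simps)
    with LT_le(1) show ?thesis unfolding \<gamma>T by (simp add: min_def)
  qed
  define b where "b = \<gamma> * r"
  have b0: "0 < b" using \<gamma>0 r_pos by (simp add: b_def)
  have rb: "r \<le> b * (T + 4 * R)"
  proof -
    have "1 \<le> \<gamma> * (T + 4 * R)"
      using R T_pos by (cases "1 / T \<le> 1 / R / 4") (auto simp: \<gamma> min_def field_simps)
    from mult_right_mono[OF this, of r] r_pos show ?thesis by (simp add: b_def mult_ac)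
  qed
  define \<epsilon> where "\<epsilon> = \<theta> * (R\<^sub>2\<^sup>2 + real d)\<^sup>2"
  define Q where "Q = step_const K L M N"
  note small = step_small[OF R2 h, folded \<theta>_def, folded \<epsilon>_def Q_def]
  interpret near_pair d U L M N K R T h n a R\<^sub>1 adj x y R\<^sub>2 r \<gamma> b
    by unfold_locales (use a R R1 near \<gamma>0 \<gamma>T1 \<gamma>r LT\<gamma> b_def in auto)
  note E = reflection_expectation_le
  define A B where "A = energy_const" and "B = energy_diff_const"
  have AB: "0 \<le> A" "0 \<le> B" using energy_consts_nonneg by (simp_all add: A_def B_def)
  have "T * b * A + r * T * D * B + 2 * (T * b) * D * A
      \<le> (T * b) * ((1 + R) * (A + 2 * D * A + (D + 4) * D * B))"
  proof -
    have "r \<le> b * ((1 + R) * (D + 4))"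
    proof (rule order_trans[OF rb mult_left_mono])
      have "0 \<le> R * D" using R D_ge by simp
      then show "T + 4 * R \<le> (1 + R) * (D + 4)" using D_ge by (simp add: algebra_simps)
    qed (use b0 in simp)
    then have "r * (T * D * B) \<le> b * ((1 + R) * (D + 4)) * (T * D * B)"
      using T_pos D_ge AB by (intro mult_right_mono) auto
    then have 1: "r * T * D * B \<le> (T * b) * ((1 + R) * ((D + 4) * D * B))" by (simp add: mult_ac)
    have "(T * b) * (1 * (A + 2 * D * A)) \<le> (T * b) * ((1 + R) * (A + 2 * D * A))"
      using T_pos b0 R AB D_ge by (intro mult_left_mono mult_right_mono) auto
    with 1 show ?thesis by (simp add: algebra_simps)
  qed
  then have "\<theta> * (T * b * A + r * T * D * B + 2 * (T * b) * D * A) * (1000 * (R\<^sub>2\<^sup>2 + real d)\<^sup>2)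
      \<le> \<theta> * ((T * b) * ((1 + R) * (A + 2 * D * A + (D + 4) * D * B))) * (1000 * (R\<^sub>2\<^sup>2 + real d)\<^sup>2)"
    by (intro mult_right_mono mult_left_mono) (auto simp: \<theta>_def)
  also have "\<dots> = 1 / 1000 * (T * b) * ((1 + R) * (\<epsilon> * (1000000 * (A + 2 * D * A + (D + 4) * D * B))))"
    by (simp add: \<epsilon>_def algebra_simps)
  also have "\<dots> \<le> 1 / 1000 * (T * b) * ((1 + R) * (\<epsilon> * Q))"
    using step_const_ge(3) small(1) T_pos b0 R unfolding A_def B_def Q_def
    by (intro mult_left_mono) auto
  also have "\<dots> \<le> 1 / 1000 * (T * b) * 2"
    using small(2,4) T_pos b0 by (intro mult_left_mono) (auto simp: algebra_simps)
  also have "\<dots> \<le> 1 / 20 * (T * b)" using T_pos b0 by simp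
  finally have err: "- (3 / 20) * (T * b) + \<theta> * (T * b * A + r * T * D * B + 2 * (T * b) * D * A) * (1000 * (R\<^sub>2\<^sup>2 + real d)\<^sup>2)
      \<le> - (1 / 10) * (T * b)" by simp
  from mult_left_mono[OF this, of "slope r"]
  have "slope r * (- (3 / 20) * (T * b) + \<theta> * (T * b * A + r * T * D * B + 2 * (T * b) * D * A) * (1000 * (R\<^sub>2\<^sup>2 + real d)\<^sup>2))
      \<le> - (1 / 10 * (T * b) * slope r)" by (simp add: mult_ac)
  moreover have "c * f r \<le> 1 / 10 * (T * b) * slope r"
  proof -
    define \<mu> where "\<mu> = min 1 (1 / 2 * K * T\<^sup>2 * (1 + R / T) * exp (- (R / (2 * T))))"
    have "\<mu> \<le> \<gamma> * T"
    proof -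
      have "1 + R / T \<le> 2 * exp (R / (2 * T))"
      proof -
        have "R / (2 * T) = R / T / 2" by simp
        then show ?thesis using exp_ge_add_one_self[of "R / (2 * T)"] by linarith
      qed
      then have "(1 + R / T) * exp (- (R / (2 * T))) \<le> 2 * exp (R / (2 * T)) * exp (- (R / (2 * T)))"
        by (intro mult_right_mono) auto
      also have "\<dots> = 2" by (simp add: exp_add[symmetric] mult.assoc)
      finally have "1 / 2 * K * T\<^sup>2 * ((1 + R / T) * exp (- (R / (2 * T)))) \<le> 1 / 2 * K * T\<^sup>2 * 2"
        using K_pos by (intro mult_left_mono) auto
      also have "\<dots> \<le> T / (4 * R)"
        using mult_right_mono[OF KTR_le, of "4 * T"] R T_pos by (simp add: field_simps power2_eq_square)
      finally have "\<mu> \<le> T / (4 * R)" unfolding \<mu>_def mult.assoc[symmetric] by (rule min.coboundedI2)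
      then show ?thesis unfolding \<gamma>T by (simp add: \<mu>_def)
    qed
    have \<mu>0: "0 \<le> \<mu>" using K_pos R T_pos by (simp add: \<mu>_def)
    have e: "exp (- (2 * R / T)) \<le> slope r"
    proof -
      have "min r R\<^sub>1 \<le> 2 * R" using near by simp
      then show ?thesis using T_pos by (simp add: a divide_right_mono)
    qed
    have "c * f r = 1 / 10 * (\<mu> * exp (- (2 * R / T)) * f r)" by (simp add: c \<mu>_def)
    also have "\<dots> \<le> 1 / 10 * (\<gamma> * T * slope r * r)"
      using \<open>\<mu> \<le> \<gamma> * T\<close> \<mu>0 e f_le[of r] f_nonneg r_pos \<gamma>0 T_pos
      by (intro mult_left_mono mult_mono mult_nonneg_nonneg) auto
    finally show ?thesis by (simp add: b_def mult_ac)
  qed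
  ultimately have "(\<integral>\<omega>. f (new_dist \<gamma> \<omega>) \<partial>coupling_measure d) \<le> f r - c * f r"
    using E(2)[folded A_def B_def] by linarith
  then show ?thesis using E(1) by (simp add: left_diff_distrib)
qed

end

lemma transition_contraction:
  assumes d: "d \<ge> 1" and pot: "potential d U L M N K R" and T: "T > 0" and R2: "R\<^sub>2 > 0" and h1: "h\<^sub>1 > 0"
    and small: "L * (T + h\<^sub>1)\<^sup>2 \<le> min (K / L) (1 / 4)" "R > 0 \<Longrightarrow> L * (T + h\<^sub>1)\<^sup>2 \<le> 1 / (256 * L * R\<^sup>2)"
    and h: "0 < h" "h \<le> step_bound adj K L M N R T R\<^sub>2 d" "T / h \<in> \<int>"
    and x: "x \<in> Rd d" "vnorm d x \<le> R\<^sub>2" and y: "y \<in> Rd d" "vnorm d y \<le> R\<^sub>2"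
    and R1: "R\<^sub>1 = 5 / 2 * (R + T)"
    and \<gamma>: "\<gamma> = (if R = 0 then 1 / T else min (1 / T) (1 / R / 4))"
    and c: "c = 1 / 10 * min 1 (1 / 2 * K * T\<^sup>2 * (1 + R / T) * exp (- (R / (2 * T)))) * exp (- (2 * R / T))"
  defines "f \<equiv> concave_metric (1 / T) R\<^sub>1"
  shows "integrable (coupling_measure d) (\<lambda>\<omega>. f (coupled_distance adj d U h T R \<gamma> x y \<omega>)) \<and>
    (\<integral>\<omega>. f (coupled_distance adj d U h T R \<gamma> x y \<omega>) \<partial>coupling_measure d)
      \<le> (1 - c) * f (vdist d x y)"
proof -
  interpret smooth_potential d U L M N K R by unfold_locales fact+
  obtain k where k: "T / h = of_int k" using h(3) by (auto simp: Ints_def)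
  have "0 < T / h" using T h by simp
  then have k0: "0 < k" unfolding k by simp
  define n where "n = nat k"
  have Tn: "T = real n * h" using k k0 h by (simp add: n_def field_simps)
  have "T\<^sup>2 \<le> (T + h\<^sub>1)\<^sup>2" using T h1 by (intro power_mono) auto
  then have LT: "L * T\<^sup>2 \<le> L * (T + h\<^sub>1)\<^sup>2" using L_pos by simp
  have LTR: "L * T * R \<le> 1 / 16"
  proof (cases "R = 0")
    case False
    then have R: "0 < R" using R_nonneg by simp
    have "L * T\<^sup>2 \<le> 1 / (256 * L * R\<^sup>2)" using LT small(2)[OF R] by linarith
    then have "(L * T * R)\<^sup>2 \<le> (1 / 16)\<^sup>2" using L_pos R by (simp add: field_simps power2_eq_square)
    then show ?thesis by (rule power2_le_imp_le) simp
  qed simp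
  interpret hmc_potential d U L M N K R T h n
    by unfold_locales (use h T Tn LT small(1) LTR in auto)
  define r where "r = vdist d x y"
  have hb: "adj \<Longrightarrow> h \<le> step_bound adj K L M N R T R\<^sub>2 d" using h(2) by simp
  have R1_pos: "0 < R\<^sub>1" using R1 R_nonneg T by simp
  have pair: "hmc_pair d U L M N K R T h n (1 / T) R\<^sub>1 x y R\<^sub>2 r" if "0 < r"
    by unfold_locales (use T R1_pos x y R2 r_def that in auto)
  consider "r = 0" | "0 < r" "2 * R \<le> r" | "0 < r" "r < 2 * R"
    using L2_set_nonneg[of "\<lambda>i. x i - y i" "{..<d}"] unfolding r_def by linarith
  then show ?thesis
  proof cases
    case 1
    then have "x = y" using x y by (intro Rd_eqI[of x d y]) (auto simp: r_def L2_set_eq_0_iff)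
    (* Both branches of the velocity coupling return the velocity itself. *)
    have cv: "coupled_velocity d R \<gamma> y y \<xi> u' = \<xi>" if "\<xi> \<in> Rd d" for \<xi> u'
      using that by (auto simp: coupled_velocity_def Let_def Rd_def PiE_def extensional_restrict)
    have zero: "coupled_distance adj d U h T R \<gamma> x y \<omega> = 0" if "\<omega> \<in> space (coupling_measure d)" for \<omega>
    proof -
      obtain \<xi> u u' where \<omega>: "\<omega> = (\<xi>, u, u')" by (cases \<omega>) auto
      then have "\<xi> \<in> Rd d" using that by (auto simp: coupling_measure_def space_pair_measure space_gaussian)
      then show ?thesis unfolding \<omega> \<open>x = y\<close> by (simp add: coupled_distance_def cv L2_set_def)
    qed
    have f0: "f 0 = 0" by (simp add: f_def concave_metric_def)
    have "integrable (coupling_measure d) (\<lambda>\<omega>. f (coupled_distance adj d U h T R \<gamma> x y \<omega>))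
        \<longleftrightarrow> integrable (coupling_measure d) (\<lambda>\<omega>. 0 :: real)"
      by (intro Bochner_Integration.integrable_cong refl) (simp add: zero f0)
    moreover have "(\<integral>\<omega>. f (coupled_distance adj d U h T R \<gamma> x y \<omega>) \<partial>coupling_measure d)
        = (\<integral>\<omega>. 0 \<partial>coupling_measure d)"
      by (intro Bochner_Integration.integral_cong refl) (simp add: zero f0)
    ultimately show ?thesis using 1 f0 by (simp add: r_def)
  next
    case 2
    have "c \<le> 1 / 20 * K * T\<^sup>2 * (1 + R / T) * exp (- (R / (2 * T))) * exp (- (2 * R / T))"
    proof -
      define X where "X = 1 / 2 * K * T\<^sup>2 * (1 + R / T) * exp (- (R / (2 * T)))"
      have "c \<le> 1 / 10 * X * exp (- (2 * R / T))"
        unfolding c X_def[symmetric] by (intro mult_right_mono mult_left_mono) auto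
      then show ?thesis by (simp add: X_def)
    qed
    from hmc_pair.far_contraction[OF pair[OF 2(1)] hb R2 2(2) refl R1 this]
    show ?thesis unfolding f_def r_def[symmetric] .
  next
    case 3
    then have "\<gamma> = min (1 / T) (1 / R / 4)" using \<gamma> by simp
    from hmc_pair.near_contraction[OF pair[OF 3(1)] hb R2 3(2) refl R1 this c]
    show ?thesis unfolding f_def r_def[symmetric] .
  qed
qed

theorem theorem2p4:
  shows "\<exists>hstar :: bool \<Rightarrow> real \<Rightarrow> real \<Rightarrow> real \<Rightarrow> real \<Rightarrow> real \<Rightarrow> real \<Rightarrow> real \<Rightarrow> nat \<Rightarrow> real.
    (\<forall>adj K L M N R T R\<^sub>2 d. hstar adj K L M N R T R\<^sub>2 d > 0) \<and>
    (\<forall>adj K L M N R T R\<^sub>2 h\<^sub>1 d U.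
       d \<ge> 1 \<and> potential d U L M N K R \<and> T > 0 \<and> R\<^sub>2 > 0 \<and> h\<^sub>1 > 0 \<and>
       L * (T + h\<^sub>1)\<^sup>2 \<le> min (K / L) (1 / 4) \<and>
       (R > 0 \<longrightarrow> L * (T + h\<^sub>1)\<^sup>2 \<le> 1 / (256 * L * R\<^sup>2)) \<longrightarrow>
       (let a = 1 / T;
            R\<^sub>1 = 5 / 2 * (R + T);
            \<gamma> = (if R = 0 then 1 / T else min (1 / T) (1 / R / 4));
            f = concave_metric a R\<^sub>1;
            c = 1 / 10 * min 1 (1 / 2 * K * T\<^sup>2 * (1 + R / T) * exp (- (R / (2 * T))))
                  * exp (- (2 * R / T))
        in (\<forall>h x y.
              0 < h \<and> h \<le> min (hstar adj K L M N R T R\<^sub>2 d) h\<^sub>1 \<and> T / h \<in> \<int> \<and>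
              x \<in> Rd d \<and> y \<in> Rd d \<and> max (vnorm d x) (vnorm d y) \<le> R\<^sub>2 \<longrightarrow>
              integrable (coupling_measure d) (\<lambda>\<omega>. f (coupled_distance adj d U h T R \<gamma> x y \<omega>)) \<and>
              (\<integral>\<omega>. f (coupled_distance adj d U h T R \<gamma> x y \<omega>) \<partial>coupling_measure d)
                \<le> (1 - c) * f (vdist d x y)))) \<and>
    (\<forall>K L M N. K > 0 \<and> L > 0 \<and> M \<ge> 0 \<and> N \<ge> 0 \<longrightarrow>
       (\<exists>C>0. \<forall>R T R\<^sub>2 d. R \<ge> 0 \<and> T > 0 \<and> R\<^sub>2 > 0 \<and> d \<ge> 1 \<longrightarrow>
          inverse (hstar False K L M N R T R\<^sub>2 d) \<le> C * R\<^sub>2 \<and>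
          inverse (hstar True K L M N R T R\<^sub>2 d)
            \<le> C * ((1 + T powr (- 1 / 2) + R powr (1 / 2)) * (R\<^sub>2\<^sup>2 + real d))))"
proof (rule exI[of _ step_bound], intro conjI, goal_cases)
  case 1
  show ?case by (intro allI step_bound_pos)
next
  case 2
  show ?case
  proof (unfold Let_def, intro allI impI, elim conjE, goal_cases)
    case (1 adj K L M N R T R\<^sub>2 h\<^sub>1 d U h x y)
    then show ?case
      by (intro transition_contraction[where R\<^sub>2=R\<^sub>2 and h\<^sub>1=h\<^sub>1 and L=L and M=M and N=N and K=K] refl) simp_all
  qed
next
  case 3
  show ?case by (intro allI impI step_bound_order)
qed

end
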